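(* Let $k\ge 1$ be an integer and let $F\subseteq \mathrm{SL}_k(\mathbb{R})$ be the fundamental domain for the right action of $\mathrm{SL}_k(\mathbb{Z})$ described in the context. Then the limit $\mu_{\mathbb{Z}}(I\cdot F)$ exists and $$\mathrm{vol}(I\cdot F)=\mu_{\mathbb{Z}}(I\cdot F).$$
   Context: $M_k(\mathbb{R})\cong\mathbb{R}^{k^2}$ is the Euclidean space of real $k\times k$ matrices, with Lebesgue measure $\mathrm{vol}$ and with integer lattice $M_k(\mathbb{Z})\cong\mathbb{Z}^{k^2}$. The set $F$ is obtained as follows: in each orbit $g\,\mathrm{SL}_k(\mathbb{Z})$, $g\in\mathrm{SL}_k(\mathbb{R})$, choose the element closest to the identity matrix in the standard Euclidean norm on $M_k(\mathbb{R})$, ties being broken by choosing the smallest element in a fixed lexicographic order on $M_k(\mathbb{R})$; $F$ is the set of chosen elements. With $I=[0,1]$, $I\cdot F=\{tB : B\in F,\ 0\le t\le 1\}$. For a subset $U\subseteq\mathbb{R}^n$ and $r>0$ put $N_r(U)=r^n\cdot\#(U\cap r\mathbb{Z}^n)$ and $\mu_{\mathbb{Z}}(U)=\lim_{r\to0^+}N_r(U)$ if the limit exists, possibly equal to $+\infty$; an equation involving $\mu_{\mathbb{Z}}(U)$ includes the assertion that the limit exists. *)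

theory Defs
  imports "HOL-Analysis.Analysis"
begin

definition SL_real :: "(real ^ 'n ^ 'n) set" where
  "SL_real = {A. det A = 1}"

definition SL_int :: "(real ^ 'n ^ 'n) set" where
  "SL_int = {A. det A = 1 \<and> (\<forall>i j. A $ i $ j \<in> \<int>)}"

definition SL_orbit :: "real ^ 'n ^ 'n \<Rightarrow> (real ^ 'n ^ 'n) set" where
  "SL_orbit g = {g ** \<gamma> | \<gamma>. \<gamma> \<in> SL_int}"

text \<open>A lexicographic order on matrices depends on an ordering of the matrix entries;
  \<open>e\<close> lists the index pairs (row, column) in that order, as \<open>e 0, \<dots>, e (k\<^sup>2 - 1)\<close>.\<close>

definition entry_enum :: "(nat \<Rightarrow> 'n::finite \<times> 'n) \<Rightarrow> bool" where
  "entry_enum e \<longleftrightarrow> bij_betw e {..<CARD('n)^2} UNIV"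

definition entry :: "real ^ 'n ^ 'n \<Rightarrow> 'n \<times> 'n \<Rightarrow> real" where
  "entry A p = A $ fst p $ snd p"

definition lex_less :: "(nat \<Rightarrow> 'n::finite \<times> 'n) \<Rightarrow> real ^ 'n ^ 'n \<Rightarrow> real ^ 'n ^ 'n \<Rightarrow> bool" where
  "lex_less e A B \<longleftrightarrow>
     (\<exists>m<CARD('n)^2. entry A (e m) < entry B (e m) \<and> (\<forall>l<m. entry A (e l) = entry B (e l)))"

text \<open>The norm of \<^typ>\<open>real ^ 'n ^ 'n\<close> is the Euclidean norm of the vector of all entries.\<close>

definition closest_to_id :: "real ^ 'n ^ 'n \<Rightarrow> (real ^ 'n ^ 'n) set" where
  "closest_to_id g =
     {A \<in> SL_orbit g. \<forall>B \<in> SL_orbit g. norm (A - mat 1) \<le> norm (B - mat 1)}"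

definition fund_domain :: "(nat \<Rightarrow> 'n::finite \<times> 'n) \<Rightarrow> (real ^ 'n ^ 'n) set" where
  "fund_domain e =
     {A. \<exists>g \<in> SL_real. A \<in> closest_to_id g \<and>
           (\<forall>B \<in> closest_to_id g. B = A \<or> lex_less e A B)}"

definition unit_cone :: "'a::real_vector set \<Rightarrow> 'a set" where
  "unit_cone U = {t *\<^sub>R x | t x. x \<in> U \<and> 0 \<le> t \<and> t \<le> 1}"

definition int_lattice :: "'a::euclidean_space set" where
  "int_lattice = {x. \<forall>b \<in> Basis. x \<bullet> b \<in> \<int>}"

lemma int_lattice_matrix:
  "(int_lattice :: (real ^ 'n ^ 'm) set) = {A. \<forall>i j. A $ i $ j \<in> \<int>}"
  by (auto simp: int_lattice_def Basis_vec_def inner_axis)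

text \<open>The cardinality is taken with respect to the counting measure, so that it is \<open>\<infinity>\<close>
  (and not 0) when \<open>U \<inter> r\<int>\<^sup>n\<close> is infinite.\<close>

definition lattice_count :: "'a::euclidean_space set \<Rightarrow> real \<Rightarrow> ennreal" where
  "lattice_count U r =
     ennreal (r ^ DIM('a)) * emeasure (count_space UNIV) (U \<inter> (\<lambda>x. r *\<^sub>R x) ` int_lattice)"

definition has_mu_Z :: "'a::euclidean_space set \<Rightarrow> bool" where
  "has_mu_Z U \<longleftrightarrow> (\<exists>L. (lattice_count U \<longlongrightarrow> L) (at_right 0))"

definition mu_Z :: "'a::euclidean_space set \<Rightarrow> ennreal" where
  "mu_Z U = Lim (at_right 0) (lattice_count U)"

end

theory Submission
  imports Defs
begin

text \<open>
  Write \<open>k = CARD('n)\<close> and let \<open>C\<close> be the cone over the fundamental domain. Rounding every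
  coordinate of a point down to a multiple of \<open>r\<close> (\<open>grid_floor\<close>) shows that the lattice count
  \<open>N\<^sub>r(C)\<close> is the Lebesgue measure of the set of all \<open>y\<close> with \<open>grid_floor r y \<in> C\<close>. As \<open>r\<close> tends
  to \<open>0\<close>, \<open>grid_floor r y\<close> tends to \<open>y\<close>, so for a bounded set with negligible boundary the count
  tends to the volume: Fatou's lemma bounds it from below on the interior, and the reverse Fatou
  lemma bounds it from above on the closure. For the unbounded cone \<open>C\<close> Fatou still gives the lower
  bound. The upper bound needs that the part of \<open>C\<close> outside a large ball carries few lattice points,
  uniformly in \<open>r\<close>. This reduction is \<open>lattice_count_tendsto_volume\<close>, and two facts about \<open>C\<close>
  remain.

  \<^bold>\<open>The boundary is negligible\<close> (\<open>negligible_frontier_unit_cone\<close>). Let \<open>\<delta>\<close> be the \<open>k\<close>-th root of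
  \<open>det Y\<close>. Near a matrix \<open>Y\<close> with \<open>0 < det Y < 1\<close> only finitely many \<open>\<gamma>\<close> can make \<open>Y \<gamma> / \<delta>\<close> at
  least as close to the identity as \<open>Y / \<delta>\<close>, so membership in \<open>C\<close> is locally constant at \<open>Y\<close> unless
  \<open>Y / \<delta>\<close> and some \<open>Y \<gamma> / \<delta>\<close> with \<open>\<gamma> \<noteq> 1\<close> are equally close. Such ties, like the conditions
  \<open>det Y = 0\<close> and \<open>det Y = 1\<close>, define null sets: after raising to the \<open>k\<close>-th power a tie becomes the
  vanishing of a nonzero homogeneous polynomial. There are countably many \<open>\<gamma>\<close>.

  \<^bold>\<open>No lattice points escape to infinity\<close> (\<open>unit_cone_tail\<close>). A nonzero integer matrix \<open>A\<close> with \<open>r A \<in> C\<close>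
  is determined by its orbit, that is, by the sublattice \<open>L = A \<int>\<^sup>k\<close>, of index at most \<open>r\<^sup>-\<^sup>k\<close>. The
  chosen element of an orbit is closest to the identity, so if it is far away, then so is a matrix
  whose columns form an LLL-reduced basis of \<open>L\<close>. The first column \<open>v\<close> of that matrix must then be
  short, of length less than \<open>\<epsilon> / r\<close> (\<open>exists_reduced_in_orbit\<close>, \<open>closest_reduced_basis\<close>). There are
  \<open>O((\<epsilon> / r)\<^sup>k)\<close> integer vectors \<open>v\<close> of this length. For each of them, move \<open>v\<close> to a multiple \<open>c\<close>
  of the first coordinate vector by a unimodular row operation. Thereby a lattice that has \<open>v\<close>
  as the first vector of a basis gets a Hermite normal form with first diagonal entry \<open>c\<close>, and at most
  \<open>O(r\<^sup>-\<^sup>k\<^sup>(\<^sup>k\<^sup>-\<^sup>1\<^sup>))\<close> such forms have determinant at most \<open>r\<^sup>-\<^sup>k\<close> (\<open>card_hermite_le\<close>). Multiplying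
  with the normalisation \<open>r\<close> to the power \<open>k\<^sup>2\<close> leaves \<open>O(\<epsilon>\<^sup>k)\<close>, independently of \<open>r\<close>.
\<close>

section \<open>Lattice counts and Lebesgue measure\<close>

definition grid_floor :: "real \<Rightarrow> 'a::euclidean_space \<Rightarrow> 'a" where
  "grid_floor r y = (\<Sum>b\<in>Basis. (r * of_int \<lfloor>(y \<bullet> b) / r\<rfloor>) *\<^sub>R b)"

lemma grid_floor_inner [simp]:
  "b \<in> Basis \<Longrightarrow> grid_floor r y \<bullet> b = r * of_int \<lfloor>(y \<bullet> b) / r\<rfloor>"
  by (simp add: grid_floor_def)

lemma grid_floor_near:
  fixes y :: "'a::euclidean_space"
  assumes "r > 0"
  shows "norm (grid_floor r y - y) \<le> real DIM('a) * r"
proof -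
  have "\<bar>(grid_floor r y - y) \<bullet> b\<bar> \<le> r" if "b \<in> Basis" for b
  proof -
    define z where "z = (y \<bullet> b) / r"
    have "y \<bullet> b = r * z" using assms by (simp add: z_def)
    moreover have "\<bar>of_int \<lfloor>z\<rfloor> - z\<bar> \<le> 1" by linarith
    hence "\<bar>r * (of_int \<lfloor>z\<rfloor> - z)\<bar> \<le> r" using assms by (simp add: abs_mult)
    ultimately show ?thesis using that by (simp add: inner_diff_left z_def right_diff_distrib)
  qed
  then have "(\<Sum>b\<in>Basis. \<bar>(grid_floor r y - y) \<bullet> b\<bar>) \<le> (\<Sum>b\<in>(Basis::'a set). r)"
    by (intro sum_mono)
  then show ?thesis using norm_le_l1[of "grid_floor r y - y"] by simp
qed

text \<open>The fibre of \<open>grid_floor r\<close> over a lattice point is a half-open cube of side \<open>r\<close>. These cubes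
  tile the space, which turns counting lattice points into measuring a set.\<close>

lemma grid_floor_eq_iff:
  fixes y x :: "'a::euclidean_space"
  assumes "r > 0" "x \<in> (\<lambda>x. r *\<^sub>R x) ` int_lattice"
  shows "grid_floor r y = x \<longleftrightarrow> (\<forall>b\<in>Basis. x \<bullet> b \<le> y \<bullet> b \<and> y \<bullet> b < x \<bullet> b + r)"
proof -
  have "r * of_int \<lfloor>(y \<bullet> b) / r\<rfloor> = x \<bullet> b \<longleftrightarrow> x \<bullet> b \<le> y \<bullet> b \<and> y \<bullet> b < x \<bullet> b + r"
    if b: "b \<in> Basis" for b
  proof -
    obtain z where z: "x = r *\<^sub>R z" "z \<bullet> b \<in> \<int>"
      using assms(2) b by (auto simp: int_lattice_def)
    then obtain m :: int where m: "x \<bullet> b = r * of_int m"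
      by (auto elim!: Ints_cases)
    have "r * of_int \<lfloor>(y \<bullet> b) / r\<rfloor> = x \<bullet> b \<longleftrightarrow> \<lfloor>(y \<bullet> b) / r\<rfloor> = m" using assms(1) m by simp
    also have "\<dots> \<longleftrightarrow> of_int m \<le> (y \<bullet> b) / r \<and> (y \<bullet> b) / r < of_int m + 1"
      by (simp add: floor_eq_iff)
    also have "\<dots> \<longleftrightarrow> x \<bullet> b \<le> y \<bullet> b \<and> y \<bullet> b < x \<bullet> b + r"
      using assms(1) by (simp add: m field_simps)
    finally show ?thesis .
  qed
  then show ?thesis by (subst euclidean_eq_iff) simp
qed

lemma grid_floor_in_lattice:
  fixes y :: "'a::euclidean_space"
  assumes "r > 0"
  shows "grid_floor r y \<in> (\<lambda>x. r *\<^sub>R x) ` int_lattice"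
proof
  show "grid_floor r y = r *\<^sub>R (\<Sum>b\<in>Basis. of_int \<lfloor>(y \<bullet> b) / r\<rfloor> *\<^sub>R b)"
    by (simp add: grid_floor_def scaleR_sum_right)
qed (simp add: int_lattice_def)

lemma countable_int_lattice: "countable (int_lattice :: 'a::euclidean_space set)"
proof -
  let ?f = "\<lambda>g :: 'a \<Rightarrow> int. \<Sum>b\<in>Basis. of_int (g b) *\<^sub>R b"
  have "x \<in> ?f ` (Basis \<rightarrow>\<^sub>E UNIV)" if "x \<in> int_lattice" for x
  proof
    show "x = ?f (restrict (\<lambda>b. \<lfloor>x \<bullet> b\<rfloor>) Basis)"
      using that by (auto simp: euclidean_eq_iff[of x] int_lattice_def elim!: Ints_cases)
  qed auto
  then have "(int_lattice :: 'a set) \<subseteq> ?f ` (Basis \<rightarrow>\<^sub>E UNIV)" by blast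
  moreover have "countable ((Basis :: 'a set) \<rightarrow>\<^sub>E (UNIV :: int set))"
    by (intro countable_PiE) auto
  ultimately show ?thesis by (meson countable_image countable_subset)
qed

lemma emeasure_half_open_cube:
  fixes x :: "'a::euclidean_space"
  assumes "r > 0"
  defines "Q \<equiv> {y. \<forall>b\<in>Basis. x \<bullet> b \<le> y \<bullet> b \<and> y \<bullet> b < x \<bullet> b + r}"
  shows "Q \<in> sets borel" "emeasure lborel Q = ennreal (r ^ DIM('a))"
proof -
  have "Q = (\<Inter>b\<in>Basis. {y. x \<bullet> b \<le> y \<bullet> b} \<inter> {y. y \<bullet> b < x \<bullet> b + r})"
    by (auto simp: Q_def)
  also have "\<dots> \<in> sets borel"
    by (intro sets.countable_INT'' sets.Int) (auto intro!: borel_closed borel_open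
        closed_halfspace_component_ge open_halfspace_component_lt countable_finite)
  finally show Q: "Q \<in> sets borel" .
  let ?z = "x + (\<Sum>b\<in>Basis. r *\<^sub>R b)"
  have z: "?z \<bullet> b = x \<bullet> b + r" if "b \<in> Basis" for b
    using that by (simp add: inner_add_left)
  have "emeasure lborel (box x ?z) \<le> emeasure lborel Q"
    using Q by (intro emeasure_mono) (auto simp: Q_def box_def z intro: less_imp_le)
  moreover have "emeasure lborel Q \<le> emeasure lborel (cbox x ?z)"
    by (intro emeasure_mono) (auto simp: Q_def cbox_def z intro: less_imp_le)
  moreover have "emeasure lborel (box x ?z) = ennreal (r ^ DIM('a))"
    using assms(1) by (subst emeasure_lborel_box) (auto simp: z inner_diff_left)
  moreover have "emeasure lborel (cbox x ?z) = ennreal (r ^ DIM('a))"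
    using assms(1) by (subst emeasure_lborel_cbox) (auto simp: z inner_diff_left)
  ultimately show "emeasure lborel Q = ennreal (r ^ DIM('a))" by auto
qed

text \<open>The half-open cubes over the lattice points of \<open>U\<close> are disjoint, countably many, and of volume
  \<open>r ^ DIM('a)\<close> each; their union is the preimage of \<open>U\<close>.\<close>

lemma lattice_count_eq_emeasure:
  fixes U :: "'a::euclidean_space set"
  assumes "r > 0"
  shows "{y. grid_floor r y \<in> U} \<in> sets borel"
    and "lattice_count U r = emeasure lborel {y. grid_floor r y \<in> U}"
proof -
  define I where "I = U \<inter> (\<lambda>x. r *\<^sub>R x) ` int_lattice"
  have I: "countable I" unfolding I_def by (intro countable_Int2 countable_image countable_int_lattice)
  define Q where "Q = (\<lambda>x::'a. {y::'a. grid_floor r y = x})"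
  have Q_eq: "Q x = {y. \<forall>b\<in>Basis. x \<bullet> b \<le> y \<bullet> b \<and> y \<bullet> b < x \<bullet> b + r}" if "x \<in> I" for x
    using grid_floor_eq_iff[OF assms] that by (auto simp: Q_def I_def)
  have Q: "Q x \<in> sets lborel" "emeasure lborel (Q x) = ennreal (r ^ DIM('a))" if "x \<in> I" for x
    unfolding Q_eq[OF that] using emeasure_half_open_cube[OF assms, of x] by simp_all
  have eq: "{y. grid_floor r y \<in> U} = (\<Union>x\<in>I. Q x)"
    using grid_floor_in_lattice[OF assms] by (auto simp: Q_def I_def)
  show "{y. grid_floor r y \<in> U} \<in> sets borel"
    unfolding eq using Q(1) I by (intro sets.countable_UN'') auto
  have "emeasure lborel {y. grid_floor r y \<in> U} = (\<integral>\<^sup>+x. emeasure lborel (Q x) \<partial>count_space I)"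
    unfolding eq using Q(1) I by (intro emeasure_UN_countable) (auto simp: disjoint_family_on_def Q_def)
  also have "\<dots> = (\<integral>\<^sup>+x. ennreal (r ^ DIM('a)) \<partial>count_space I)"
    by (intro nn_integral_cong) (simp add: Q(2))
  also have "\<dots> = ennreal (r ^ DIM('a)) * emeasure (count_space I) I"
    by simp
  also have "emeasure (count_space I) I = emeasure (count_space UNIV) I"
    by (cases "finite I") (auto simp: emeasure_count_space_finite emeasure_count_space_infinite)
  finally show "lattice_count U r = emeasure lborel {y. grid_floor r y \<in> U}"
    by (simp add: lattice_count_def I_def)
qed

lemma lattice_count_as_integral:
  fixes U :: "'a::euclidean_space set"
  assumes "r > 0"
  shows "(\<lambda>y. indicator U (grid_floor r y) :: ennreal) \<in> borel_measurable lborel"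
    and "lattice_count U r = (\<integral>\<^sup>+y. indicator U (grid_floor r y) \<partial>lborel)"
proof -
  have eq: "(\<lambda>y. indicator U (grid_floor r y) :: ennreal) = indicator {y. grid_floor r y \<in> U}"
    by (auto simp: indicator_def)
  show "(\<lambda>y. indicator U (grid_floor r y) :: ennreal) \<in> borel_measurable lborel"
    unfolding eq using lattice_count_eq_emeasure(1)[OF assms, of U] by simp
  show "lattice_count U r = (\<integral>\<^sup>+y. indicator U (grid_floor r y) \<partial>lborel)"
    unfolding eq using lattice_count_eq_emeasure[OF assms, of U] by simp
qed

lemma grid_floor_tendsto:
  fixes y :: "'a::euclidean_space"
  assumes "\<And>n. s n > 0" "s \<longlonglongrightarrow> 0"
  shows "(\<lambda>n. grid_floor (s n) y) \<longlonglongrightarrow> y"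
proof -
  have "(\<lambda>n. real DIM('a) * s n) \<longlonglongrightarrow> real DIM('a) * 0"
    by (intro tendsto_intros assms)
  then have lim: "(\<lambda>n. real DIM('a) * s n) \<longlonglongrightarrow> 0" by simp
  have "(\<lambda>n. grid_floor (s n) y - y) \<longlonglongrightarrow> 0"
    by (rule Lim_null_comparison[OF always_eventually lim]) (intro allI grid_floor_near assms(1))
  then show ?thesis by (simp add: LIM_zero_iff)
qed

text \<open>Fatou's lemma: at every point of an open set the rounded points eventually lie in the set. No
  boundedness is needed for this half.\<close>

lemma emeasure_open_le_liminf_lattice_count:
  fixes U :: "'a::euclidean_space set"
  assumes s: "\<And>n. s n > 0" "s \<longlonglongrightarrow> 0" and U: "open U"
  shows "emeasure lborel U \<le> liminf (\<lambda>n. lattice_count U (s n))"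
proof -
  have "emeasure lborel U = (\<integral>\<^sup>+y. indicator U y \<partial>lborel)" using U by simp
  also have "\<dots> \<le> (\<integral>\<^sup>+y. liminf (\<lambda>n. indicator U (grid_floor (s n) y)) \<partial>lborel)"
  proof (intro nn_integral_mono)
    fix y :: 'a
    show "indicator U y \<le> (liminf (\<lambda>n. indicator U (grid_floor (s n) y)) :: ennreal)"
    proof (cases "y \<in> U")
      case True
      have "eventually (\<lambda>n. grid_floor (s n) y \<in> U) sequentially"
        using topological_tendstoD[OF grid_floor_tendsto[OF s] U True] .
      then show ?thesis using True by (intro Liminf_bounded) (auto elim!: eventually_mono)
    qed simp
  qed
  also have "\<dots> \<le> liminf (\<lambda>n. \<integral>\<^sup>+y. indicator U (grid_floor (s n) y) \<partial>lborel)"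
    by (intro nn_integral_liminf lattice_count_as_integral(1) s)
  finally show ?thesis by (simp add: lattice_count_as_integral(2)[OF s(1)])
qed

text \<open>The reverse Fatou lemma: a point outside a closed set is eventually rounded to a point outside
  it. Boundedness supplies the integrable majorant, the indicator of a ball that contains every point
  that can be rounded into \<open>K\<close> with mesh below \<open>1\<close>.\<close>

lemma limsup_lattice_count_le_emeasure_compact:
  fixes K :: "'a::euclidean_space set"
  assumes s: "\<And>n. s n > 0" "s \<longlonglongrightarrow> 0" and s1: "\<And>n. s n < 1" and K: "compact K"
  shows "limsup (\<lambda>n. lattice_count K (s n)) \<le> emeasure lborel K"
proof -
  obtain B where B: "\<And>x. x \<in> K \<Longrightarrow> norm x \<le> B"
    using compact_imp_bounded[OF K] by (auto simp: bounded_iff)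
  define W where "W = cball (0::'a) (B + DIM('a))"
  have in_W: "y \<in> W" if "grid_floor (s n) y \<in> K" for y n
  proof -
    have "norm (grid_floor (s n) y - y) \<le> real DIM('a) * s n" by (rule grid_floor_near[OF s(1)])
    also have "\<dots> \<le> real DIM('a) * 1" using s1[of n] by (intro mult_left_mono) auto
    finally have "norm (grid_floor (s n) y - y) \<le> real DIM('a)" by simp
    then show ?thesis
      using B[OF that] norm_triangle_ineq4[of "grid_floor (s n) y" "grid_floor (s n) y - y"]
      by (simp add: W_def)
  qed
  have "limsup (\<lambda>n. lattice_count K (s n)) = limsup (\<lambda>n. \<integral>\<^sup>+y. indicator K (grid_floor (s n) y) \<partial>lborel)"
    by (simp add: lattice_count_as_integral(2)[OF s(1)])
  also have "\<dots> \<le> (\<integral>\<^sup>+y. limsup (\<lambda>n. indicator K (grid_floor (s n) y)) \<partial>lborel)"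
  proof (rule nn_integral_limsup)
    show "(\<integral>\<^sup>+y. indicator W y \<partial>lborel) < \<infinity>"
      using emeasure_bounded_finite[of W] by (simp add: W_def)
    show "AE y in lborel. (indicator K (grid_floor (s n) y) :: ennreal) \<le> indicator W y" for n
      using in_W by (auto intro!: AE_I2 simp: indicator_def)
    show "(\<lambda>y. indicator K (grid_floor (s n) y) :: ennreal) \<in> borel_measurable lborel" for n
      by (rule lattice_count_as_integral(1)[OF s(1)])
    show "(indicator W :: 'a \<Rightarrow> ennreal) \<in> borel_measurable lborel"
      by (intro borel_measurable_indicator) (simp add: W_def)
  qed
  also have "\<dots> \<le> (\<integral>\<^sup>+y. indicator K y \<partial>lborel)"
  proof (intro nn_integral_mono)
    fix y :: 'a
    show "(limsup (\<lambda>n. indicator K (grid_floor (s n) y)) :: ennreal) \<le> indicator K y"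
    proof (cases "y \<in> K")
      case True
      then show ?thesis by (intro Limsup_bounded) (auto simp: indicator_def)
    next
      case False
      then have "eventually (\<lambda>n. grid_floor (s n) y \<in> - K) sequentially"
        using topological_tendstoD[OF grid_floor_tendsto[OF s], of "-K" y] compact_imp_closed[OF K] by auto
      then show ?thesis using False by (intro Limsup_bounded) (auto elim!: eventually_mono)
    qed
  qed
  also have "\<dots> = emeasure lborel K" using K by (simp add: borel_compact)
  finally show ?thesis .
qed

lemma lattice_count_mono: "U \<subseteq> V \<Longrightarrow> lattice_count U r \<le> lattice_count V r"
  unfolding lattice_count_def by (intro mult_left_mono emeasure_mono) auto

lemma lattice_count_Un_le:
  "lattice_count (U \<union> V) r \<le> lattice_count U r + lattice_count V r"
proof -
  have "emeasure (count_space UNIV) ((U \<union> V) \<inter> L) \<le>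
      emeasure (count_space UNIV) (U \<inter> L) + emeasure (count_space UNIV) (V \<inter> L)" for L :: "'a set"
    unfolding Int_Un_distrib2 by (intro emeasure_subadditive) auto
  then show ?thesis
    unfolding lattice_count_def distrib_left[symmetric] by (intro mult_left_mono) auto
qed

text \<open>Only the tail hypothesis prevents lattice points from escaping to infinity: a set of finite
  volume with negligible boundary may contain far too many lattice points in thin cusps.\<close>

proposition lattice_count_tendsto_volume:
  fixes C :: "'a::euclidean_space set"
  assumes null: "negligible (frontier C)"
    and tail: "\<And>\<delta>. \<delta> > 0 \<Longrightarrow> \<exists>R. \<forall>r>0. lattice_count (C - cball 0 R) r \<le> ennreal \<delta>"
  shows "C \<in> sets lebesgue"
    and "(lattice_count C \<longlongrightarrow> emeasure lebesgue C) (at_right 0)"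
proof -
  have fr: "frontier C \<in> null_sets lebesgue"
    using null by (simp add: negligible_iff_null_sets)
  have "C = interior C \<union> (C \<inter> frontier C)"
    using interior_subset closure_subset by (auto simp: frontier_def)
  moreover have cf: "C \<inter> frontier C \<in> null_sets lebesgue"
    using negligible_subset[OF null, of "C \<inter> frontier C"] by (simp add: negligible_iff_null_sets)
  moreover have int_sets: "interior C \<in> sets lebesgue" by (simp add: borel_open)
  ultimately show sets: "C \<in> sets lebesgue"
    using sets.Un[OF int_sets null_setsD2[OF cf]] by simp
  have "emeasure lebesgue C = emeasure lebesgue (interior C \<union> (C \<inter> frontier C))"
    using \<open>C = interior C \<union> (C \<inter> frontier C)\<close> by simp
  also have "\<dots> = emeasure lborel (interior C)"
    using cf int_sets by (simp add: emeasure_Un_null_set)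
  finally have int: "emeasure lebesgue C = emeasure lborel (interior C)" .
  have clo: "emeasure lborel (closure C \<inter> cball 0 R) \<le> emeasure lebesgue C" for R
  proof -
    have "emeasure lborel (closure C \<inter> cball 0 R) = emeasure lebesgue (closure C \<inter> cball 0 R)"
      by simp
    also have "\<dots> \<le> emeasure lebesgue (interior C \<union> frontier C)"
      using int_sets null_setsD2[OF fr] by (intro emeasure_mono) (auto simp: frontier_def)
    also have "\<dots> = emeasure lborel (interior C)" using fr int_sets by (simp add: emeasure_Un_null_set)
    finally show ?thesis using int by simp
  qed
  show "(lattice_count C \<longlongrightarrow> emeasure lebesgue C) (at_right 0)"
  proof (rule tendsto_at_right_sequentially[of 0 1])
    fix s :: "nat \<Rightarrow> real"
    assume s: "\<And>n. 0 < s n" "\<And>n. s n < 1" "decseq s" "s \<longlonglongrightarrow> 0"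
    have "emeasure lebesgue C \<le> liminf (\<lambda>n. lattice_count (interior C) (s n))"
      unfolding int using s by (intro emeasure_open_le_liminf_lattice_count) auto
    also have "\<dots> \<le> liminf (\<lambda>n. lattice_count C (s n))"
      by (intro Liminf_mono always_eventually allI lattice_count_mono interior_subset)
    finally have lower: "emeasure lebesgue C \<le> liminf (\<lambda>n. lattice_count C (s n))" .
    have upper: "limsup (\<lambda>n. lattice_count C (s n)) \<le> emeasure lebesgue C"
    proof (rule ennreal_le_epsilon)
      fix \<delta> :: real assume "\<delta> > 0"
      then obtain R where R: "\<And>r. r > 0 \<Longrightarrow> lattice_count (C - cball 0 R) r \<le> ennreal \<delta>"
        using tail by blast
      define K where "K = closure C \<inter> cball 0 R"
      have K: "compact K" unfolding K_def by (simp add: closed_Int_compact)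
      have "lattice_count C (s n) \<le> lattice_count K (s n) + ennreal \<delta>" for n
      proof -
        have "lattice_count C (s n) \<le> lattice_count (K \<union> (C - cball 0 R)) (s n)"
          using closure_subset by (intro lattice_count_mono) (auto simp: K_def)
        also have "\<dots> \<le> lattice_count K (s n) + lattice_count (C - cball 0 R) (s n)"
          by (rule lattice_count_Un_le)
        also have "\<dots> \<le> lattice_count K (s n) + ennreal \<delta>"
          using R[OF s(1)] by (intro add_left_mono)
        finally show ?thesis .
      qed
      then have "lattice_count C (s n) \<le> ennreal \<delta> + lattice_count K (s n)" for n
        by (simp add: add.commute)
      then have "limsup (\<lambda>n. lattice_count C (s n)) \<le> limsup (\<lambda>n. ennreal \<delta> + lattice_count K (s n))"
        by (intro Limsup_mono always_eventually allI)
      also have "\<dots> = limsup (\<lambda>n. lattice_count K (s n)) + ennreal \<delta>"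
        by (subst Limsup_const_add) (auto simp: add.commute)
      also have "\<dots> \<le> emeasure lborel K + ennreal \<delta>"
        using limsup_lattice_count_le_emeasure_compact[OF s(1) s(4) s(2) K] by (intro add_right_mono)
      also have "\<dots> \<le> emeasure lebesgue C + ennreal \<delta>"
        using clo[of R] by (intro add_right_mono) (simp add: K_def)
      finally show "limsup (\<lambda>n. lattice_count C (s n)) \<le> emeasure lebesgue C + ennreal \<delta>" .
    qed
    show "(\<lambda>n. lattice_count C (s n)) \<longlonglongrightarrow> emeasure lebesgue C"
    proof (rule Liminf_eq_Limsup)
      have le: "liminf (\<lambda>n. lattice_count C (s n)) \<le> limsup (\<lambda>n. lattice_count C (s n))"
        by (rule Liminf_le_Limsup) simp
      show "liminf (\<lambda>n. lattice_count C (s n)) = emeasure lebesgue C"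
        using lower order_trans[OF le upper] by (rule antisym[rotated])
      show "limsup (\<lambda>n. lattice_count C (s n)) = emeasure lebesgue C"
        using upper order_trans[OF lower le] by (rule antisym)
    qed simp
  qed simp
qed

section \<open>Null sets of homogeneous polynomials\<close>

text \<open>On the line through \<open>x\<close> in direction \<open>V\<close> the function is a polynomial in \<open>t\<close>. It is not the zero
  polynomial, since by homogeneity \<open>f (x + t V) / t ^ m = f (x / t + V)\<close>, which tends to \<open>f V \<noteq> 0\<close> as
  \<open>t\<close> grows.\<close>

lemma finite_zeros_on_line:
  fixes f :: "'a::euclidean_space \<Rightarrow> real"
  assumes f: "real_polynomial_function f"
    and hom: "\<And>x t. f (t *\<^sub>R x) = t ^ m * f x"
    and V: "f V \<noteq> 0"
  shows "finite {t. f (x + t *\<^sub>R V) = 0}"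
proof -
  have "real_polynomial_function (f \<circ> (\<lambda>t. x + t *\<^sub>R V))"
    by (intro real_polynomial_function_compose f polynomial_function_add polynomial_function_const
        polynomial_function_bounded_linear bounded_linear_scaleR_left)
  then obtain a n where a: "\<And>t. f (x + t *\<^sub>R V) = (\<Sum>i\<le>n. a i * t ^ i)"
    unfolding real_polynomial_function_iff_sum comp_def by metis
  have "\<exists>i\<le>n. a i \<noteq> 0"
  proof (rule ccontr)
    assume "\<not> ?thesis"
    then have zero: "f (x + t *\<^sub>R V) = 0" for t by (simp add: a)
    have "f (inverse (real (Suc k)) *\<^sub>R x + V) = 0" for k
    proof -
      have "f (real (Suc k) *\<^sub>R (inverse (real (Suc k)) *\<^sub>R x + V)) = 0"
        using zero[of "real (Suc k)"] by (simp add: scaleR_add_right del: of_nat_Suc)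
      then show ?thesis by (simp add: hom)
    qed
    moreover have "isCont f (0 *\<^sub>R x + V)"
      using f by (simp add: continuous_polymonial_function real_polynomial_function_eq)
    moreover have "(\<lambda>k. inverse (real (Suc k)) *\<^sub>R x + V) \<longlonglongrightarrow> 0 *\<^sub>R x + V"
      by (intro tendsto_intros LIMSEQ_inverse_real_of_nat)
    ultimately have "(\<lambda>k. 0) \<longlonglongrightarrow> f (0 *\<^sub>R x + V)"
      using isCont_tendsto_compose by fastforce
    then show False using V by (simp add: LIMSEQ_const_iff)
  qed
  then show ?thesis unfolding a by (subst polyfun_finite_roots)
qed

text \<open>Average the measure of the zero set \<open>S\<close> over its translates by \<open>s V\<close> with \<open>0 \<le> s \<le> 1\<close>. Translation
  does not change the measure, and by Tonelli the average is the integral over \<open>x\<close> of the length of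
  \<open>{s. x + s V \<in> S}\<close>, which is a finite set.\<close>

proposition negligible_zeros_homogeneous_polynomial:
  fixes f :: "'a::euclidean_space \<Rightarrow> real"
  assumes f: "real_polynomial_function f"
    and hom: "\<And>x t. f (t *\<^sub>R x) = t ^ m * f x"
    and V: "f V \<noteq> 0"
  shows "negligible {x. f x = 0}"
proof -
  define S where "S = {x. f x = 0}"
  have "closed S"
    unfolding S_def using f
    by (intro closed_Collect_eq continuous_intros)
       (auto simp: real_polynomial_function_eq intro!: continuous_on_polymonial_function)
  then have S[measurable]: "S \<in> sets borel" by simp
  have shift: "(\<integral>\<^sup>+x. indicator S (x + s *\<^sub>R V) \<partial>lborel) = emeasure lborel S" for s
  proof -
    have "emeasure lborel S = (\<integral>\<^sup>+x. indicator S x \<partial>distr lborel borel ((+) (s *\<^sub>R V)))"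
      by (simp add: lborel_distr_plus)
    also have "\<dots> = (\<integral>\<^sup>+x. indicator S (s *\<^sub>R V + x) \<partial>lborel)"
      by (subst nn_integral_distr) auto
    finally show ?thesis by (simp add: add.commute)
  qed
  have "emeasure lborel S = (\<integral>\<^sup>+s. indicator {0..1::real} s * emeasure lborel S \<partial>lborel)"
    by (simp add: nn_integral_multc)
  also have "\<dots> = (\<integral>\<^sup>+s. \<integral>\<^sup>+x. indicator {0..1::real} s * indicator S (x + s *\<^sub>R V) \<partial>lborel \<partial>lborel)"
    by (intro nn_integral_cong) (simp add: nn_integral_cmult shift)
  also have "\<dots> = (\<integral>\<^sup>+x. \<integral>\<^sup>+s. indicator {0..1::real} s * indicator S (x + s *\<^sub>R V) \<partial>lborel \<partial>lborel)"
    by (intro lborel_pair.Fubini') measurable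
  also have "\<dots> = (\<integral>\<^sup>+(x::'a). 0 \<partial>lborel)"
  proof (intro nn_integral_cong)
    fix x :: 'a
    have fin: "finite {t. x + t *\<^sub>R V \<in> S}"
      unfolding S_def using finite_zeros_on_line[OF f hom V] by simp
    have "(\<integral>\<^sup>+s. indicator {0..1::real} s * indicator S (x + s *\<^sub>R V) \<partial>lborel) \<le>
        (\<integral>\<^sup>+s. indicator {t. x + t *\<^sub>R V \<in> S} s \<partial>lborel)"
      by (intro nn_integral_mono) (auto simp: indicator_def)
    also have "\<dots> = emeasure lborel {t. x + t *\<^sub>R V \<in> S}"
      using fin by (intro nn_integral_indicator) (simp add: finite_imp_closed borel_closed)
    also have "\<dots> = 0" using fin by (intro emeasure_lborel_countable countable_finite)
    finally show "(\<integral>\<^sup>+s. indicator {0..1::real} s * indicator S (x + s *\<^sub>R V) \<partial>lborel) = 0" by simp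
  qed
  finally have "emeasure lborel S = 0" by simp
  then have "S \<in> null_sets lborel" by auto
  then have "S \<in> null_sets lebesgue" by (rule null_sets_completionI)
  then show ?thesis by (simp add: S_def negligible_iff_null_sets)
qed


section \<open>Orbits of the integral special linear group\<close>

lemma SL_int_one [simp]: "mat 1 \<in> SL_int"
  unfolding SL_int_def by (auto, simp add: mat_def)

lemma SL_int_mult: "A \<in> SL_int \<Longrightarrow> B \<in> SL_int \<Longrightarrow> A ** B \<in> SL_int"
  unfolding SL_int_def by (auto simp: det_mul, auto simp: matrix_matrix_mult_def intro!: Ints_sum Ints_mult)

lemma det_Ints: "(\<And>i j. A $ i $ j \<in> \<int>) \<Longrightarrow> det (A :: real ^ 'n ^ 'n) \<in> \<int>"
  unfolding det_def by (intro Ints_sum Ints_mult Ints_prod) auto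

text \<open>Cramer's rule expresses the entries of the inverse as integer determinants, because the
  denominator \<open>det A\<close> is \<open>1\<close>.\<close>

lemma SL_int_inverse:
  fixes A :: "real ^ 'n ^ 'n"
  assumes "A \<in> SL_int"
  obtains B where "B \<in> SL_int" "A ** B = mat 1" "B ** A = mat 1"
proof -
  have det: "det A = 1" and int: "\<And>i j. A $ i $ j \<in> \<int>" using assms by (auto simp: SL_int_def)
  then have "invertible A" by (simp add: invertible_det_nz)
  then obtain B where B: "A ** B = mat 1" "B ** A = mat 1" by (auto simp: invertible_def)
  have "det A * det B = 1" using B(1) by (metis det_I det_mul)
  then have "det B = 1" using det by simp
  moreover have "B $ i $ j \<in> \<int>" for i j
  proof -
    have "A *v (B *v axis j 1) = axis j 1" by (simp add: matrix_vector_mul_assoc B)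
    then have "B *v axis j 1 = (\<chi> k. det (\<chi> i l. if l = k then axis j 1 $ i else A $ i $ l) / det A)"
      using cramer[of A] det by simp
    then have "(B *v axis j 1) $ i \<in> \<int>"
      using int det by (auto intro!: det_Ints simp: axis_def)
    then show ?thesis by (simp add: matrix_vector_mult_basis column_def)
  qed
  ultimately have "B \<in> SL_int" by (simp add: SL_int_def)
  then show thesis using B that by blast
qed

lemma SL_orbit_self [simp]: "A \<in> SL_orbit A"
  unfolding SL_orbit_def by (auto intro!: exI[of _ "mat 1"])

lemma SL_orbit_mult: "\<gamma> \<in> SL_int \<Longrightarrow> A ** \<gamma> \<in> SL_orbit A"
  by (auto simp: SL_orbit_def)

lemma SL_orbit_trans: "B \<in> SL_orbit A \<Longrightarrow> C \<in> SL_orbit B \<Longrightarrow> C \<in> SL_orbit A"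
  unfolding SL_orbit_def by (auto simp flip: matrix_mul_assoc intro!: SL_int_mult)

lemma SL_orbit_sym: "B \<in> SL_orbit A \<Longrightarrow> A \<in> SL_orbit B"
proof -
  assume "B \<in> SL_orbit A"
  then obtain \<gamma> where g: "\<gamma> \<in> SL_int" "B = A ** \<gamma>" by (auto simp: SL_orbit_def)
  obtain \<gamma>' where g': "\<gamma>' \<in> SL_int" "\<gamma> ** \<gamma>' = mat 1" by (rule SL_int_inverse[OF g(1)])
  have "A = B ** \<gamma>'" using g g' by (simp flip: matrix_mul_assoc)
  then show "A \<in> SL_orbit B" using g' by (auto simp: SL_orbit_def)
qed

lemma SL_orbit_eq: "B \<in> SL_orbit A \<Longrightarrow> SL_orbit B = SL_orbit A"
  using SL_orbit_trans SL_orbit_sym by blast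

lemma det_SL_orbit: "B \<in> SL_orbit A \<Longrightarrow> det B = det A"
  by (auto simp: SL_orbit_def SL_int_def det_mul)

lemma SL_orbit_Ints:
  assumes "B \<in> SL_orbit A" "\<And>i j. A $ i $ j \<in> \<int>"
  shows "B $ i $ j \<in> \<int>"
proof -
  obtain \<gamma> where "B = A ** \<gamma>" "\<And>i j. \<gamma> $ i $ j \<in> \<int>"
    using assms(1) by (auto simp: SL_orbit_def SL_int_def)
  then show ?thesis using assms(2) by (simp add: matrix_matrix_mult_def Ints_sum Ints_mult)
qed

lemma power2_norm_matrix:
  fixes A :: "real ^ 'n ^ 'm"
  shows "(norm A)\<^sup>2 = (\<Sum>i\<in>UNIV. \<Sum>j\<in>UNIV. (A $ i $ j)\<^sup>2)"
  by (simp add: norm_vec_def L2_set_def sum_nonneg)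

lemma power2_norm_rows:
  fixes A :: "real ^ 'n ^ 'm"
  shows "(norm A)\<^sup>2 = (\<Sum>i\<in>UNIV. (norm (A $ i))\<^sup>2)"
  by (simp add: norm_vec_def[of A] L2_set_def sum_nonneg)

lemma norm_matrix_mult_le:
  fixes A :: "real ^ 'n ^ 'm" and B :: "real ^ 'p ^ 'n"
  shows "norm (A ** B) \<le> norm A * norm B"
proof -
  have "(norm (A ** B))\<^sup>2 = (\<Sum>i\<in>UNIV. \<Sum>j\<in>UNIV. (A $ i \<bullet> column j B)\<^sup>2)"
    by (simp add: power2_norm_matrix matrix_matrix_mult_def inner_vec_def column_def)
  also have "\<dots> \<le> (\<Sum>i\<in>UNIV. \<Sum>j\<in>UNIV. (norm (A $ i))\<^sup>2 * (norm (column j B))\<^sup>2)"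
    by (intro sum_mono) (metis Cauchy_Schwarz_ineq dot_square_norm)
  also have "\<dots> = (\<Sum>i\<in>UNIV. (norm (A $ i))\<^sup>2) * (\<Sum>j\<in>UNIV. (norm (column j B))\<^sup>2)"
    by (simp add: sum_product)
  also have "(\<Sum>i\<in>UNIV. (norm (A $ i))\<^sup>2) = (norm A)\<^sup>2"
    by (simp add: norm_vec_def L2_set_def sum_nonneg)
  also have "(\<Sum>j\<in>UNIV. (norm (column j B))\<^sup>2) = (norm B)\<^sup>2"
    unfolding power2_norm_matrix
    by (subst sum.swap) (simp add: norm_vec_def L2_set_def sum_nonneg column_def)
  finally have "(norm (A ** B))\<^sup>2 \<le> (norm A * norm B)\<^sup>2" by (simp add: power_mult_distrib)
  then show ?thesis by (rule power2_le_imp_le) simp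
qed

lemma abs_entry_le_norm: "\<bar>A $ i $ j\<bar> \<le> norm (A :: real ^ 'n ^ 'm)"
  using component_le_norm_cart[of "A $ i" j] Finite_Cartesian_Product.norm_nth_le[of A i] by linarith

lemma finite_bounded_integer_vectors:
  "finite {v :: real ^ 'n. (\<forall>i. v $ i \<in> \<int>) \<and> (\<forall>i. \<bar>v $ i\<bar> \<le> M)}" (is "finite ?S")
  and card_bounded_integer_vectors:
  "M \<ge> 0 \<Longrightarrow> real (card {v :: real ^ 'n. (\<forall>i. v $ i \<in> \<int>) \<and> (\<forall>i. \<bar>v $ i\<bar> \<le> M)}) \<le> (2 * M + 1) ^ CARD('n)"
proof -
  define P where "P = (UNIV :: 'n set) \<rightarrow>\<^sub>E {- \<lfloor>M\<rfloor>..\<lfloor>M\<rfloor>}"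
  have fin: "finite P" unfolding P_def by (intro finite_PiE) auto
  have inj: "inj_on (\<lambda>v i. \<lfloor>v $ i\<rfloor>) ?S"
  proof (rule inj_onI)
    fix v w :: "real ^ 'n"
    assume "v \<in> ?S" "w \<in> ?S" and eq: "(\<lambda>i. \<lfloor>v $ i\<rfloor>) = (\<lambda>i. \<lfloor>w $ i\<rfloor>)"
    then have "v $ i = of_int \<lfloor>v $ i\<rfloor>" "w $ i = of_int \<lfloor>w $ i\<rfloor>" for i by simp_all
    then show "v = w" using fun_cong[OF eq] unfolding vec_eq_iff by metis
  qed
  have sub: "(\<lambda>v i. \<lfloor>v $ i\<rfloor>) ` ?S \<subseteq> P"
  proof -
    have "- \<lfloor>M\<rfloor> \<le> \<lfloor>x\<rfloor> \<and> \<lfloor>x\<rfloor> \<le> \<lfloor>M\<rfloor>" if "x \<in> \<int>" "\<bar>x\<bar> \<le> M" for x :: real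
    proof -
      obtain z where "x = of_int z" using \<open>x \<in> \<int>\<close> by (rule Ints_cases)
      then show ?thesis using \<open>\<bar>x\<bar> \<le> M\<close> by (auto simp: abs_le_iff le_floor_iff) linarith
    qed
    then show ?thesis by (auto simp: P_def)
  qed
  show "finite ?S" using inj sub fin by (rule inj_on_finite)
  assume "M \<ge> 0"
  have "card ?S \<le> card P" using inj sub fin by (rule card_inj_on_le)
  also have "card P = nat (2 * \<lfloor>M\<rfloor> + 1) ^ CARD('n)" by (simp add: P_def card_PiE)
  finally have "real (card ?S) \<le> real (nat (2 * \<lfloor>M\<rfloor> + 1) ^ CARD('n))"
    by (simp only: of_nat_le_iff)
  also have "\<dots> = real (nat (2 * \<lfloor>M\<rfloor> + 1)) ^ CARD('n)" by (rule of_nat_power)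
  also have "\<dots> \<le> (2 * M + 1) ^ CARD('n)"
    using \<open>M \<ge> 0\<close> by (intro power_mono) (auto simp: of_nat_nat)
  finally show "real (card ?S) \<le> (2 * M + 1) ^ CARD('n)" .
qed

lemma finite_bounded_SL_int:
  "finite {\<gamma> :: real ^ 'n ^ 'n. \<gamma> \<in> SL_int \<and> norm \<gamma> \<le> M}" (is "finite ?S")
proof -
  let ?V = "{v :: real ^ 'n. (\<forall>i. v $ i \<in> \<int>) \<and> (\<forall>i. \<bar>v $ i\<bar> \<le> M)}"
  have "inj_on (\<lambda>A i. A $ i) ?S" by (intro inj_onI) (simp add: vec_eq_iff fun_eq_iff)
  moreover have "(\<lambda>A i. A $ i) ` ?S \<subseteq> UNIV \<rightarrow>\<^sub>E ?V"
    by (auto simp: SL_int_def intro: order_trans[OF abs_entry_le_norm])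
  moreover have "finite ((UNIV :: 'n set) \<rightarrow>\<^sub>E ?V)"
    by (intro finite_PiE finite_bounded_integer_vectors) auto
  ultimately show ?thesis by (rule inj_on_finite)
qed

lemma countable_SL_int: "countable (SL_int :: (real ^ 'n ^ 'n) set)"
proof -
  have "(SL_int :: (real ^ 'n ^ 'n) set) = (\<Union>n. {\<gamma> \<in> SL_int. norm \<gamma> \<le> real n})"
    by (auto intro: real_arch_simple)
  also have "countable \<dots>"
    by (rule countable_UN[OF countableI_type countable_finite[OF finite_bounded_SL_int]])
  finally show ?thesis .
qed

section \<open>The boundary of the cone over the fundamental domain\<close>

lemma real_polynomial_function_entry [intro]:
  "real_polynomial_function (\<lambda>A :: real ^ 'n ^ 'm. A $ i $ j)"
  by (intro real_polynomial_function.intros(1) bounded_linear_compose[OF bounded_linear_vec_nth]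
      bounded_linear_vec_nth)

lemma real_polynomial_function_det [intro]:
  "real_polynomial_function (\<lambda>A :: real ^ 'n ^ 'n. det A)"
  unfolding det_def
  by (intro real_polynomial_function_sum real_polynomial_function.intros(4) real_polynomial_function.intros(2)
      real_polynomial_function_prod) auto

text \<open>Let \<open>s\<close> be the \<open>k\<close>-th root of \<open>det Y\<close>. The matrices \<open>Y\<close> and \<open>Y \<gamma>\<close> are equally far from \<open>s 1\<close> exactly
  if \<open>|Y|\<^sup>2 - |Y \<gamma>|\<^sup>2 = 2 s (Y - Y \<gamma>) \<bullet> 1\<close>. Raising both sides to the \<open>k\<close>-th power eliminates the root
  and leaves a homogeneous polynomial of degree \<open>2 k\<close> in the entries of \<open>Y\<close>.\<close>

definition tie_poly :: "real ^ 'n ^ 'n \<Rightarrow> real ^ 'n ^ 'n \<Rightarrow> real" where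
  "tie_poly \<gamma> Y = ((norm Y)\<^sup>2 - (norm (Y ** \<gamma>))\<^sup>2) ^ CARD('n) -
     2 ^ CARD('n) * det Y * ((Y - Y ** \<gamma>) \<bullet> mat 1) ^ CARD('n)"

lemma det_scaleR: "det (c *\<^sub>R (A :: real ^ 'n ^ 'n)) = c ^ CARD('n) * det A"
proof -
  have "c *\<^sub>R A = (\<chi> i. c *s A $ i)" by (simp add: vec_eq_iff)
  then show ?thesis using det_rows_mul[of "\<lambda>_. c" "\<lambda>i. A $ i"] by (simp add: vec_lambda_eta)
qed

lemma scaleR_matrix_mult: "(c *\<^sub>R A) ** B = c *\<^sub>R ((A :: real ^ 'n ^ 'm) ** B)"
  by (simp add: matrix_matrix_mult_def vec_eq_iff sum_distrib_left mult.assoc)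

lemma negligible_det_eq_0: "negligible {Y :: real ^ 'n ^ 'n. det Y = 0}"
  by (rule negligible_zeros_homogeneous_polynomial[of _ "CARD('n)" "mat 1"]) (auto simp: det_scaleR)

text \<open>Each ray from the origin meets the hypersurface at most once.\<close>

lemma negligible_det_eq_1: "negligible {Y :: real ^ 'n ^ 'n. det Y = 1}"
proof (rule starlike_negligible[of _ 0])
  show "closed {Y :: real ^ 'n ^ 'n. det Y = 1}"
    by (intro closed_Collect_eq continuous_intros continuous_on_polymonial_function)
       (auto simp flip: real_polynomial_function_eq)
  show "c = 1" if "0 \<le> c" "0 + x \<in> {Y :: real ^ 'n ^ 'n. det Y = 1}" "0 + c *\<^sub>R x \<in> {Y. det Y = 1}" for c x
    using that power_eq_1_iff[of c "CARD('n)"] by (auto simp: det_scaleR)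
qed

lemma inner_mat_1: "A \<bullet> mat 1 = (\<Sum>i\<in>UNIV. A $ i $ i)" for A :: "real ^ 'n ^ 'n"
  by (simp add: inner_vec_def mat_def if_distrib cong: if_cong)

text \<open>If \<open>\<gamma>\<close> is orthogonal, a tie forces \<open>det Y = 0\<close> or a nontrivial linear equation. Otherwise some
  row vector changes its length under \<open>\<gamma>\<close>, and the matrix \<open>V\<close> with this row and zeros elsewhere is not
  a zero of the tie polynomial: the first term is nonzero there, and the second vanishes as
  \<open>det V = 0\<close>. For \<open>k = 1\<close> there is no zero row, but then \<open>\<gamma> = 1\<close>.\<close>

lemma negligible_ties:
  fixes \<gamma> :: "real ^ 'n ^ 'n"
  assumes g: "\<gamma> \<in> SL_int" "\<gamma> \<noteq> mat 1"
  shows "negligible {Y. tie_poly \<gamma> Y = 0}"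
proof (cases "\<forall>Y :: real ^ 'n ^ 'n. norm (Y ** \<gamma>) = norm Y")
  case True
  define h where "h = (\<lambda>Y :: real ^ 'n ^ 'n. (Y - Y ** \<gamma>) \<bullet> mat 1)"
  have "(Y - Y ** \<gamma>) = Y ** (mat 1 - \<gamma>)" for Y :: "real ^ 'n ^ 'n"
    using matrix_add_ldistrib[of Y "mat 1 - \<gamma>" \<gamma>] by (simp add: algebra_simps)
  then have h_eq: "h Y = (\<Sum>i\<in>UNIV. \<Sum>j\<in>UNIV. Y $ i $ j * (mat 1 - \<gamma>) $ j $ i)" for Y
    by (simp add: h_def inner_mat_1) (simp add: matrix_matrix_mult_def)
  have "negligible {Y. h Y = 0}"
  proof (rule negligible_zeros_homogeneous_polynomial[of _ 1 "transpose (mat 1 - \<gamma>)"])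
    show "real_polynomial_function h"
      unfolding h_eq by (intro real_polynomial_function_sum real_polynomial_function.intros(4)
          real_polynomial_function.intros(2)) auto
    show "h (t *\<^sub>R x) = t ^ 1 * h x" for x t by (simp add: h_eq sum_distrib_left mult.assoc)
    have "h (transpose (mat 1 - \<gamma>)) = (norm (transpose (mat 1 - \<gamma>)))\<^sup>2"
      unfolding h_eq power2_norm_matrix by (simp add: transpose_def power2_eq_square)
    moreover have "transpose (mat 1 - \<gamma>) \<noteq> 0"
      using g(2) by (auto simp: transpose_def vec_eq_iff) metis
    ultimately show "h (transpose (mat 1 - \<gamma>)) \<noteq> 0" by simp
  qed
  then have "negligible ({Y :: real ^ 'n ^ 'n. det Y = 0} \<union> {Y. h Y = 0})"
    using negligible_det_eq_0 by (intro negligible_Un)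
  then show ?thesis
    by (rule negligible_subset) (auto simp: tie_poly_def True h_def power_0_left)
next
  case False
  then obtain Y :: "real ^ 'n ^ 'n" where "norm (Y ** \<gamma>) \<noteq> norm Y" by blast
  then have "(norm (Y ** \<gamma>))\<^sup>2 \<noteq> (norm Y)\<^sup>2" by simp
  then have "(\<Sum>i\<in>UNIV. (norm ((Y ** \<gamma>) $ i))\<^sup>2) \<noteq> (\<Sum>i\<in>UNIV. (norm (Y $ i))\<^sup>2)"
    by (simp add: power2_norm_rows)
  then obtain i where i: "(norm ((Y ** \<gamma>) $ i))\<^sup>2 \<noteq> (norm (Y $ i))\<^sup>2"
    by (meson sum.cong)
  define V :: "real ^ 'n ^ 'n" where "V = (\<chi> l. if l = i then Y $ i else 0)"
  have V_mult: "V ** \<gamma> = (\<chi> l. if l = i then (Y ** \<gamma>) $ i else 0)"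
    by (simp add: V_def matrix_matrix_mult_def vec_eq_iff)
  have row_norm: "(norm ((\<chi> l. if l = i then w else 0) :: real ^ 'n ^ 'n))\<^sup>2 = (norm w)\<^sup>2" for w
    by (simp add: power2_norm_rows if_distrib[of norm] if_distrib[of "\<lambda>x. x\<^sup>2"] cong: if_cong)
  have "\<exists>l. l \<noteq> i"
  proof (rule ccontr)
    assume "\<not> (\<exists>l. l \<noteq> i)"
    then have U: "UNIV = {i}" by auto
    have "det \<gamma> = \<gamma> $ i $ i" by (simp add: det_def U permutes_sing)
    then have "\<gamma> = mat 1" using g(1) \<open>\<not> (\<exists>l. l \<noteq> i)\<close>
      by (auto simp: SL_int_def vec_eq_iff mat_def) metis+
    then show False using g(2) by simp
  qed
  then obtain l where "l \<noteq> i" by blast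
  then have "det V = 0" by (intro det_zero_row(1)[of l]) (simp add: V_def row_def vec_eq_iff)
  then have "tie_poly \<gamma> V \<noteq> 0"
  proof -
    have "(norm V)\<^sup>2 = (norm (Y $ i))\<^sup>2" unfolding V_def by (rule row_norm)
    moreover have "(norm (V ** \<gamma>))\<^sup>2 = (norm ((Y ** \<gamma>) $ i))\<^sup>2" unfolding V_mult by (rule row_norm)
    ultimately show ?thesis using i \<open>det V = 0\<close> by (simp add: tie_poly_def)
  qed
  then show ?thesis
  proof (rule negligible_zeros_homogeneous_polynomial[of _ "2 * CARD('n)", rotated 2])
    show "real_polynomial_function (tie_poly \<gamma>)"
      unfolding tie_poly_def power2_norm_matrix inner_vec_def matrix_matrix_mult_def
      by (intro real_polynomial_function_diff real_polynomial_function_power real_polynomial_function.intros(4)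
          real_polynomial_function_sum real_polynomial_function.intros(2) real_polynomial_function_det)
         (auto intro!: real_polynomial_function_diff real_polynomial_function_power real_polynomial_function.intros(4)
          real_polynomial_function_sum real_polynomial_function.intros(2))
    show "tie_poly \<gamma> (t *\<^sub>R Y) = t ^ (2 * CARD('n)) * tie_poly \<gamma> Y" for Y t
    proof -
      have e1: "(norm (t *\<^sub>R Y))\<^sup>2 - (norm ((t *\<^sub>R Y) ** \<gamma>))\<^sup>2 = t\<^sup>2 * ((norm Y)\<^sup>2 - (norm (Y ** \<gamma>))\<^sup>2)"
        by (simp add: scaleR_matrix_mult power_mult_distrib right_diff_distrib)
      have e2: "(t *\<^sub>R Y - (t *\<^sub>R Y) ** \<gamma>) \<bullet> mat 1 = t * ((Y - Y ** \<gamma>) \<bullet> mat 1)"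
        by (simp add: scaleR_matrix_mult inner_diff_left right_diff_distrib)
      have "t ^ (2 * CARD('n)) = t ^ CARD('n) * t ^ CARD('n)" "(t\<^sup>2) ^ CARD('n) = t ^ CARD('n) * t ^ CARD('n)"
        by (simp_all add: mult_2 power_add power2_eq_square power_mult_distrib)
      then show ?thesis
        unfolding tie_poly_def e1 e2 det_scaleR power_mult_distrib by (simp add: algebra_simps)
    qed
  qed
qed


lemma fund_domainD:
  assumes "B \<in> fund_domain e"
  shows "det B = 1" "\<gamma> \<in> SL_int \<Longrightarrow> norm (B - mat 1) \<le> norm (B ** \<gamma> - mat 1)"
proof -
  obtain g where g: "g \<in> SL_real" "B \<in> closest_to_id g"
    using assms by (auto simp: fund_domain_def)
  then have B: "B \<in> SL_orbit g" by (simp add: closest_to_id_def)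
  show "det B = 1" using det_SL_orbit[OF B] g(1) by (simp add: SL_real_def)
  assume "\<gamma> \<in> SL_int"
  then have "B ** \<gamma> \<in> SL_orbit g" by (rule SL_orbit_trans[OF B SL_orbit_mult])
  then show "norm (B - mat 1) \<le> norm (B ** \<gamma> - mat 1)" using g(2) by (simp add: closest_to_id_def)
qed

lemma lex_less_asym: "lex_less e A B \<Longrightarrow> \<not> lex_less e B A"
proof
  assume "lex_less e A B" "lex_less e B A"
  then obtain m m' where m: "entry A (e m) < entry B (e m)" "\<forall>l<m. entry A (e l) = entry B (e l)"
    and m': "entry B (e m') < entry A (e m')" "\<forall>l<m'. entry B (e l) = entry A (e l)"
    by (auto simp: lex_less_def)
  show False using m m' by (cases m m' rule: linorder_cases) auto
qed

text \<open>Both elements minimise the distance to the identity in the same orbit, and the lexicographic order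
  separates distinct minimisers.\<close>

lemma fund_domain_unique:
  assumes "A \<in> fund_domain e" "B \<in> fund_domain e" "B \<in> SL_orbit A"
  shows "A = B"
proof -
  obtain g h where g: "A \<in> closest_to_id g" "\<forall>C\<in>closest_to_id g. C = A \<or> lex_less e A C"
    and h: "B \<in> closest_to_id h" "\<forall>C\<in>closest_to_id h. C = B \<or> lex_less e B C"
    using assms(1,2) by (auto simp: fund_domain_def)
  have "SL_orbit g = SL_orbit h"
    using SL_orbit_eq[of A g] SL_orbit_eq[of B h] SL_orbit_eq[OF assms(3)] g(1) h(1)
    by (simp add: closest_to_id_def)
  then have "closest_to_id g = closest_to_id h" by (simp add: closest_to_id_def)
  then show ?thesis using g h lex_less_asym by metis
qed

lemma fund_domainI_strict:
  assumes "det B = 1"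
    and strict: "\<And>\<gamma>. \<gamma> \<in> SL_int \<Longrightarrow> \<gamma> \<noteq> mat 1 \<Longrightarrow> norm (B - mat 1) < norm (B ** \<gamma> - mat 1)"
  shows "B \<in> fund_domain e"
proof -
  have le: "norm (B - mat 1) \<le> norm (C - mat 1)" "C = B \<or> norm (B - mat 1) < norm (C - mat 1)"
    if C: "C \<in> SL_orbit B" for C
  proof -
    obtain \<gamma> where "\<gamma> \<in> SL_int" "C = B ** \<gamma>" using C by (auto simp: SL_orbit_def)
    then show "C = B \<or> norm (B - mat 1) < norm (C - mat 1)"
      using strict[of \<gamma>] by (cases "\<gamma> = mat 1") auto
    then show "norm (B - mat 1) \<le> norm (C - mat 1)" by auto
  qed
  have "B \<in> closest_to_id B" using le(1) by (simp add: closest_to_id_def)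
  moreover have "C = B" if "C \<in> closest_to_id B" for C
  proof -
    have "C \<in> SL_orbit B" "norm (C - mat 1) \<le> norm (B - mat 1)"
      using that by (auto simp: closest_to_id_def)
    then show ?thesis using le(2)[of C] by auto
  qed
  ultimately show ?thesis using assms(1) by (auto simp: fund_domain_def SL_real_def)
qed

text \<open>On the cone \<open>I \<cdot> F\<close> this recovers the scaling factor \<open>t\<close> of \<open>t B\<close>, as \<open>det B = 1\<close>.\<close>

definition det_root :: "real ^ 'n ^ 'n \<Rightarrow> real" where
  "det_root Y = root CARD('n) (det Y)"

lemma det_root_pos: "det Y > 0 \<Longrightarrow> det_root Y > 0"
  by (simp add: det_root_def)

lemma det_root_power: "det Y \<ge> 0 \<Longrightarrow> det_root (Y :: real ^ 'n ^ 'n) ^ CARD('n) = det Y"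
  by (simp add: det_root_def)

lemma det_root_scaleR: "t \<ge> 0 \<Longrightarrow> det B = 1 \<Longrightarrow> det_root (t *\<^sub>R B) = t"
  by (simp add: det_root_def det_scaleR real_root_power_cancel)

lemma det_unit_cone:
  assumes "(Y :: real ^ 'n ^ 'n) \<in> unit_cone (fund_domain e)"
  shows "0 \<le> det Y" "det Y \<le> 1"
proof -
  obtain t B where "Y = t *\<^sub>R B" "B \<in> fund_domain e" "0 \<le> t" "t \<le> 1"
    using assms by (auto simp: unit_cone_def)
  then show "0 \<le> det Y" "det Y \<le> 1" by (simp_all add: det_scaleR fund_domainD(1) power_le_one)
qed

lemma unit_cone_iff:
  assumes "det Y > 0"
  shows "(Y :: real ^ 'n ^ 'n) \<in> unit_cone (fund_domain e) \<longleftrightarrow>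
    det Y \<le> 1 \<and> inverse (det_root Y) *\<^sub>R Y \<in> fund_domain e"
proof
  assume Y: "Y \<in> unit_cone (fund_domain e)"
  then obtain t B where tB: "Y = t *\<^sub>R B" "B \<in> fund_domain e" "0 \<le> t" by (auto simp: unit_cone_def)
  then have "det_root Y = t" by (simp add: det_root_scaleR fund_domainD(1))
  moreover have "t \<noteq> 0" using assms tB by (auto simp: det_scaleR power_0_left)
  ultimately show "det Y \<le> 1 \<and> inverse (det_root Y) *\<^sub>R Y \<in> fund_domain e"
    using det_unit_cone[OF Y] tB by simp
next
  assume "det Y \<le> 1 \<and> inverse (det_root Y) *\<^sub>R Y \<in> fund_domain e"
  moreover have "Y = det_root Y *\<^sub>R (inverse (det_root Y) *\<^sub>R Y)"
    using det_root_pos[OF assms] by simp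
  ultimately show "Y \<in> unit_cone (fund_domain e)"
    using det_root_pos[OF assms] assms unfolding unit_cone_def
    by (auto intro!: exI[of _ "det_root Y"] exI[of _ "inverse (det_root Y) *\<^sub>R Y"] simp: det_root_def)
qed

lemma norm_unscale:
  fixes Z :: "'a::real_normed_vector"
  assumes "s > 0"
  shows "norm (inverse s *\<^sub>R Z - u) = norm (Z - s *\<^sub>R u) / s"
proof -
  have "inverse s *\<^sub>R Z - u = inverse s *\<^sub>R (Z - s *\<^sub>R u)" using assms by (simp add: scaleR_diff_right)
  then show ?thesis using assms by (simp add: divide_inverse mult.commute)
qed

lemma continuous_on_det [continuous_intros]:
  "continuous_on S (\<lambda>A :: real ^ 'n ^ 'n. det A)"
  using real_polynomial_function_det continuous_on_polymonial_function real_polynomial_function_eq by blast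

lemma continuous_on_det_root [continuous_intros]:
  "continuous_on S (\<lambda>A :: real ^ 'n ^ 'n. det_root A)"
  unfolding det_root_def by (intro continuous_intros)

lemma matrix_add_rdistrib: "((A :: real ^ 'n ^ 'm) + B) ** C = A ** C + B ** C"
  by (simp add: matrix_matrix_mult_def vec_eq_iff sum.distrib distrib_right)

lemma continuous_on_mult_right [continuous_intros]:
  "continuous_on S (\<lambda>A :: real ^ 'n ^ 'n. A ** B)"
proof -
  have "bounded_linear (\<lambda>A :: real ^ 'n ^ 'n. A ** B)"
    by (intro bounded_linear_intro[where K = "norm B"])
       (auto simp: scaleR_matrix_mult norm_matrix_mult_le matrix_add_rdistrib)
  then show ?thesis by (rule linear_continuous_on)
qed

lemma tie_imp_tie_poly:
  fixes Y :: "real ^ 'n ^ 'n"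
  assumes "det Y \<ge> 0" and tie: "norm (Y - det_root Y *\<^sub>R mat 1) = norm (Y ** \<gamma> - det_root Y *\<^sub>R mat 1)"
  shows "tie_poly \<gamma> Y = 0"
proof -
  define s where "s = det_root Y"
  have "(norm (Y - s *\<^sub>R mat 1))\<^sup>2 = (norm (Y ** \<gamma> - s *\<^sub>R mat 1))\<^sup>2" using tie by (simp add: s_def)
  then have "(norm Y)\<^sup>2 - (norm (Y ** \<gamma>))\<^sup>2 = 2 * s * ((Y - Y ** \<gamma>) \<bullet> mat 1)"
    unfolding power2_norm_eq_inner
    by (simp add: inner_diff_left inner_diff_right inner_commute algebra_simps)
  then have "((norm Y)\<^sup>2 - (norm (Y ** \<gamma>))\<^sup>2) ^ CARD('n) = 2 ^ CARD('n) * s ^ CARD('n) * ((Y - Y ** \<gamma>) \<bullet> mat 1) ^ CARD('n)"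
    by (simp add: power_mult_distrib)
  then show ?thesis using det_root_power[OF assms(1)] by (simp add: tie_poly_def s_def)
qed

text \<open>Strict inequality against a single \<open>\<gamma>\<close> persists near \<open>Y0\<close>, and finitely many \<open>\<gamma>\<close> are enough: if
  \<open>Y \<gamma>\<close> is at least as close to \<open>s 1\<close> as \<open>Y\<close>, then \<open>Y \<gamma>\<close> is bounded, hence so is \<open>\<gamma>\<close>, as \<open>Y\<close> is close
  to the invertible matrix \<open>Y0\<close>.\<close>

lemma eventually_in_cone_if_strict:
  fixes Y0 :: "real ^ 'n ^ 'n"
  assumes det: "0 < det Y0" "det Y0 < 1"
    and strict: "\<And>\<gamma>. \<gamma> \<in> SL_int \<Longrightarrow> \<gamma> \<noteq> mat 1 \<Longrightarrow>
      norm (Y0 - det_root Y0 *\<^sub>R mat 1) < norm (Y0 ** \<gamma> - det_root Y0 *\<^sub>R mat 1)"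
  shows "eventually (\<lambda>Y. Y \<in> unit_cone (fund_domain e)) (nhds Y0)"
proof -
  obtain J where J: "J ** Y0 = mat 1"
    using det(1) invertible_det_nz[of Y0] by (auto simp: invertible_def)
  \<comment> \<open>The summand \<open>1\<close> only ensures that the bound is positive.\<close>
  define j where "j = norm J + 1"
  have j: "j > 0" "norm J \<le> j" by (auto simp: j_def add_nonneg_pos)
  define M where "M = 2 * j * (norm Y0 + 1 + 2 * norm (mat 1 :: real ^ 'n ^ 'n))"
  define \<Gamma> where "\<Gamma> = {\<gamma> :: real ^ 'n ^ 'n. \<gamma> \<in> SL_int \<and> norm \<gamma> \<le> M} - {mat 1}"
  have fin: "finite \<Gamma>" unfolding \<Gamma>_def using finite_bounded_SL_int by blast
  have open_det: "eventually (\<lambda>Y. det Y \<in> {0<..<1}) (nhds Y0)"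
    using det by (intro eventually_nhds_in_open[of "{Y. 0 < det Y} \<inter> {Y. det Y < 1}" Y0, THEN eventually_mono])
      (auto intro!: open_Int open_Collect_less continuous_intros)
  have strict_near: "eventually (\<lambda>Y. \<forall>\<gamma>\<in>\<Gamma>. norm (Y - det_root Y *\<^sub>R mat 1) < norm (Y ** \<gamma> - det_root Y *\<^sub>R mat 1)) (nhds Y0)"
  proof (rule eventually_ball_finite[OF fin], rule ballI)
    fix \<gamma> assume "\<gamma> \<in> \<Gamma>"
    then show "eventually (\<lambda>Y. norm (Y - det_root Y *\<^sub>R mat 1) < norm (Y ** \<gamma> - det_root Y *\<^sub>R mat 1)) (nhds Y0)"
      using strict[of \<gamma>]
      by (intro eventually_nhds_in_open[of "{Y. norm (Y - det_root Y *\<^sub>R mat 1) < norm (Y ** \<gamma> - det_root Y *\<^sub>R mat 1)}" Y0, THEN eventually_mono])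
        (auto simp: \<Gamma>_def intro!: open_Collect_less continuous_intros)
  qed
  have "eventually (\<lambda>Y. dist Y Y0 < min 1 (1 / (2 * j))) (nhds Y0)"
    using j by (intro eventually_nhds_metric[THEN iffD2] exI[of _ "min 1 (1 / (2 * j))"]) auto
  then show ?thesis using open_det strict_near
  proof eventually_elim
    case (elim Y)
    have near: "norm (Y0 - Y) \<le> 1" "j * norm (Y0 - Y) \<le> 1 / 2"
      using elim(1) j by (auto simp: dist_norm norm_minus_commute field_simps)
    have dY: "0 < det Y" "det Y < 1" using elim(2) by auto
    define s where "s = det_root Y"
    have s: "0 < s" "s \<le> 1" using dY by (auto simp: s_def det_root_def)
    have lt: "norm (Y - s *\<^sub>R mat 1) < norm (Y ** \<gamma> - s *\<^sub>R mat 1)" if g: "\<gamma> \<in> SL_int" "\<gamma> \<noteq> mat 1" for \<gamma>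
    proof (rule ccontr)
      assume not_lt: "\<not> ?thesis"
      then have "norm (Y ** \<gamma> - s *\<^sub>R mat 1) \<le> norm (Y - s *\<^sub>R mat 1)" by simp
      moreover have "norm (s *\<^sub>R mat 1 :: real ^ 'n ^ 'n) \<le> norm (mat 1 :: real ^ 'n ^ 'n)"
        using s mult_right_mono[of s 1 "norm (mat 1 :: real ^ 'n ^ 'n)"] by simp
      moreover have "norm Y \<le> norm Y0 + 1"
        using near(1) norm_triangle_ineq4[of Y0 "Y0 - Y"] by simp
      ultimately have Yg: "norm (Y ** \<gamma>) \<le> norm Y0 + 1 + 2 * norm (mat 1 :: real ^ 'n ^ 'n)"
        using norm_triangle_ineq4[of Y "s *\<^sub>R mat 1"] norm_triangle_ineq[of "Y ** \<gamma> - s *\<^sub>R mat 1" "s *\<^sub>R mat 1"]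
        by simp
      have "\<gamma> = J ** (Y ** \<gamma> + (Y0 - Y) ** \<gamma>)"
        by (simp add: J matrix_mul_assoc flip: matrix_add_rdistrib)
      then have "norm \<gamma> \<le> norm J * norm (Y ** \<gamma> + (Y0 - Y) ** \<gamma>)" by (metis norm_matrix_mult_le)
      also have "\<dots> \<le> j * (norm (Y ** \<gamma>) + norm (Y0 - Y) * norm \<gamma>)"
        using j by (intro mult_mono order_trans[OF norm_triangle_ineq] add_left_mono norm_matrix_mult_le) auto
      also have "\<dots> = j * norm (Y ** \<gamma>) + (j * norm (Y0 - Y)) * norm \<gamma>" by (simp add: algebra_simps)
      also have "\<dots> \<le> j * norm (Y ** \<gamma>) + (1 / 2) * norm \<gamma>"
        using near(2) by (intro add_left_mono mult_right_mono) auto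
      finally have "norm \<gamma> \<le> 2 * j * norm (Y ** \<gamma>)" by simp
      also have "\<dots> \<le> M" unfolding M_def using Yg j by (intro mult_left_mono) auto
      finally have "\<gamma> \<in> \<Gamma>" using g by (simp add: \<Gamma>_def)
      then show False using elim(3) not_lt by (auto simp: s_def)
    qed
    have "inverse s *\<^sub>R Y \<in> fund_domain e"
    proof (rule fund_domainI_strict)
      show "det (inverse s *\<^sub>R Y) = 1"
        using det_root_power[of Y] dY s by (simp add: det_scaleR s_def power_inverse)
      show "norm (inverse s *\<^sub>R Y - mat 1) < norm ((inverse s *\<^sub>R Y) ** \<gamma> - mat 1)"
        if "\<gamma> \<in> SL_int" "\<gamma> \<noteq> mat 1" for \<gamma>
        using lt[OF that] s by (simp add: norm_unscale scaleR_matrix_mult divide_strict_right_mono)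
    qed
    then show ?case using dY by (simp add: unit_cone_iff s_def)
  qed
qed

text \<open>Consider \<open>Y\<close> with \<open>0 < det Y < 1\<close> and no ties. If every \<open>\<gamma> \<noteq> 1\<close> takes \<open>Y\<close> strictly further from
  \<open>s 1\<close>, a neighbourhood of \<open>Y\<close> lies in the cone. Otherwise some \<open>\<gamma>\<close> takes \<open>Y\<close> strictly closer, an open
  condition that keeps a neighbourhood outside.\<close>

lemma frontier_unit_cone_subset:
  fixes e :: "nat \<Rightarrow> 'n::finite \<times> 'n"
  shows "frontier (unit_cone (fund_domain e)) \<subseteq>
    {Y. det Y = 0} \<union> {Y. det Y = 1} \<union> (\<Union>\<gamma>\<in>SL_int - {mat 1}. {Y. tie_poly \<gamma> Y = 0})"
proof (rule subsetI, rule ccontr)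
  define C where "C = unit_cone (fund_domain e)"
  fix Y0 assume fr: "Y0 \<in> frontier (unit_cone (fund_domain e))"
    and "Y0 \<notin> {Y. det Y = 0} \<union> {Y. det Y = 1} \<union> (\<Union>\<gamma>\<in>SL_int - {mat 1}. {Y. tie_poly \<gamma> Y = 0})"
  then have det: "det Y0 \<noteq> 0" "det Y0 \<noteq> 1"
    and no_tie: "\<And>\<gamma>. \<gamma> \<in> SL_int \<Longrightarrow> \<gamma> \<noteq> mat 1 \<Longrightarrow> tie_poly \<gamma> Y0 \<noteq> 0"
    by auto
  have fr: "Y0 \<in> frontier C" using fr by (simp add: C_def)
  have not_out: "S \<inter> C \<noteq> {}" if "open S" "Y0 \<in> S" for S
    using fr that by (auto simp: frontier_def open_Int_closure_eq_empty[OF that(1), of C, symmetric])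
  have not_in: "\<not> eventually (\<lambda>Y. Y \<in> C) (nhds Y0)"
    using fr by (auto simp: frontier_def eventually_nhds interior_def)
  have "det Y0 > 0"
  proof (rule ccontr)
    assume "\<not> det Y0 > 0"
    then have "{Y :: real ^ 'n ^ 'n. det Y < 0} \<inter> C \<noteq> {}"
      using det by (intro not_out) (auto intro!: open_Collect_less continuous_intros)
    then show False using det_unit_cone(1) by (fastforce simp: C_def)
  qed
  moreover have "det Y0 < 1"
  proof (rule ccontr)
    assume "\<not> det Y0 < 1"
    then have "{Y :: real ^ 'n ^ 'n. 1 < det Y} \<inter> C \<noteq> {}"
      using det by (intro not_out) (auto intro!: open_Collect_less continuous_intros)
    then show False using det_unit_cone(2) by (fastforce simp: C_def)
  qed
  ultimately obtain \<gamma> where g: "\<gamma> \<in> SL_int" "\<gamma> \<noteq> mat 1"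
    and "\<not> norm (Y0 - det_root Y0 *\<^sub>R mat 1) < norm (Y0 ** \<gamma> - det_root Y0 *\<^sub>R mat 1)"
    using eventually_in_cone_if_strict[of Y0 e] not_in by (auto simp: C_def)
  moreover have "norm (Y0 - det_root Y0 *\<^sub>R mat 1) \<noteq> norm (Y0 ** \<gamma> - det_root Y0 *\<^sub>R mat 1)"
    using tie_imp_tie_poly[of Y0 \<gamma>] no_tie[OF g] \<open>det Y0 > 0\<close> by auto
  ultimately have lt: "norm (Y0 ** \<gamma> - det_root Y0 *\<^sub>R mat 1) < norm (Y0 - det_root Y0 *\<^sub>R mat 1)" by simp
  define S where "S = {Y :: real ^ 'n ^ 'n. 0 < det Y} \<inter>
    {Y. norm (Y ** \<gamma> - det_root Y *\<^sub>R mat 1) < norm (Y - det_root Y *\<^sub>R mat 1)}"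
  have "S \<inter> C \<noteq> {}"
    using lt \<open>det Y0 > 0\<close> unfolding S_def
    by (intro not_out open_Int) (auto intro!: open_Collect_less continuous_intros)
  then obtain Y where Y: "Y \<in> C" "det Y > 0"
    and lt: "norm (Y ** \<gamma> - det_root Y *\<^sub>R mat 1) < norm (Y - det_root Y *\<^sub>R mat 1)"
    by (auto simp: S_def)
  then have "inverse (det_root Y) *\<^sub>R Y \<in> fund_domain e" by (simp add: C_def unit_cone_iff)
  from fund_domainD(2)[OF this g(1)]
  have "norm (Y - det_root Y *\<^sub>R mat 1) \<le> norm (Y ** \<gamma> - det_root Y *\<^sub>R mat 1)"
    using det_root_pos[OF Y(2)] by (simp add: norm_unscale scaleR_matrix_mult divide_le_cancel)
  then show False using lt by simp
qed

proposition negligible_frontier_unit_cone: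
  fixes e :: "nat \<Rightarrow> 'n::finite \<times> 'n"
  shows "negligible (frontier (unit_cone (fund_domain e)))"
proof -
  have "negligible (\<Union>\<gamma>\<in>(SL_int :: (real ^ 'n ^ 'n) set) - {mat 1}. {Y. tie_poly \<gamma> Y = 0})"
    by (intro negligible_countable_Union countable_image countable_Diff countable_SL_int)
       (auto intro: negligible_ties)
  then show ?thesis
    by (intro negligible_subset[OF _ frontier_unit_cone_subset] negligible_Un
        negligible_det_eq_0 negligible_det_eq_1)
qed

section \<open>Gram--Schmidt vectors and LLL-reduced bases\<close>

text \<open>A fixed enumeration of the index type from \<open>0\<close>, which gives a meaning to ``triangular'', ``first
  column'' and to the order in which columns are orthogonalised.\<close>

definition idx :: "'n::finite \<Rightarrow> nat" where
  "idx = to_nat_on UNIV"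

lemma bij_idx: "bij_betw (idx :: 'n::finite \<Rightarrow> nat) UNIV {..<CARD('n)}"
  unfolding idx_def by (rule to_nat_on_finite) simp

lemma idx_eq_iff [simp]: "idx i = idx j \<longleftrightarrow> i = j"
  using bij_idx by (auto simp: bij_betw_def inj_on_def)

lemma idx_less [simp]: "idx (i :: 'n::finite) < CARD('n)"
  using bij_idx by (auto simp: bij_betw_def)

lemma idx_surj: "m < CARD('n) \<Longrightarrow> \<exists>i :: 'n::finite. idx i = m"
proof -
  assume "m < CARD('n)"
  moreover have "idx ` (UNIV :: 'n set) = {..<CARD('n)}" by (rule bij_betw_imp_surj_on[OF bij_idx])
  ultimately have "m \<in> idx ` (UNIV :: 'n set)" by simp
  then show ?thesis by auto
qed

text \<open>A permutation that never decreases the index is the identity, by comparing the sums of the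
  indices; every other permutation contributes an entry below the diagonal.\<close>

lemma det_triangular:
  fixes A :: "real ^ 'n ^ 'n"
  assumes tri: "\<And>i j. idx j < idx i \<Longrightarrow> A $ i $ j = 0"
  shows "det A = (\<Prod>i\<in>UNIV. A $ i $ i)"
proof -
  let ?g = "\<lambda>p. of_int (sign p) * (\<Prod>i\<in>UNIV. A $ i $ p i)"
  have "det A = sum ?g {p. p permutes (UNIV :: 'n set)}" by (simp add: det_def)
  also have "\<dots> = sum ?g {id}"
  proof (rule sum.mono_neutral_right)
    show "\<forall>p\<in>{p. p permutes (UNIV :: 'n set)} - {id}. ?g p = 0"
    proof
      fix p :: "'n \<Rightarrow> 'n" assume p: "p \<in> {p. p permutes UNIV} - {id}"
      have "\<exists>i. idx (p i) < idx i"
      proof (rule ccontr)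
        assume "\<not> ?thesis"
        then have le: "idx i \<le> idx (p i)" for i by (simp add: not_less)
        obtain j where "p j \<noteq> j" using p by (auto simp: fun_eq_iff)
        then have "idx j < idx (p j)" using le[of j] by (metis idx_eq_iff le_neq_implies_less)
        have "(\<Sum>i\<in>(UNIV :: 'n set). idx i) < (\<Sum>i\<in>UNIV. idx (p i))"
        proof (rule sum_strict_mono_ex1)
          show "\<forall>i\<in>(UNIV :: 'n set). idx i \<le> idx (p i)" using le by blast
          show "\<exists>i\<in>UNIV. idx i < idx (p i)" using \<open>idx j < idx (p j)\<close> by blast
        qed simp
        moreover have "(\<Sum>i\<in>UNIV. idx (p i)) = (\<Sum>i\<in>(UNIV :: 'n set). idx i)"
          using p sum.permute[of p "UNIV :: 'n set" idx] by (simp add: comp_def)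
        ultimately show False by simp
      qed
      then obtain i where "A $ i $ p i = 0" using tri by blast
      then have "(\<Prod>i\<in>UNIV. A $ i $ p i) = 0" by (intro prod_zero) auto
      then show "?g p = 0" by simp
    qed
  qed (auto simp: permutes_id)
  finally show ?thesis by (simp add: sign_id)
qed

definition add_column :: "'n \<Rightarrow> 'n \<Rightarrow> real \<Rightarrow> real ^ 'n ^ 'm \<Rightarrow> real ^ 'n ^ 'm" where
  "add_column i j c A = (\<chi> r s. if s = j then A $ r $ j + c * A $ r $ i else A $ r $ s)"

lemma column_add_column:
  "column l (add_column i j c A) = (if l = j then column j A + c *\<^sub>R column i A else column l A)"
  by (simp add: column_def add_column_def vec_eq_iff)

lemma add_column_in_SL_orbit:
  fixes A :: "real ^ 'n ^ 'n"
  assumes "i \<noteq> j" "c \<in> \<int>"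
  shows "add_column i j c A \<in> SL_orbit A"
proof -
  define E :: "real ^ 'n ^ 'n" where "E = add_column i j c (mat 1)"
  have "transpose E = (\<chi> k. if k = j then row j (mat 1) + c *s row i (mat 1) else row k (mat 1 :: real ^ 'n ^ 'n))"
    by (simp add: E_def add_column_def transpose_def vec_eq_iff row_def mat_def)
  then have "det (transpose E) = 1"
    using det_row_operation[of j i "mat 1 :: real ^ 'n ^ 'n" c] assms(1) by simp
  then have "det E = 1" by simp
  moreover have "E $ r $ s \<in> \<int>" for r s using assms(2) by (simp add: E_def add_column_def mat_def)
  ultimately have "E \<in> SL_int" by (simp add: SL_int_def)
  moreover have "add_column i j c A = A ** E"
    using assms(1)
  proof -
    have E: "E $ k $ s = (if k = s then 1 else 0) + (if k = i then if s = j then c else 0 else 0)" for k s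
      using assms(1) by (simp add: E_def add_column_def mat_def)
    have "(A ** E) $ r $ s = A $ r $ s + A $ r $ i * (if s = j then c else 0)" for r s
      by (simp add: matrix_matrix_mult_def E distrib_left sum.distrib if_distrib[of "\<lambda>x. y * x" for y]
          cong: if_cong)
    then show ?thesis by (simp add: vec_eq_iff add_column_def mult.commute)
  qed
  ultimately show ?thesis by (auto simp: SL_orbit_def)
qed

definition columns_before_span :: "real ^ 'n ^ 'm \<Rightarrow> nat \<Rightarrow> (real ^ 'm) set" where
  "columns_before_span A m = span {column i A | i. idx i < m}"

text \<open>The Gram--Schmidt vector of column \<open>j\<close>: its component orthogonal to the columns before it.\<close>

definition gram_schmidt :: "real ^ 'n ^ 'm \<Rightarrow> 'n \<Rightarrow> real ^ 'm" where
  "gram_schmidt A j = (SOME z. column j A - z \<in> columns_before_span A (idx j) \<and>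
     (\<forall>w\<in>columns_before_span A (idx j). orthogonal z w))"

lemma gram_schmidt_spec:
  fixes A :: "real ^ 'n ^ 'm"
  shows gram_schmidt_diff: "column j A - gram_schmidt A j \<in> columns_before_span A (idx j)"
    and gram_schmidt_orth: "w \<in> columns_before_span A (idx j) \<Longrightarrow> orthogonal (gram_schmidt A j) w"
proof -
  obtain y z where "y \<in> columns_before_span A (idx j)" "\<And>w. w \<in> columns_before_span A (idx j) \<Longrightarrow> orthogonal z w"
    "column j A = y + z"
    unfolding columns_before_span_def
    by (rule orthogonal_subspace_decomp_exists[of "{column i A | i. idx i < idx j}" "column j A"]) blast
  then have "\<exists>z. column j A - z \<in> columns_before_span A (idx j) \<and> (\<forall>w\<in>columns_before_span A (idx j). orthogonal z w)"
    by (intro exI[of _ z]) auto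
  from someI_ex[OF this]
  show "column j A - gram_schmidt A j \<in> columns_before_span A (idx j)"
    and "w \<in> columns_before_span A (idx j) \<Longrightarrow> orthogonal (gram_schmidt A j) w"
    by (auto simp: gram_schmidt_def)
qed

lemma subspace_columns_before_span: "subspace (columns_before_span A m)"
  by (simp add: columns_before_span_def)

lemma gram_schmidt_unique:
  assumes "column j A - z \<in> columns_before_span A (idx j)" "\<And>w. w \<in> columns_before_span A (idx j) \<Longrightarrow> orthogonal z w"
  shows "gram_schmidt A j = z"
proof -
  have "(column j A - z) - (column j A - gram_schmidt A j) \<in> columns_before_span A (idx j)"
    by (intro subspace_diff subspace_columns_before_span assms gram_schmidt_diff)
  then have d: "gram_schmidt A j - z \<in> columns_before_span A (idx j)" by simp
  have "orthogonal (gram_schmidt A j - z) (gram_schmidt A j - z)"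
    using assms(2)[OF d] gram_schmidt_orth[OF d] by (simp add: orthogonal_def inner_diff_left)
  then show ?thesis by (simp add: orthogonal_self)
qed

lemma gram_schmidt_cong:
  assumes "columns_before_span B (idx j) = columns_before_span A (idx j)" "column j B - column j A \<in> columns_before_span A (idx j)"
  shows "gram_schmidt B j = gram_schmidt A j"
proof (rule gram_schmidt_unique)
  have "(column j B - column j A) + (column j A - gram_schmidt A j) \<in> columns_before_span A (idx j)"
    by (intro subspace_add subspace_columns_before_span assms gram_schmidt_diff)
  then show "column j B - gram_schmidt A j \<in> columns_before_span B (idx j)" by (simp add: assms(1))
  show "orthogonal (gram_schmidt A j) w" if "w \<in> columns_before_span B (idx j)" for w
    using that gram_schmidt_orth by (simp add: assms(1))
qed

lemma columns_before_span_mono: "m \<le> m' \<Longrightarrow> columns_before_span A m \<subseteq> columns_before_span A m'"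
  unfolding columns_before_span_def by (intro span_mono) auto

lemma column_in_columns_before_span: "idx i < m \<Longrightarrow> column i A \<in> columns_before_span A m"
  unfolding columns_before_span_def by (intro span_base) auto

lemma gram_schmidt_in_columns_before_span: "idx i < m \<Longrightarrow> gram_schmidt A i \<in> columns_before_span A m"
proof -
  assume m: "idx i < m"
  have "column i A - gram_schmidt A i \<in> columns_before_span A m"
    using m gram_schmidt_diff[of i A] columns_before_span_mono[of "idx i" m A] by auto
  then have "column i A - (column i A - gram_schmidt A i) \<in> columns_before_span A m"
    by (rule subspace_diff[OF subspace_columns_before_span column_in_columns_before_span[OF m]])
  moreover have "column i A - (column i A - gram_schmidt A i) = gram_schmidt A i" by simp
  ultimately show ?thesis by metis
qed

lemma columns_before_span_0 [simp]: "columns_before_span A 0 = {0}"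
  by (simp add: columns_before_span_def)

lemma columns_before_span_Suc:
  assumes "idx q = m" "w \<in> columns_before_span A (Suc m)"
  obtains t w0 where "w = t *\<^sub>R column q A + w0" "w0 \<in> columns_before_span A m"
proof -
  have "{column i A | i. idx i < Suc m} = insert (column q A) {column i A | i. idx i < m}"
    using assms(1) by (auto simp: less_Suc_eq)
  then have "w \<in> span (insert (column q A) {column i A | i. idx i < m})"
    using assms(2) by (simp add: columns_before_span_def)
  then obtain t where "w - t *\<^sub>R column q A \<in> columns_before_span A m"
    by (auto simp: span_insert columns_before_span_def)
  then show thesis by (intro that[of t "w - t *\<^sub>R column q A"]) auto
qed

lemma columns_before_span_subset:
  assumes "\<And>i. idx i < m \<Longrightarrow> column i B \<in> columns_before_span A m"
  shows "columns_before_span B m \<subseteq> columns_before_span A m"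
  using assms unfolding columns_before_span_def[of B] by (intro span_minimal subspace_columns_before_span) auto

text \<open>The Gram matrix of the first \<open>m\<close> columns, filled up with an identity block so that its size does not
  depend on \<open>m\<close>.\<close>

definition gram :: "nat \<Rightarrow> real ^ 'n ^ 'm \<Rightarrow> real ^ 'n ^ 'n" where
  "gram m A = (\<chi> i l. if idx i < m \<and> idx l < m then column i A \<bullet> column l A else if i = l then 1 else 0)"

text \<open>Replace the columns \<open>a\<^sub>i\<close> that occur on the left of the inner products by their Gram--Schmidt
  vectors, starting with the last one. Each replacement adds to a row a combination of other rows and
  preserves the determinant. In the end the matrix is triangular with the squared norms on its
  diagonal.\<close>

lemma det_gram:
  fixes A :: "real ^ 'n ^ 'm"
  shows "det (gram m A) = (\<Prod>i | idx i < m. (norm (gram_schmidt A i))\<^sup>2)"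
proof -
  define \<phi> :: "real ^ 'm \<Rightarrow> real ^ 'n" where
    "\<phi> x = (\<chi> l. if idx l < m then x \<bullet> column l A else 0)" for x
  have lin: "linear \<phi>" by (rule linearI) (simp_all add: \<phi>_def vec_eq_iff inner_add_left)
  \<comment> \<open>\<open>B m\<close> is the Gram matrix, and \<open>B 0\<close> is triangular.\<close>
  define B where "B s = (\<chi> i. if idx i < m then \<phi> (if s \<le> idx i then gram_schmidt A i else column i A) else axis i 1)" for s
  have step: "det (B (Suc s)) = det (B s)" for s
  proof (cases "s < m \<and> s < CARD('n)")
    case True
    then obtain q :: 'n where q: "idx q = s" using idx_surj by blast
    let ?x = "\<phi> (column q A - gram_schmidt A q)"
    have "column q A - gram_schmidt A q \<in> span {column i A | i. idx i < s}"
      using gram_schmidt_diff[of q A] q by (simp add: columns_before_span_def)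
    then have "?x \<in> span (\<phi> ` {column i A | i. idx i < s})"
      using linear_span_image[OF lin, of "{column i A | i. idx i < s}"] by blast
    also have "\<dots> \<subseteq> span {row j (B s) | j. j \<noteq> q}"
    proof (rule span_mono, rule subsetI)
      fix y assume "y \<in> \<phi> ` {column i A | i. idx i < s}"
      then obtain i where i: "idx i < s" "y = \<phi> (column i A)" by auto
      then have "y = row i (B s)" using True by (simp add: B_def row_def vec_lambda_eta)
      then show "y \<in> {row j (B s) | j. j \<noteq> q}" using i q by blast
    qed
    finally have "det (\<chi> k. if k = q then row q (B s) + ?x else row k (B s)) = det (B s)"
      by (intro det_row_span) (simp add: span_vec_eq)
    moreover have "(\<chi> k. if k = q then row q (B s) + ?x else row k (B s)) = B (Suc s)"
    proof -
      have "row q (B s) + ?x = \<phi> (gram_schmidt A q) + \<phi> (column q A - gram_schmidt A q)"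
        using q True by (simp add: B_def row_def vec_lambda_eta)
      also have "\<dots> = \<phi> (column q A)" using linear_add[OF lin, of "gram_schmidt A q" "column q A - gram_schmidt A q"] by simp
      finally have *: "row q (B s) + ?x = B (Suc s) $ q" using q True by (simp add: B_def)
      have "row k (B s) = B (Suc s) $ k" if "k \<noteq> q" for k
      proof -
        have "idx k \<noteq> s" using that q by auto
        then have "Suc s \<le> idx k \<longleftrightarrow> s \<le> idx k" by auto
        then show ?thesis by (simp add: B_def row_def vec_lambda_eta)
      qed
      then show ?thesis using * by (simp add: vec_eq_iff)
    qed
    ultimately show ?thesis by simp
  next
    case False
    then have "Suc s \<le> idx i \<longleftrightarrow> s \<le> idx i" if "idx i < m" for i :: 'n
      using that idx_less[of i] by (auto simp del: idx_less)
    then have "B (Suc s) = B s" by (simp add: B_def vec_eq_iff)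
    then show ?thesis by simp
  qed
  have "gram m A = B m"
    by (auto simp: gram_def B_def \<phi>_def vec_eq_iff axis_def)
  moreover have "det (B s) = det (B 0)" for s by (induction s) (simp_all add: step)
  ultimately have "det (gram m A) = det (B 0)" by simp
  also have "\<dots> = (\<Prod>i\<in>UNIV. B 0 $ i $ i)"
  proof (rule det_triangular)
    fix i j :: 'n assume ij: "idx j < idx i"
    show "B 0 $ i $ j = 0"
      using gram_schmidt_orth[OF column_in_columns_before_span[OF ij]] ij by (auto simp: B_def \<phi>_def axis_def orthogonal_def)
  qed
  also have "\<dots> = (\<Prod>i\<in>UNIV. if idx i < m then (norm (gram_schmidt A i))\<^sup>2 else 1)"
  proof (rule prod.cong)
    fix i :: 'n
    have "orthogonal (gram_schmidt A i) (column i A - gram_schmidt A i)" by (intro gram_schmidt_orth gram_schmidt_diff)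
    then have "gram_schmidt A i \<bullet> column i A = (norm (gram_schmidt A i))\<^sup>2"
      by (simp add: orthogonal_def inner_diff_right power2_norm_eq_inner)
    then show "B 0 $ i $ i = (if idx i < m then (norm (gram_schmidt A i))\<^sup>2 else 1)" by (simp add: B_def \<phi>_def)
  qed simp
  also have "\<dots> = (\<Prod>i | idx i < m. (norm (gram_schmidt A i))\<^sup>2)"
    by (simp add: prod.If_cases)
  finally show ?thesis .
qed

lemma prod_norm_gram_schmidt:
  fixes A :: "real ^ 'n ^ 'n"
  shows "(\<Prod>i\<in>UNIV. (norm (gram_schmidt A i))\<^sup>2) = (det A)\<^sup>2"
proof -
  have "gram CARD('n) A = transpose A ** A"
    by (simp add: gram_def transpose_def matrix_matrix_mult_def vec_eq_iff inner_vec_def column_def)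
  then have "det (gram CARD('n) A) = (det A)\<^sup>2" by (simp add: det_mul power2_eq_square)
  then show ?thesis by (simp add: det_gram)
qed

text \<open>The potential of the LLL algorithm. For integer matrices it is a positive integer, so that a
  minimum over an orbit exists; this is what makes reduction terminate.\<close>

definition lll_potential :: "real ^ 'n ^ 'n \<Rightarrow> real" where
  "lll_potential A = (\<Prod>m\<le>CARD('n). det (gram m A))"

lemma gram_schmidt_pos:
  fixes A :: "real ^ 'n ^ 'n"
  assumes "det A \<noteq> 0"
  shows "norm (gram_schmidt A i) > 0"
proof -
  have "(\<Prod>i\<in>UNIV. (norm (gram_schmidt A i))\<^sup>2) \<noteq> 0" using assms by (simp add: prod_norm_gram_schmidt)
  then show ?thesis by auto
qed

lemma det_gram_pos: "det A \<noteq> 0 \<Longrightarrow> det (gram m (A :: real ^ 'n ^ 'n)) > 0"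
  unfolding det_gram by (intro prod_pos) (use gram_schmidt_pos in auto)

lemma det_gram_Ints:
  assumes "\<And>i j. (A :: real ^ 'n ^ 'm) $ i $ j \<in> \<int>"
  shows "det (gram m A) \<in> \<int>"
  using assms by (intro det_Ints) (auto simp: gram_def inner_vec_def column_def intro!: Ints_sum Ints_mult)

lemma lll_potential_pos: "det A \<noteq> 0 \<Longrightarrow> lll_potential A > 0"
  unfolding lll_potential_def by (intro prod_pos) (use det_gram_pos in auto)

lemma lll_potential_Ints:
  assumes "\<And>i j. A $ i $ j \<in> \<int>"
  shows "lll_potential A \<in> \<int>"
  unfolding lll_potential_def by (intro Ints_prod) (rule det_gram_Ints[OF assms])

lemma lll_potential_cong: "(\<And>i. gram_schmidt B i = gram_schmidt A i) \<Longrightarrow> lll_potential B = lll_potential A"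
  by (simp add: lll_potential_def det_gram)

lemma ex_min_Ints:
  fixes f :: "'a \<Rightarrow> real"
  assumes "P a" "\<And>x. P x \<Longrightarrow> f x \<in> \<int>" "\<And>x. P x \<Longrightarrow> f x \<ge> 0"
  obtains x where "P x" "\<And>y. P y \<Longrightarrow> f x \<le> f y"
proof -
  obtain x where x: "P x" "\<And>y. P y \<Longrightarrow> nat \<lfloor>f x\<rfloor> \<le> nat \<lfloor>f y\<rfloor>"
    using ex_has_least_nat[of P a "\<lambda>x. nat \<lfloor>f x\<rfloor>"] assms(1) by blast
  have "f x \<le> f y" if "P y" for y
  proof -
    have "\<lfloor>f x\<rfloor> \<le> \<lfloor>f y\<rfloor>" using x(2)[OF that] assms(3)[OF that] by (simp add: nat_le_eq_zle)
    moreover have "f x = of_int \<lfloor>f x\<rfloor>" "f y = of_int \<lfloor>f y\<rfloor>"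
      using assms(2)[OF that] assms(2)[OF x(1)] by simp_all
    ultimately show ?thesis by (metis of_int_le_iff)
  qed
  then show thesis using x(1) that by blast
qed

text \<open>Only the factor for \<open>m = idx i + 1\<close> changes: for smaller \<open>m\<close> the vectors involved agree, and for
  larger \<open>m\<close> the product over all indices is \<open>(det A)\<^sup>2\<close> and the vectors left out agree.\<close>

lemma lll_potential_swap:
  fixes A B :: "real ^ 'n ^ 'n"
  assumes det: "det A \<noteq> 0" "det B = det A"
    and i: "idx i' = Suc (idx i)"
    and same: "\<And>l. l \<noteq> i \<Longrightarrow> l \<noteq> i' \<Longrightarrow> gram_schmidt B l = gram_schmidt A l"
  shows "lll_potential B * (norm (gram_schmidt A i))\<^sup>2 = lll_potential A * (norm (gram_schmidt B i))\<^sup>2"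
proof -
  let ?f = "\<lambda>A m. \<Prod>l | idx l < m. (norm (gram_schmidt (A :: real ^ 'n ^ 'n) l))\<^sup>2"
  have ne: "i \<noteq> i'" using i by auto
  have low: "?f B m = ?f A m" if "m \<le> idx i" for m
  proof (rule prod.cong)
    fix x :: 'n assume "x \<in> {l. idx l < m}"
    then have "x \<noteq> i" "x \<noteq> i'" using that i by auto
    then show "(norm (gram_schmidt B x))\<^sup>2 = (norm (gram_schmidt A x))\<^sup>2" by (simp add: same)
  qed simp
  have high: "?f B m = ?f A m" if m: "m > idx i'" for m
  proof -
    have split: "?f C m * (\<Prod>l | \<not> idx l < m. (norm (gram_schmidt C l))\<^sup>2) = (det C)\<^sup>2" for C :: "real ^ 'n ^ 'n"
    proof -
      have "(\<Prod>l\<in>UNIV. (norm (gram_schmidt C l))\<^sup>2) = ?f C m * (\<Prod>l | \<not> idx l < m. (norm (gram_schmidt C l))\<^sup>2)"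
        by (subst prod.union_disjoint[symmetric]) (auto intro!: prod.cong)
      then show ?thesis by (simp add: prod_norm_gram_schmidt)
    qed
    have "(\<Prod>l | \<not> idx l < m. (norm (gram_schmidt B l))\<^sup>2) = (\<Prod>l | \<not> idx l < m. (norm (gram_schmidt A l))\<^sup>2)"
    proof (rule prod.cong)
      fix x :: 'n assume "x \<in> {l. \<not> idx l < m}"
      then have "x \<noteq> i" "x \<noteq> i'" using m i by auto
      then show "(norm (gram_schmidt B x))\<^sup>2 = (norm (gram_schmidt A x))\<^sup>2" by (simp add: same)
    qed simp
    moreover have "(\<Prod>l | \<not> idx l < m. (norm (gram_schmidt A l))\<^sup>2) \<noteq> 0"
      using gram_schmidt_pos[OF det(1)] by (simp add: prod_zero_iff)
    ultimately show ?thesis using split[of A] split[of B] det(2) by (metis mult_right_cancel)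
  qed
  have mid: "?f C (Suc (idx i)) = ?f C (idx i) * (norm (gram_schmidt C i))\<^sup>2" for C :: "real ^ 'n ^ 'n"
  proof -
    have "{l. idx l < Suc (idx i)} = insert i {l. idx l < idx i}" by (auto simp: less_Suc_eq)
    then show ?thesis by (simp add: mult.commute)
  qed
  have "Suc (idx i) \<le> CARD('n)" by (rule Suc_leI[OF idx_less])
  then have split: "lll_potential C = ?f C (Suc (idx i)) * (\<Prod>m\<in>{..CARD('n)} - {Suc (idx i)}. ?f C m)" for C :: "real ^ 'n ^ 'n"
    unfolding lll_potential_def det_gram by (intro prod.remove) auto
  have "?f B m = ?f A m" if "m \<noteq> Suc (idx i)" for m
    using low[of m] high[of m] i that by (cases "m \<le> idx i") auto
  then have "(\<Prod>m\<in>{..CARD('n)} - {Suc (idx i)}. ?f B m) = (\<Prod>m\<in>{..CARD('n)} - {Suc (idx i)}. ?f A m)"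
    by (rule_tac prod.cong[OF refl]) blast
  then show ?thesis unfolding split[of A] split[of B] mid using low[of "idx i"] by simp
qed

text \<open>Replace the columns \<open>a\<^sub>i, a\<^sub>i\<^sub>'\<close> by \<open>a\<^sub>i\<^sub>' + c a\<^sub>i\<close> and \<open>- a\<^sub>i\<close>. The new \<open>i\<close>-th Gram--Schmidt vector is
  \<open>g' + (t + c) g\<close>, and the integer \<open>c\<close> can be chosen such that \<open>|t + c| \<le> 1/2\<close>. Minimality of the
  potential means that it is not shorter than \<open>g\<close>, so \<open>|g|\<^sup>2 \<le> |g'|\<^sup>2 + |g|\<^sup>2 / 4\<close>.\<close>

lemma lovasz_condition:
  fixes A :: "real ^ 'n ^ 'n"
  assumes det: "det A \<noteq> 0" and i: "idx i' = Suc (idx i)"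
    and min: "\<And>B. B \<in> SL_orbit A \<Longrightarrow> lll_potential A \<le> lll_potential B"
  shows "norm (gram_schmidt A i) \<le> 2 * norm (gram_schmidt A i')"
proof -
  have ne: "i \<noteq> i'" using i by auto
  define g where "g = gram_schmidt A i"
  define g' where "g' = gram_schmidt A i'"
  define V where "V = columns_before_span A (idx i)"
  have V: "subspace V" by (simp add: V_def subspace_columns_before_span)
  have "column i' A - g' \<in> columns_before_span A (Suc (idx i))" using gram_schmidt_diff[of i' A] i by (simp add: g'_def)
  then obtain t w where tw: "column i' A - g' = t *\<^sub>R column i A + w" "w \<in> V"
    unfolding V_def by (rule columns_before_span_Suc[OF refl])
  define c :: real where "c = - of_int (round t)"
  \<comment> \<open>The signed swap is composed of three column additions, after the addition of \<open>c a\<^sub>i\<close>.\<close>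
  define B where "B = add_column i' i 1 (add_column i i' (-1) (add_column i' i 1 (add_column i i' c A)))"
  have B: "B \<in> SL_orbit A"
    unfolding B_def using ne
    by (intro SL_orbit_trans[OF SL_orbit_trans[OF SL_orbit_trans[OF add_column_in_SL_orbit add_column_in_SL_orbit]
            add_column_in_SL_orbit] add_column_in_SL_orbit]) (auto simp: c_def)
  have col: "column i B = column i' A + c *\<^sub>R column i A" "column i' B = - column i A"
    "\<And>l. l \<noteq> i \<Longrightarrow> l \<noteq> i' \<Longrightarrow> column l B = column l A"
    using ne by (simp_all add: B_def column_add_column)
  have cA: "column i A = - column i' B" "column i' A = column i B + c *\<^sub>R column i' B"
    by (simp_all add: col)
  have span_low: "columns_before_span B m = columns_before_span A m" if "m \<le> idx i" for m
  proof -
    have "{column l B | l. idx l < m} = {column l A | l. idx l < m}"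
      using that i col(3) by (metis (no_types, opaque_lifting) Suc_leD not_less less_irrefl order_le_less_trans less_Suc_eq)
    then show ?thesis by (simp add: columns_before_span_def)
  qed
  have span_high: "columns_before_span B m = columns_before_span A m" if m: "m > idx i'" for m
  proof
    have mem: "idx i < m" "idx i' < m" using m i by auto
    have "column l B \<in> columns_before_span A m" if "idx l < m" for l
      using column_in_columns_before_span[OF that, of A] column_in_columns_before_span[OF mem(1), of A] column_in_columns_before_span[OF mem(2), of A]
      by (cases "l = i"; cases "l = i'")
         (auto simp: col intro!: subspace_add subspace_neg subspace_scale subspace_columns_before_span)
    then show "columns_before_span B m \<subseteq> columns_before_span A m" by (rule columns_before_span_subset)
    have "column l A \<in> columns_before_span B m" if "idx l < m" for l
      using column_in_columns_before_span[OF that, of B] column_in_columns_before_span[OF mem(1), of B] column_in_columns_before_span[OF mem(2), of B]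
      by (cases "l = i"; cases "l = i'")
         (auto simp: cA col(3) simp del: col(1,2) intro!: subspace_add subspace_neg subspace_scale subspace_columns_before_span)
    then show "columns_before_span A m \<subseteq> columns_before_span B m" by (rule columns_before_span_subset)
  qed
  have same: "gram_schmidt B l = gram_schmidt A l" if l: "l \<noteq> i" "l \<noteq> i'" for l
  proof (rule gram_schmidt_cong)
    have "idx l \<noteq> idx i'" using l by simp
    then have "idx l \<le> idx i \<or> idx l > idx i'" using i by linarith
    then show "columns_before_span B (idx l) = columns_before_span A (idx l)" using span_low span_high by blast
    show "column l B - column l A \<in> columns_before_span A (idx l)"
      using l by (simp add: col subspace_0[OF subspace_columns_before_span])
  qed
  have gram_schmidt_B: "gram_schmidt B i = g' + (t + c) *\<^sub>R g"
  proof (rule gram_schmidt_unique)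
    have "column i A - g \<in> V" using gram_schmidt_diff[of i A] by (simp add: g_def V_def)
    then have "w + (t + c) *\<^sub>R (column i A - g) \<in> V"
      by (intro subspace_add[OF V] subspace_scale[OF V] tw(2))
    moreover have "column i B - (g' + (t + c) *\<^sub>R g) = w + (t + c) *\<^sub>R (column i A - g)"
      using tw(1) by (simp add: col algebra_simps)
    ultimately show "column i B - (g' + (t + c) *\<^sub>R g) \<in> columns_before_span B (idx i)"
      by (simp add: span_low V_def)
    fix u assume "u \<in> columns_before_span B (idx i)"
    then have u: "u \<in> columns_before_span A (idx i)" by (simp add: span_low)
    then have "orthogonal g u" unfolding g_def by (rule gram_schmidt_orth)
    moreover have "u \<in> columns_before_span A (idx i')" using u columns_before_span_mono[of "idx i" "idx i'" A] i by auto
    then have "orthogonal g' u" unfolding g'_def by (rule gram_schmidt_orth)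
    ultimately show "orthogonal (g' + (t + c) *\<^sub>R g) u" by (simp add: orthogonal_def inner_add_left)
  qed
  have "orthogonal g' g" unfolding g'_def g_def by (intro gram_schmidt_orth gram_schmidt_in_columns_before_span) (simp add: i)
  then have "(norm (gram_schmidt B i))\<^sup>2 = (norm g')\<^sup>2 + (t + c)\<^sup>2 * (norm g)\<^sup>2"
    unfolding gram_schmidt_B power2_norm_eq_inner orthogonal_def
    by (simp add: inner_add_left inner_add_right inner_commute power2_eq_square)
  also have "(t + c)\<^sup>2 \<le> (1/2)\<^sup>2"
    using of_int_round_abs_le[of t] by (intro abs_le_square_iff[THEN iffD1]) (simp add: c_def abs_minus_commute)
  then have "(norm g')\<^sup>2 + (t + c)\<^sup>2 * (norm g)\<^sup>2 \<le> (norm g')\<^sup>2 + (1/2)\<^sup>2 * (norm g)\<^sup>2"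
    by (intro add_left_mono mult_right_mono) auto
  finally have le: "(norm (gram_schmidt B i))\<^sup>2 \<le> (norm g')\<^sup>2 + (norm g)\<^sup>2 / 4" by (simp add: power2_eq_square)
  have "lll_potential A * (norm g)\<^sup>2 \<le> lll_potential B * (norm g)\<^sup>2" using min[OF B] by (intro mult_right_mono) auto
  also have "\<dots> = lll_potential A * (norm (gram_schmidt B i))\<^sup>2"
    unfolding g_def by (rule lll_potential_swap[OF det det_SL_orbit[OF B] i same])
  finally have "(norm g)\<^sup>2 \<le> (norm (gram_schmidt B i))\<^sup>2" using lll_potential_pos[OF det] by simp
  then have "(norm g)\<^sup>2 \<le> 4 * (norm g')\<^sup>2"
    using le zero_le_power2[of "norm g'"] by linarith
  then have "(norm g)\<^sup>2 \<le> (2 * norm g')\<^sup>2" by (simp add: power_mult_distrib)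
  then show ?thesis unfolding g_def g'_def by (rule power2_le_imp_le) simp
qed

text \<open>Babai's nearest plane procedure, downwards in \<open>s\<close>: subtracting an integer multiple of the column
  with index \<open>s\<close> makes the coefficient of its Gram--Schmidt vector at most \<open>1\<close> in absolute value. At
  \<open>s = 0\<close> the whole \<open>j\<close>-th column is bounded.\<close>

lemma nearest_plane:
  fixes A :: "real ^ 'n ^ 'n"
  assumes "s \<le> idx j"
  shows "\<exists>B\<in>SL_orbit A. (\<forall>l. l \<noteq> j \<longrightarrow> column l B = column l A) \<and>
    column j B - column j A \<in> columns_before_span A (idx j) \<and>
    (\<exists>w\<in>columns_before_span A s. norm (column j B - w) \<le> (\<Sum>l | s \<le> idx l \<and> idx l \<le> idx j. norm (gram_schmidt A l)))"
  using assms
proof (induction rule: inc_induct)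
  case base
  have "{l. idx j \<le> idx l \<and> idx l \<le> idx j} = {j}" by (auto dest: antisym)
  then show ?case
    using gram_schmidt_diff[of j A]
    by (intro bexI[of _ A] conjI bexI[of _ "column j A - gram_schmidt A j"])
       (auto intro: subspace_0 subspace_columns_before_span)
next
  case (step s)
  then obtain B w where B: "B \<in> SL_orbit A" "\<And>l. l \<noteq> j \<Longrightarrow> column l B = column l A"
    "column j B - column j A \<in> columns_before_span A (idx j)" "w \<in> columns_before_span A (Suc s)"
    and le: "norm (column j B - w) \<le> (\<Sum>l | Suc s \<le> idx l \<and> idx l \<le> idx j. norm (gram_schmidt A l))"
    by auto
  have "s < CARD('n)" using step(2) idx_less[of j] by linarith
  then obtain q :: 'n where q: "idx q = s" using idx_surj by blast
  then have qj: "q \<noteq> j" using step(2) by auto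
  obtain t w0 where w: "w = t *\<^sub>R column q A + w0" "w0 \<in> columns_before_span A s"
    using columns_before_span_Suc[OF q B(4)] .
  define c :: real where "c = - of_int (round t)"
  define B' where "B' = add_column q j c B"
  define w' where "w' = (t + c) *\<^sub>R (column q A - gram_schmidt A q) + w0"
  have col: "column j B' = column j B + c *\<^sub>R column q A"
    using B(2)[OF qj] by (simp add: B'_def column_add_column)
  have "B' \<in> SL_orbit A"
    unfolding B'_def using qj by (intro SL_orbit_trans[OF B(1)] add_column_in_SL_orbit) (auto simp: c_def)
  moreover have "column l B' = column l A" if "l \<noteq> j" for l
    using that B(2) by (simp add: B'_def column_add_column)
  moreover have "column j B' - column j A \<in> columns_before_span A (idx j)"
  proof -
    have "(column j B - column j A) + c *\<^sub>R column q A \<in> columns_before_span A (idx j)"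
      using q step(2) by (intro subspace_add subspace_scale subspace_columns_before_span B(3) column_in_columns_before_span) auto
    then show ?thesis by (simp add: col algebra_simps)
  qed
  moreover have "w' \<in> columns_before_span A s"
    unfolding w'_def using gram_schmidt_diff[of q A] q w(2) by (intro subspace_add subspace_scale subspace_columns_before_span) auto
  moreover have "norm (column j B' - w') \<le> (\<Sum>l | s \<le> idx l \<and> idx l \<le> idx j. norm (gram_schmidt A l))"
  proof -
    have "column j B' - w' = (column j B - w) + (t + c) *\<^sub>R gram_schmidt A q"
      by (simp add: col w'_def w algebra_simps)
    then have "norm (column j B' - w') \<le> norm (column j B - w) + \<bar>t + c\<bar> * norm (gram_schmidt A q)"
      using norm_triangle_ineq[of "column j B - w" "(t + c) *\<^sub>R gram_schmidt A q"] by simp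
    moreover have "\<bar>t + c\<bar> \<le> 1" using of_int_round_abs_le[of t] unfolding c_def by linarith
    then have "\<bar>t + c\<bar> * norm (gram_schmidt A q) \<le> norm (gram_schmidt A q)" by (simp add: mult_left_le_one_le)
    moreover have "{l. s \<le> idx l \<and> idx l \<le> idx j} = insert q {l. Suc s \<le> idx l \<and> idx l \<le> idx j}"
    proof -
      have "s \<le> idx l \<longleftrightarrow> l = q \<or> Suc s \<le> idx l" for l
      proof -
        have "idx l = s \<longleftrightarrow> l = q" unfolding q[symmetric] by (rule idx_eq_iff)
        then show ?thesis by linarith
      qed
      moreover have "l = q \<Longrightarrow> idx l \<le> idx j" for l using q step(2) by simp
      ultimately show ?thesis unfolding set_eq_iff insert_iff mem_Collect_eq by blast
    qed
    then have "(\<Sum>l | s \<le> idx l \<and> idx l \<le> idx j. norm (gram_schmidt A l)) =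
        norm (gram_schmidt A q) + (\<Sum>l | Suc s \<le> idx l \<and> idx l \<le> idx j. norm (gram_schmidt A l))"
      using q by simp
    ultimately show ?thesis using le by linarith
  qed
  ultimately show ?case by blast
qed

text \<open>Minimise the potential first, which gives the Lovasz condition, and then the norm among the
  minimisers. Nearest-plane steps preserve the Gram--Schmidt vectors and with them the potential, so
  the second minimum satisfies the size bound.\<close>

lemma exists_LLL_reduced:
  fixes A :: "real ^ 'n ^ 'n"
  assumes int: "\<And>i j. A $ i $ j \<in> \<int>" and det: "det A \<noteq> 0"
  obtains B where "B \<in> SL_orbit A"
    "\<And>i i'. idx i' = Suc (idx i) \<Longrightarrow> norm (gram_schmidt B i) \<le> 2 * norm (gram_schmidt B i')"
    "\<And>j. norm (column j B) \<le> (\<Sum>l\<in>UNIV. norm (gram_schmidt B l))"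
proof -
  have intB: "B $ i $ j \<in> \<int>" if "B \<in> SL_orbit A" for B i j using SL_orbit_Ints[OF that int] .
  have detB: "det B \<noteq> 0" if "B \<in> SL_orbit A" for B using det_SL_orbit[OF that] det by simp
  have lll_potential_nonneg: "lll_potential B \<ge> 0" if "B \<in> SL_orbit A" for B using lll_potential_pos[OF detB[OF that]] by simp
  obtain A0 where A0: "A0 \<in> SL_orbit A" "\<And>B. B \<in> SL_orbit A \<Longrightarrow> lll_potential A0 \<le> lll_potential B"
    by (rule ex_min_Ints[of "\<lambda>B. B \<in> SL_orbit A" A lll_potential])
       (auto intro: lll_potential_Ints intB lll_potential_nonneg)
  have normsq_Ints: "(norm B)\<^sup>2 \<in> \<int>" if "B \<in> SL_orbit A" for B
    unfolding power2_norm_matrix unfolding power2_eq_square using intB[OF that] by (intro Ints_sum Ints_mult) auto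
  obtain B where B: "B \<in> SL_orbit A \<and> lll_potential B \<le> lll_potential A0"
    and minB: "\<And>C. C \<in> SL_orbit A \<and> lll_potential C \<le> lll_potential A0 \<Longrightarrow> (norm B)\<^sup>2 \<le> (norm C)\<^sup>2"
  proof (rule ex_min_Ints[of "\<lambda>B. B \<in> SL_orbit A \<and> lll_potential B \<le> lll_potential A0" A0 "\<lambda>B. (norm B)\<^sup>2"])
    show "A0 \<in> SL_orbit A \<and> lll_potential A0 \<le> lll_potential A0" using A0(1) by simp
    show "(norm B)\<^sup>2 \<in> \<int>" if "B \<in> SL_orbit A \<and> lll_potential B \<le> lll_potential A0" for B
      using that normsq_Ints by simp
    show "0 \<le> (norm B)\<^sup>2" for B :: "real ^ 'n ^ 'n" by simp
  qed (rule that)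
  have orb: "C \<in> SL_orbit A" if "C \<in> SL_orbit B" for C using that B SL_orbit_trans by blast
  have min_potential: "lll_potential B \<le> lll_potential C" if "C \<in> SL_orbit B" for C
    using A0(2)[OF orb[OF that]] B by linarith
  have "norm (column j B) \<le> (\<Sum>l\<in>UNIV. norm (gram_schmidt B l))" for j
  proof -
    obtain C w where C: "C \<in> SL_orbit B" "\<And>l. l \<noteq> j \<Longrightarrow> column l C = column l B"
      "column j C - column j B \<in> columns_before_span B (idx j)" "w \<in> columns_before_span B 0"
      and le: "norm (column j C - w) \<le> (\<Sum>l | 0 \<le> idx l \<and> idx l \<le> idx j. norm (gram_schmidt B l))"
      using nearest_plane[of 0 j B] by auto
    have cols: "column l C \<in> columns_before_span B m" if "idx l < m" for l m
    proof (cases "l = j")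
      case True
      have "(column j C - column j B) + column j B \<in> columns_before_span B m"
        using C(3) columns_before_span_mono[of "idx j" m B] that True
        by (intro subspace_add subspace_columns_before_span column_in_columns_before_span) auto
      then show ?thesis using True by simp
    qed (use C(2) that column_in_columns_before_span in auto)
    have low: "columns_before_span C m = columns_before_span B m" if "m \<le> idx j" for m
    proof -
      have "{column l C | l. idx l < m} = {column l B | l. idx l < m}"
        using that C(2) by (metis (no_types, opaque_lifting) not_less)
      then show ?thesis by (simp add: columns_before_span_def)
    qed
    have cols': "column l B \<in> columns_before_span C m" if "idx l < m" for l m
    proof (cases "l = j")
      case True
      have "column j C - column j B \<in> columns_before_span C m"
        using C(3) columns_before_span_mono[of "idx j" m C] that True low[of "idx j"] by auto
      moreover have "column j C \<in> columns_before_span C m" using that True by (intro column_in_columns_before_span) simp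
      ultimately show ?thesis
        using subspace_diff[OF subspace_columns_before_span, of "column j C" C m "column j C - column j B"] True by simp
    next
      case False
      then show ?thesis using C(2)[OF False] column_in_columns_before_span[OF that, of C] by simp
    qed
    have spans: "columns_before_span C m = columns_before_span B m" for m
      using columns_before_span_subset[of m C B] columns_before_span_subset[of m B C] cols cols' by blast
    have "gram_schmidt C l = gram_schmidt B l" for l
    proof (rule gram_schmidt_cong)
      show "column l C - column l B \<in> columns_before_span B (idx l)"
        using C(2,3) by (cases "l = j") (auto simp: subspace_0[OF subspace_columns_before_span])
    qed (rule spans)
    then have "lll_potential C = lll_potential B" by (rule lll_potential_cong)
    then have "(norm B)\<^sup>2 \<le> (norm C)\<^sup>2" using minB[of C] orb[OF C(1)] B by simp
    moreover have normsq: "(norm D)\<^sup>2 = (\<Sum>l\<in>UNIV. (norm (column l D))\<^sup>2)" for D :: "real ^ 'n ^ 'n"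
      unfolding power2_norm_matrix
      by (subst sum.swap) (simp add: norm_vec_def L2_set_def sum_nonneg column_def)
    moreover have "(\<Sum>l\<in>UNIV. (norm (column l D))\<^sup>2) = (norm (column j D))\<^sup>2 + (\<Sum>l\<in>UNIV - {j}. (norm (column l D))\<^sup>2)" for D :: "real ^ 'n ^ 'n"
      by (rule sum.remove) auto
    moreover have "(\<Sum>l\<in>UNIV - {j}. (norm (column l C))\<^sup>2) = (\<Sum>l\<in>UNIV - {j}. (norm (column l B))\<^sup>2)"
      using C(2) by (intro sum.cong) auto
    ultimately have "(norm (column j B))\<^sup>2 \<le> (norm (column j C))\<^sup>2" by simp
    then have "norm (column j B) \<le> norm (column j C)" by (rule power2_le_imp_le) simp
    also have "\<dots> \<le> (\<Sum>l | 0 \<le> idx l \<and> idx l \<le> idx j. norm (gram_schmidt B l))" using le C(4) by simp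
    also have "\<dots> \<le> (\<Sum>l\<in>UNIV. norm (gram_schmidt B l))" by (intro sum_mono2) auto
    finally show ?thesis .
  qed
  moreover have "norm (gram_schmidt B i) \<le> 2 * norm (gram_schmidt B i')" if "idx i' = Suc (idx i)" for i i'
    using lovasz_condition[OF detB that min_potential] B by blast
  ultimately show thesis using that B by blast
qed

text \<open>Lower bounds on the Gram--Schmidt lengths become upper bounds, since their product is
  \<open>det A\<close>: each of them is at least \<open>2 ^ (- k)\<close> times the length of the first column. Hence a reduced
  basis of bounded determinant can only be long if its first vector is short.\<close>

proposition exists_reduced_in_orbit:
  fixes A :: "real ^ 'n ^ 'n"
  assumes int: "\<And>i j. A $ i $ j \<in> \<int>" and det: "det A > 0" and p: "idx p = 0"
  obtains B where "B \<in> SL_orbit A"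
    "norm B * norm (column p B) ^ (CARD('n) - 1) \<le> real (CARD('n) * CARD('n) * 2 ^ (CARD('n) * CARD('n))) * det A"
proof -
  let ?k = "CARD('n)"
  obtain B where B: "B \<in> SL_orbit A"
    and lov: "\<And>i i'. idx i' = Suc (idx i) \<Longrightarrow> norm (gram_schmidt B i) \<le> 2 * norm (gram_schmidt B i')"
    and size: "\<And>j. norm (column j B) \<le> (\<Sum>l\<in>UNIV. norm (gram_schmidt B l))"
    using exists_LLL_reduced[OF int] det by (metis less_irrefl)
  have detB: "det B = det A" using det_SL_orbit[OF B] .
  define v where "v = norm (column p B)"
  have gp: "gram_schmidt B p = column p B" using gram_schmidt_diff[of p B] p by simp
  have "v \<le> 2 ^ idx i * norm (gram_schmidt B i)" for i :: 'n
  proof (induction "idx i" arbitrary: i)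
    case 0
    then have "i = p" using p by (metis idx_eq_iff)
    then show ?case using p gp by (simp add: v_def)
  next
    case (Suc m)
    then obtain q :: 'n where q: "idx q = m" using idx_surj[of m] idx_less[of i] by (metis Suc_lessD)
    have "v \<le> 2 ^ m * norm (gram_schmidt B q)" using Suc(1)[of q] q by simp
    also have "\<dots> \<le> 2 ^ m * (2 * norm (gram_schmidt B i))" using lov[of i q] q Suc(2) by (intro mult_left_mono) auto
    finally show ?case using Suc(2)[symmetric] by simp
  qed
  moreover have "2 ^ idx i * norm (gram_schmidt B i) \<le> 2 ^ ?k * norm (gram_schmidt B i)" for i
    using less_imp_le[OF idx_less[of i]] by (intro mult_right_mono power_increasing) auto
  ultimately have v: "v \<le> 2 ^ ?k * norm (gram_schmidt B i)" for i by (meson order_trans)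
  have "v \<ge> 0" by (simp add: v_def)
  have prod: "(\<Prod>i\<in>UNIV. norm (gram_schmidt B i)) = det A"
  proof -
    have "(\<Prod>i\<in>UNIV. norm (gram_schmidt B i))\<^sup>2 = (det A)\<^sup>2"
      by (simp add: prod_power_distrib prod_norm_gram_schmidt detB)
    then show ?thesis using det by (simp add: prod_nonneg power2_eq_iff_nonneg)
  qed
  have g: "norm (gram_schmidt B j) * v ^ (?k - 1) \<le> 2 ^ (?k * ?k) * det A" for j
  proof -
    have "v ^ (?k - 1) = (\<Prod>i\<in>UNIV - {j}. v)" by simp
    also have "\<dots> \<le> (\<Prod>i\<in>UNIV - {j}. 2 ^ ?k * norm (gram_schmidt B i))"
      using v \<open>v \<ge> 0\<close> by (intro prod_mono) auto
    also have "\<dots> = (2 ^ ?k) ^ (?k - 1) * (\<Prod>i\<in>UNIV - {j}. norm (gram_schmidt B i))"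
      by (simp add: prod.distrib)
    finally have "norm (gram_schmidt B j) * v ^ (?k - 1) \<le> norm (gram_schmidt B j) * ((2 ^ ?k) ^ (?k - 1) * (\<Prod>i\<in>UNIV - {j}. norm (gram_schmidt B i)))"
      by (intro mult_left_mono) auto
    also have "\<dots> = (2 ^ ?k) ^ (?k - 1) * det A"
      unfolding prod[symmetric] by (subst prod.remove[of UNIV j]) auto
    also have "\<dots> \<le> (2 ^ ?k) ^ ?k * det A"
      using det by (intro mult_right_mono power_increasing) auto
    finally show ?thesis by (simp add: power_mult)
  qed
  have "norm B \<le> (\<Sum>j\<in>UNIV. norm (column j B))"
  proof (rule power2_le_imp_le)
    have "(norm B)\<^sup>2 = (\<Sum>l\<in>UNIV. (norm (column l B))\<^sup>2)"
      unfolding power2_norm_matrix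
      by (subst sum.swap) (simp add: norm_vec_def L2_set_def sum_nonneg column_def)
    also have "\<dots> \<le> (\<Sum>l\<in>UNIV. norm (column l B) * (\<Sum>j\<in>UNIV. norm (column j B)))"
      unfolding power2_eq_square by (intro sum_mono mult_left_mono member_le_sum) auto
    also have "\<dots> = (\<Sum>j\<in>UNIV. norm (column j B))\<^sup>2" by (simp add: sum_distrib_right power2_eq_square)
    finally show "(norm B)\<^sup>2 \<le> (\<Sum>j\<in>UNIV. norm (column j B))\<^sup>2" .
  qed (simp add: sum_nonneg)
  also have "\<dots> \<le> (\<Sum>j\<in>(UNIV :: 'n set). \<Sum>l\<in>UNIV. norm (gram_schmidt B l))"
    by (intro sum_mono size)
  finally have "norm B * v ^ (?k - 1) \<le> (\<Sum>j\<in>(UNIV :: 'n set). \<Sum>l\<in>UNIV. norm (gram_schmidt B l)) * v ^ (?k - 1)"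
    using \<open>v \<ge> 0\<close> by (intro mult_right_mono) auto
  also have "\<dots> = (\<Sum>j\<in>(UNIV :: 'n set). \<Sum>l\<in>UNIV. norm (gram_schmidt B l) * v ^ (?k - 1))"
    by (simp add: sum_distrib_right)
  also have "\<dots> \<le> (\<Sum>j\<in>(UNIV :: 'n set). \<Sum>l\<in>(UNIV :: 'n set). 2 ^ (?k * ?k) * det A)"
    by (intro sum_mono g)
  finally show thesis using B that by (simp add: v_def mult.assoc)
qed

section \<open>Hermite normal forms and their number\<close>

lemma not_le_idx [simp]: "\<not> CARD('n) \<le> idx (i :: 'n::finite)"
  by (simp add: not_le)

text \<open>The Euclidean algorithm in the abstract: \<open>S\<close> is a set of objects with integer entries \<open>w B j\<close> that
  is closed under adding multiples of one entry to another. At a minimum of the sum of absolute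
  values at most one entry is nonzero, and two further steps move it to position \<open>q\<close>. It serves for
  row operations on a vector as well as for column operations on a row of a matrix.\<close>

lemma clear_entries:
  fixes w :: "'b \<Rightarrow> 'n::finite \<Rightarrow> real"
  assumes "B0 \<in> S" and int: "\<And>B j. B \<in> S \<Longrightarrow> w B j \<in> \<int>" and q: "q \<in> J"
    and op: "\<And>B i j m. B \<in> S \<Longrightarrow> i \<in> J \<Longrightarrow> j \<in> J \<Longrightarrow> i \<noteq> j \<Longrightarrow> m \<in> \<int> \<Longrightarrow>
      \<exists>B'\<in>S. \<forall>l. w B' l = (if l = j then w B j + m * w B i else w B l)"
  obtains B where "B \<in> S" "\<And>j. j \<in> J \<Longrightarrow> j \<noteq> q \<Longrightarrow> w B j = 0"
proof -
  define f where "f B = (\<Sum>j\<in>J. \<bar>w B j\<bar>)" for B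
  obtain B where B: "B \<in> S" and min: "\<And>C. C \<in> S \<Longrightarrow> f B \<le> f C"
  proof (rule ex_min_Ints[of "\<lambda>B. B \<in> S" B0 f])
    show "f B \<in> \<int>" "f B \<ge> 0" if "B \<in> S" for B
      using int[OF that] by (auto simp: f_def intro!: Ints_sum Ints_abs sum_nonneg)
  qed (use assms(1) in auto)
  have not_smaller: "w B i = 0" if ij: "i \<in> J" "j \<in> J" "i \<noteq> j" "w B j \<noteq> 0" "\<bar>w B i\<bar> \<le> \<bar>w B j\<bar>" for i j
  proof (rule ccontr)
    assume i: "w B i \<noteq> 0"
    \<comment> \<open>With this sign the addition lowers \<open>|w B j|\<close> by \<open>|w B i|\<close>.\<close>
    define m where "m = - sgn (w B i) * sgn (w B j)"
    have "m \<in> \<int>" by (auto simp: m_def sgn_if)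
    then obtain C where C: "C \<in> S" "\<And>l. w C l = (if l = j then w B j + m * w B i else w B l)"
      using op[OF B ij(1,2,3)] by blast
    have "\<bar>w C j\<bar> < \<bar>w B j\<bar>"
      using i ij(4,5) unfolding C(2) m_def by (auto simp: sgn_if abs_if split: if_splits)
    moreover have "(\<Sum>l\<in>J - {j}. \<bar>w C l\<bar>) = (\<Sum>l\<in>J - {j}. \<bar>w B l\<bar>)"
      by (intro sum.cong) (auto simp: C(2))
    ultimately have "f C < f B"
      unfolding f_def using ij(2) by (simp add: sum.remove[of J j])
    then show False using min[OF C(1)] by simp
  qed
  show thesis
  proof (cases "\<forall>j\<in>J. j \<noteq> q \<longrightarrow> w B j = 0")
    case True
    then show thesis using that B by blast
  next
    case False
    then obtain j where j: "j \<in> J" "j \<noteq> q" "w B j \<noteq> 0" by blast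
    have zero: "w B i = 0" if "i \<in> J" "i \<noteq> j" for i
    proof (cases "\<bar>w B i\<bar> \<le> \<bar>w B j\<bar>")
      case True
      then show ?thesis using not_smaller[of i j] j that by simp
    next
      case False
      then show ?thesis using not_smaller[of j i] j that by force
    qed
    obtain C where C: "C \<in> S" "\<And>l. w C l = (if l = q then w B q + 1 * w B j else w B l)"
      using op[OF B j(1) q j(2), of 1] by auto
    obtain D where D: "D \<in> S" "\<And>l. w D l = (if l = j then w C j + (-1) * w C q else w C l)"
      using op[OF C(1) q j(1), of "-1"] j(2) by auto
    have "w D i = 0" if "i \<in> J" "i \<noteq> q" for i
      using that zero[OF that(1)] zero[OF q] j by (auto simp: D(2) C(2))
    then show thesis using that D(1) by blast
  qed
qed

lemma SL_int_transpose: "A \<in> SL_int \<Longrightarrow> transpose A \<in> SL_int"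
  by (auto simp: SL_int_def transpose_def, metis det_transpose transpose_def)

lemma add_column_one_SL_int:
  assumes "i \<noteq> j" "c \<in> \<int>"
  shows "add_column i j c (mat 1 :: real ^ 'n ^ 'n) \<in> SL_int"
  using add_column_in_SL_orbit[OF assms, of "mat 1"] by (auto simp: SL_orbit_def)

lemma exists_SL_int_to_axis:
  fixes v :: "real ^ 'n"
  assumes int: "\<And>i. v $ i \<in> \<int>" and "v \<noteq> 0"
  shows "\<exists>U c. U \<in> SL_int \<and> c \<in> \<int> \<and> c \<noteq> 0 \<and> U *v v = c *\<^sub>R axis p 1"
proof -
  obtain U :: "real ^ 'n ^ 'n" where U: "U \<in> SL_int" and zero: "\<And>j. j \<in> UNIV \<Longrightarrow> j \<noteq> p \<Longrightarrow> (U *v v) $ j = 0"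
  proof (rule clear_entries[of "mat 1" SL_int "\<lambda>U j. (U *v v) $ j" p UNIV])
    show "(U *v v) $ j \<in> \<int>" if "U \<in> SL_int" for U :: "real ^ 'n ^ 'n" and j
      using that int by (auto simp: SL_int_def matrix_vector_mult_def intro!: Ints_sum Ints_mult)
    fix U :: "real ^ 'n ^ 'n" and i j :: 'n and m :: real
    assume U: "U \<in> SL_int" and ij: "i \<noteq> j" "m \<in> \<int>"
    define E where "E = transpose (add_column i j m (mat 1 :: real ^ 'n ^ 'n))"
    have "E *v x = (\<chi> l. if l = j then x $ j + m * x $ i else x $ l)" for x
    proof -
      have E: "E $ l $ s = (if s = l then 1 else 0) + (if s = i then if l = j then m else 0 else 0)" for l s
        using ij(1) by (simp add: E_def add_column_def transpose_def mat_def)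
      have "(E *v x) $ l = x $ l + (if l = j then m else 0) * x $ i" for l
        by (simp add: matrix_vector_mult_def E distrib_right sum.distrib if_distrib[of "\<lambda>z. z * y" for y]
            cong: if_cong)
      then show ?thesis by (simp add: vec_eq_iff)
    qed
    moreover have "E ** U \<in> SL_int"
      unfolding E_def using U ij by (intro SL_int_mult SL_int_transpose add_column_one_SL_int)
    ultimately show "\<exists>B'\<in>SL_int. \<forall>l. (B' *v v) $ l = (if l = j then (U *v v) $ j + m * (U *v v) $ i else (U *v v) $ l)"
      by (intro bexI[of _ "E ** U"]) (simp_all flip: matrix_vector_mul_assoc)
  qed (use that in auto)
  define c where "c = (U *v v) $ p"
  have eq: "U *v v = c *\<^sub>R axis p 1"
    using zero by (auto simp: c_def vec_eq_iff axis_def)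
  have "c \<in> \<int>" using U int unfolding c_def
    by (auto simp: SL_int_def matrix_vector_mult_def intro!: Ints_sum Ints_mult)
  moreover have "c \<noteq> 0"
  proof
    assume "c = 0"
    then have "U *v v = 0" by (simp add: eq)
    obtain W where W: "W ** U = mat 1" using SL_int_inverse[OF U] by metis
    have "v = W *v (U *v v)" by (simp add: matrix_vector_mul_assoc W)
    then have "v = 0" by (simp add: \<open>U *v v = 0\<close>)
    then show False using \<open>v \<noteq> 0\<close> by simp
  qed
  ultimately show ?thesis using U eq by blast
qed

definition upper_triangular :: "real ^ 'n ^ 'n \<Rightarrow> bool" where
  "upper_triangular H \<longleftrightarrow> (\<forall>i j. idx j < idx i \<longrightarrow> H $ i $ j = 0)"

lemma det_upper_triangular: "upper_triangular H \<Longrightarrow> det H = (\<Prod>i\<in>UNIV. H $ i $ i)"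
  by (intro det_triangular) (auto simp: upper_triangular_def)

lemma add_column_entry:
  "add_column i j c A $ r $ s = (if s = j then A $ r $ j + c * A $ r $ i else A $ r $ s)"
  by (simp add: add_column_def)

text \<open>Clear the rows from the bottom up, using only columns that already vanish in the rows below. The
  column \<open>p\<close> takes no part in this, because it is already zero off the diagonal.\<close>

lemma exists_upper_triangular_in_orbit:
  fixes A :: "real ^ 'n ^ 'n"
  assumes int: "\<And>i j. A $ i $ j \<in> \<int>" and p: "idx p = 0"
    and col: "\<And>i. i \<noteq> p \<Longrightarrow> A $ i $ p = 0"
  obtains B where "B \<in> SL_orbit A" "column p B = column p A" "upper_triangular B"
proof -
  define S where "S s = {B \<in> SL_orbit A. column p B = column p A \<and>
    (\<forall>i j. s \<le> idx i \<longrightarrow> idx j < idx i \<longrightarrow> B $ i $ j = 0)}" for s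
  have "\<exists>B. B \<in> S 1"
  proof (rule inc_induct[of 1 "CARD('n)"])
    show "1 \<le> CARD('n)" by (simp add: Suc_leI)
    have "A \<in> S CARD('n)" by (simp add: S_def not_le_idx)
    then show "\<exists>B. B \<in> S CARD('n)" by blast
    fix s assume s: "1 \<le> s" "s < CARD('n)" and "\<exists>B. B \<in> S (Suc s)"
    then obtain B0 where B0: "B0 \<in> S (Suc s)" by blast
    obtain q :: 'n where q: "idx q = s" using idx_surj s(2) by blast
    obtain B where B: "B \<in> S (Suc s)"
      and zero: "\<And>j. j \<in> {j. 1 \<le> idx j \<and> idx j \<le> s} \<Longrightarrow> j \<noteq> q \<Longrightarrow> B $ q $ j = 0"
    proof (rule clear_entries[of B0 "S (Suc s)" "\<lambda>B j. B $ q $ j" q "{j. 1 \<le> idx j \<and> idx j \<le> s}"])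
      show "B $ q $ j \<in> \<int>" if "B \<in> S (Suc s)" for B j
        using that SL_orbit_Ints[OF _ int] by (simp add: S_def)
      fix B :: "real ^ 'n ^ 'n" and i j :: 'n and m :: real
      assume B: "B \<in> S (Suc s)" and ij: "i \<in> {j. 1 \<le> idx j \<and> idx j \<le> s}" "j \<in> {j. 1 \<le> idx j \<and> idx j \<le> s}"
        "i \<noteq> j" "m \<in> \<int>"
      have "add_column i j m B \<in> S (Suc s)"
        unfolding S_def
      proof (intro CollectI conjI allI impI)
        show "add_column i j m B \<in> SL_orbit A"
          using B ij by (auto simp: S_def intro: SL_orbit_trans add_column_in_SL_orbit)
        have "p \<noteq> j" using ij(2) p by auto
        then show "column p (add_column i j m B) = column p A"
          using B by (simp add: column_add_column S_def)
        fix r l :: 'n assume "Suc s \<le> idx r" "idx l < idx r"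
        then show "add_column i j m B $ r $ l = 0"
          using B ij by (auto simp: add_column_entry S_def)
      qed
      then show "\<exists>B'\<in>S (Suc s). \<forall>l. B' $ q $ l = (if l = j then B $ q $ j + m * B $ q $ i else B $ q $ l)"
        by (intro bexI[of _ "add_column i j m B"]) (simp_all add: add_column_entry)
    qed (use B0 q s that in auto)
    have "B \<in> S s"
      unfolding S_def
    proof (intro CollectI conjI allI impI)
      fix r l :: 'n assume rl: "s \<le> idx r" "idx l < idx r"
      show "B $ r $ l = 0"
      proof (cases "idx r = s")
        case True
        then have r: "r = q" using q by (metis idx_eq_iff)
        show ?thesis
        proof (cases "l = p")
          case True
          have "B $ q $ p = column p B $ q" by (simp add: column_def)
          also have "\<dots> = A $ q $ p" using B by (simp add: S_def column_def)
          also have "\<dots> = 0" using q s p by (intro col) auto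
          finally show ?thesis using r True by simp
        next
          case False
          then have "idx l \<noteq> 0" using p by (metis idx_eq_iff)
          then show ?thesis using zero[of l] rl r q by (auto simp: Suc_le_eq)
        qed
      next
        case False
        then show ?thesis using B rl by (simp add: S_def)
      qed
    qed (use B in \<open>simp_all add: S_def\<close>)
    then show "\<exists>B. B \<in> S s" by blast
  qed
  then obtain B where B: "B \<in> S 1" by blast
  have "upper_triangular B" using B by (auto simp: upper_triangular_def S_def Suc_le_eq)
  then show thesis using B that[of B] by (simp add: S_def)
qed

definition reduced_row :: "real ^ 'n ^ 'n \<Rightarrow> 'n \<Rightarrow> bool" where
  "reduced_row H i \<longleftrightarrow> (\<forall>j. idx i < idx j \<longrightarrow> 0 \<le> H $ i $ j \<and> H $ i $ j < \<bar>H $ i $ i\<bar>)"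

text \<open>Reduce the entries to the right of the diagonal modulo the diagonal entry, from the bottom row
  upwards. Adding multiples of column \<open>q\<close> does not affect the rows below \<open>q\<close>.\<close>

lemma exists_hermite_in_orbit:
  fixes A :: "real ^ 'n ^ 'n"
  assumes int: "\<And>i j. A $ i $ j \<in> \<int>" and det: "det A \<noteq> 0" and p: "idx p = 0"
    and col: "\<And>i. i \<noteq> p \<Longrightarrow> A $ i $ p = 0"
  obtains H where "H \<in> SL_orbit A" "column p H = column p A" "upper_triangular H" "\<And>i. reduced_row H i"
proof -
  define T where "T s = {B \<in> SL_orbit A. column p B = column p A \<and> upper_triangular B \<and>
    (\<forall>i. s \<le> idx i \<longrightarrow> reduced_row B i)}" for s
  have "\<exists>B. B \<in> T 0"
  proof (rule inc_induct[of 0 "CARD('n)"])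
    show "0 \<le> CARD('n)" by simp
    obtain B where "B \<in> SL_orbit A" "column p B = column p A" "upper_triangular B"
      using exists_upper_triangular_in_orbit[OF int p col] by blast
    then have "B \<in> T CARD('n)" by (simp add: T_def not_le_idx)
    then show "\<exists>B. B \<in> T CARD('n)" by blast
    fix s assume s: "s < CARD('n)" and ex: "\<exists>B. B \<in> T (Suc s)"
    obtain q :: 'n where q: "idx q = s" using idx_surj s by blast
    have "\<exists>B. B \<in> T (Suc s) \<and> (\<forall>j\<in>J. 0 \<le> B $ q $ j \<and> B $ q $ j < \<bar>B $ q $ q\<bar>)"
      if "finite J" "J \<subseteq> {j. s < idx j}" for J
      using that
    proof (induction J rule: finite_induct)
      case empty
      then show ?case using ex by simp
    next
      case (insert j J)
      then obtain B where B: "B \<in> T (Suc s)" and J: "\<And>l. l \<in> J \<Longrightarrow> 0 \<le> B $ q $ l \<and> B $ q $ l < \<bar>B $ q $ q\<bar>"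
        by auto
      have j: "s < idx j" "q \<noteq> j" "j \<noteq> p" using insert.prems q p by auto
      have "det B \<noteq> 0" using B det det_SL_orbit[of B A] by (simp add: T_def)
      moreover have "det B = (\<Prod>i\<in>UNIV. B $ i $ i)" using B by (simp add: T_def det_upper_triangular)
      ultimately have d: "B $ q $ q \<noteq> 0" by auto
      define m where "m = - sgn (B $ q $ q) * of_int \<lfloor>B $ q $ j / \<bar>B $ q $ q\<bar>\<rfloor>"
      have "m \<in> \<int>" by (auto simp: m_def sgn_if)
      define B' where "B' = add_column q j m B"
      have "B' \<in> T (Suc s)"
        unfolding T_def
      proof (intro CollectI conjI allI impI)
        show "B' \<in> SL_orbit A"
          using B \<open>m \<in> \<int>\<close> j unfolding B'_def by (auto simp: T_def intro: SL_orbit_trans add_column_in_SL_orbit)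
        show "column p B' = column p A" using B j by (simp add: B'_def column_add_column T_def)
        have up: "B $ i $ l = 0" if "idx l < idx i" for i l using B that by (simp add: T_def upper_triangular_def)
        show "upper_triangular B'"
          unfolding upper_triangular_def B'_def add_column_entry using up q j by auto
        fix i :: 'n assume i: "Suc s \<le> idx i"
        then have "B $ i $ q = 0" using q by (intro up) auto
        then have "B' $ i $ l = B $ i $ l" for l by (simp add: B'_def add_column_entry)
        moreover have "reduced_row B i" using B i by (simp add: T_def)
        ultimately show "reduced_row B' i" by (simp add: reduced_row_def)
      qed
      moreover have "0 \<le> B' $ q $ l \<and> B' $ q $ l < \<bar>B' $ q $ q\<bar>" if "l \<in> insert j J" for l
      proof (cases "l = j")
        case True
        define a where "a = \<bar>B $ q $ q\<bar>"
        define x where "x = B $ q $ j / a"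
        have a: "a > 0" using d by (simp add: a_def)
        have "sgn (B $ q $ q) * B $ q $ q = a" by (simp add: a_def abs_sgn mult.commute)
        then have "B' $ q $ j = a * (x - of_int \<lfloor>x\<rfloor>)"
          using a by (simp add: B'_def add_column_entry m_def x_def a_def[symmetric] field_simps)
        moreover have "0 \<le> x - of_int \<lfloor>x\<rfloor>" "x - of_int \<lfloor>x\<rfloor> < 1" by linarith+
        then have "0 \<le> a * (x - of_int \<lfloor>x\<rfloor>)" "a * (x - of_int \<lfloor>x\<rfloor>) < a * 1"
          using a by (auto intro: mult_nonneg_nonneg mult_strict_left_mono)
        moreover have "B' $ q $ q = B $ q $ q" using j by (simp add: B'_def add_column_entry)
        ultimately show ?thesis using True by (simp add: a_def)
      next
        case False
        then show ?thesis using J[of l] that j by (simp add: B'_def add_column_entry)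
      qed
      ultimately show ?case by blast
    qed
    from this[of "{j. s < idx j}"] obtain B where B: "B \<in> T (Suc s)"
      and red: "\<And>j. s < idx j \<Longrightarrow> 0 \<le> B $ q $ j \<and> B $ q $ j < \<bar>B $ q $ q\<bar>"
      by auto
    have "reduced_row B i" if i: "s \<le> idx i" for i
    proof (cases "i = q")
      case True
      then show ?thesis using red q by (simp add: reduced_row_def)
    next
      case False
      then have "idx i \<noteq> s" using q by auto
      then show ?thesis using B i by (simp add: T_def)
    qed
    then show "\<exists>B. B \<in> T s" using B by (auto simp: T_def)
  qed
  then show thesis using that by (auto simp: T_def)
qed

definition hermite :: "'n \<Rightarrow> real \<Rightarrow> real \<Rightarrow> (real ^ 'n ^ 'n) set" where
  "hermite p c X = {H. (\<forall>i j. H $ i $ j \<in> \<int>) \<and> upper_triangular H \<and> (\<forall>i. reduced_row H i) \<and>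
     H $ p $ p = c \<and> 0 < \<bar>det H\<bar> \<and> \<bar>det H\<bar> \<le> X}"

lemma card_idx_greater: "card {j :: 'n::finite. idx i < idx j} = CARD('n) - 1 - idx (i :: 'n)"
proof -
  have "idx ` {j :: 'n. idx i < idx j} = {idx i<..<CARD('n)}"
    using idx_surj[where 'n = 'n] by (auto simp: image_iff) metis
  then have "card {idx i<..<CARD('n)} = card {j :: 'n. idx i < idx j}"
    using card_image[of idx "{j :: 'n. idx i < idx j}"] by (simp add: inj_on_def)
  then show ?thesis by simp
qed

lemma sum_inverse_squares_le: "(\<Sum>m=1..N. 1 / (real m)\<^sup>2) \<le> 2 - 1 / real N"
proof (induction N)
  case (Suc N)
  show ?case
  proof (cases "N = 0")
    case False
    then have "1 / (real (Suc N))\<^sup>2 \<le> 1 / (real N * real (Suc N))"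
      by (intro divide_left_mono) (auto simp: power2_eq_square)
    also have "\<dots> = 1 / real N - 1 / real (Suc N)" using False by (simp add: field_simps)
    finally show ?thesis using Suc by simp
  qed simp
qed simp

lemma sum_inverse_squares_int_le: "(\<Sum>m\<in>{-N..N} - {0::int}. 1 / (real_of_int m)\<^sup>2) \<le> 4"
proof -
  let ?f = "\<lambda>m. 1 / (real_of_int m)\<^sup>2"
  let ?P = "int ` {1..nat N}" and ?M = "(\<lambda>m. - int m) ` {1..nat N}"
  have "x \<in> ?P \<union> ?M" if "x \<in> {-N..N} - {0}" for x
  proof (cases "x > 0")
    case True
    then have "x = int (nat x)" "nat x \<in> {1..nat N}" using that by auto
    then show ?thesis by blast
  next
    case False
    then have "x = - int (nat (- x))" "nat (- x) \<in> {1..nat N}" using that by auto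
    then show ?thesis by blast
  qed
  then have "{-N..N} - {0} \<subseteq> ?P \<union> ?M" by blast
  then have "sum ?f ({-N..N} - {0}) \<le> sum ?f (?P \<union> ?M)"
    by (rule sum_mono2[rotated]) auto
  also have "\<dots> \<le> sum ?f ?P + sum ?f ?M"
    by (subst sum.union_disjoint) auto
  also have "sum ?f ?P = (\<Sum>m=1..nat N. 1 / (real m)\<^sup>2)"
    by (subst sum.reindex) (auto simp: inj_on_def)
  also have "sum ?f ?M = (\<Sum>m=1..nat N. 1 / (real m)\<^sup>2)"
    by (subst sum.reindex) (auto simp: inj_on_def)
  also have "(\<Sum>m=1..nat N. 1 / (real m)\<^sup>2) + (\<Sum>m=1..nat N. 1 / (real m)\<^sup>2) \<le> 4"
    using sum_inverse_squares_le[of "nat N"] by (smt (verit) divide_nonneg_nonneg of_nat_0_le_iff)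
  finally show ?thesis .
qed

lemma card_nonzero_int_le:
  assumes "Y \<ge> 0"
  shows "finite {m :: int. m \<noteq> 0 \<and> \<bar>real_of_int m\<bar> \<le> Y}"
    and "real (card {m :: int. m \<noteq> 0 \<and> \<bar>real_of_int m\<bar> \<le> Y}) \<le> 2 * Y"
proof -
  have eq: "{m :: int. m \<noteq> 0 \<and> \<bar>real_of_int m\<bar> \<le> Y} = {-\<lfloor>Y\<rfloor>..\<lfloor>Y\<rfloor>} - {0}"
  proof -
    have "\<bar>real_of_int m\<bar> \<le> Y \<longleftrightarrow> - \<lfloor>Y\<rfloor> \<le> m \<and> m \<le> \<lfloor>Y\<rfloor>" for m
      by (simp add: abs_le_iff le_floor_iff) linarith
    then show ?thesis unfolding set_eq_iff Diff_iff mem_Collect_eq atLeastAtMost_iff singleton_iff by blast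
  qed
  show "finite {m :: int. m \<noteq> 0 \<and> \<bar>real_of_int m\<bar> \<le> Y}"
    unfolding eq by (intro finite_Diff finite_atLeastAtMost_int)
  define n where "n = \<lfloor>Y\<rfloor>"
  have n: "n \<ge> 0" "real_of_int n \<le> Y" using assms by (auto simp: n_def)
  have "card ({-n..n} - {0}) = card {-n..n} - 1" using n(1) by (intro card_Diff_singleton) simp
  also have "\<dots> = nat (2 * n)" using n(1) by simp
  finally have "real (card ({-n..n} - {0})) = 2 * real_of_int n" using n(1) by simp
  then show "real (card {m :: int. m \<noteq> 0 \<and> \<bar>real_of_int m\<bar> \<le> Y}) \<le> 2 * Y"
    unfolding eq n_def[symmetric] using n(2) by linarith
qed

text \<open>Here \<open>d\<close> runs over the possible diagonals with a fixed first entry \<open>c\<close>, and the product counts the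
  Hermite normal forms with this diagonal. Let \<open>P\<close> be the product of \<open>|d\<^sub>i|\<close> over \<open>J\<close>, the indices
  from \<open>2\<close> on. As \<open>|c| |d\<^sub>q| P \<le> X\<close>, each summand is at most
  \<open>X ^ (k - 1) \<cdot> (|c| P / X) \<cdot> (\<Prod>i\<in>J. 1 / d\<^sub>i\<^sup>2)\<close>. For fixed entries in \<open>J\<close> there are at most
  \<open>2 X / (|c| P)\<close> choices for \<open>d\<^sub>q\<close>, which cancels the middle factor; what remains is a product of
  convergent series. The entry \<open>d\<^sub>q\<close> has to be treated separately, as it would produce the divergent
  harmonic series.\<close>

lemma sum_diagonals_le:
  fixes p q :: "'n::finite" and c X :: real
  assumes p: "idx p = 0" and q: "idx q = 1" and X: "X > 0"
  defines "D \<equiv> {d :: 'n \<Rightarrow> int. real_of_int (d p) = c \<and> (\<forall>i. d i \<noteq> 0) \<and> (\<Prod>i\<in>UNIV. \<bar>real_of_int (d i)\<bar>) \<le> X}"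
  shows "finite D"
    and "(\<Sum>d\<in>D. \<Prod>i\<in>UNIV. \<bar>real_of_int (d i)\<bar> ^ (CARD('n) - 1 - idx i)) \<le>
      2 * 4 ^ CARD('n) * X ^ (CARD('n) - 1)"
proof -
  let ?k = "CARD('n)"
  define N where "N = \<lfloor>X\<rfloor>"
  define J where "J = UNIV - {p, q}"
  define E where "E = J \<rightarrow>\<^sub>E ({-N..N} - {0})"
  define P where "P d = (\<Prod>i\<in>J. \<bar>real_of_int (d i)\<bar>)" for d :: "'n \<Rightarrow> int"
  define Q where "Q d = (\<Prod>i\<in>J. 1 / (real_of_int (d i))\<^sup>2)" for d :: "'n \<Rightarrow> int"
  have pq: "p \<noteq> q" using p q by auto
  have k: "?k \<ge> 2" using idx_less[of q] q by simp
  have split: "(\<Prod>i\<in>UNIV. f i) = f p * (f q * (\<Prod>i\<in>J. f i))" for f :: "'n \<Rightarrow> real"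
  proof -
    have "UNIV = insert p (insert q J)" by (auto simp: J_def)
    then have "prod f UNIV = prod f (insert p (insert q J))" by simp
    then show ?thesis using pq by (simp add: J_def)
  qed
  have ge1: "1 \<le> \<bar>real_of_int (d i)\<bar>" if "d \<in> D" for d i
  proof -
    have "d i \<noteq> 0" using that by (simp add: D_def)
    then have "1 \<le> \<bar>d i\<bar>" by linarith
    then have "real_of_int 1 \<le> real_of_int \<bar>d i\<bar>" by (simp only: of_int_le_iff)
    then show ?thesis by simp
  qed
  have le: "\<bar>real_of_int (d i)\<bar> \<le> X" if d: "d \<in> D" for d i
  proof -
    have "1 \<le> (\<Prod>j\<in>UNIV - {i}. \<bar>real_of_int (d j)\<bar>)" using ge1[OF d] by (intro prod_ge_1) auto
    then have "\<bar>real_of_int (d i)\<bar> * 1 \<le> \<bar>real_of_int (d i)\<bar> * (\<Prod>j\<in>UNIV - {i}. \<bar>real_of_int (d j)\<bar>)"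
      by (intro mult_left_mono) auto
    also have "\<dots> = (\<Prod>j\<in>UNIV. \<bar>real_of_int (d j)\<bar>)" by (rule prod.remove[symmetric]) auto
    also have "\<dots> \<le> X" using d by (simp add: D_def)
    finally show ?thesis by simp
  qed
  then have mem: "d i \<in> {-N..N}" if "d \<in> D" for d i
  proof -
    have "\<bar>real_of_int (d i)\<bar> \<le> X" using le[OF that] .
    then show ?thesis by (simp add: N_def abs_le_iff le_floor_iff) linarith
  qed
  then have "D \<subseteq> UNIV \<rightarrow>\<^sub>E {-N..N}" by auto
  then show finD: "finite D" by (rule finite_subset) (intro finite_PiE, auto)
  have E: "(\<lambda>d. restrict d J) ` D \<subseteq> E"
  proof (rule image_subsetI)
    fix d assume d: "d \<in> D"
    then have "d i \<in> {-N..N} - {0}" for i using mem[OF d, of i] by (auto simp: D_def)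
    then show "restrict d J \<in> E" by (auto simp: E_def)
  qed
  have finE: "finite E" unfolding E_def by (intro finite_PiE) auto
  have restr: "P (restrict d J) = P d" "Q (restrict d J) = Q d" for d
    by (auto simp: P_def Q_def intro!: prod.cong)
  have term_le: "(\<Prod>i\<in>UNIV. \<bar>real_of_int (d i)\<bar> ^ (?k - 1 - idx i)) \<le> X ^ (?k - 1) * (\<bar>c\<bar> * P d / X * Q d)"
    if d: "d \<in> D" for d
  proof -
    define a where "a = \<bar>real_of_int (d p)\<bar>"
    define b where "b = \<bar>real_of_int (d q)\<bar>"
    have abP: "a * (b * P d) \<le> X"
    proof -
      have "(\<Prod>i\<in>UNIV. \<bar>real_of_int (d i)\<bar>) \<le> X" using d by (simp add: D_def)
      then show ?thesis unfolding split[of "\<lambda>i. \<bar>real_of_int (d i)\<bar>"] a_def b_def P_def .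
    qed
    have nonneg: "0 \<le> a" "0 \<le> b" "0 \<le> P d" "0 \<le> Q d"
      by (auto simp: a_def b_def P_def Q_def intro!: prod_nonneg)
    have "(\<Prod>i\<in>J. \<bar>real_of_int (d i)\<bar> ^ (?k - 1 - idx i)) \<le>
        (\<Prod>i\<in>J. \<bar>real_of_int (d i)\<bar> ^ (?k - 1) * (1 / (real_of_int (d i))\<^sup>2))"
    proof (intro prod_mono conjI)
      fix i assume "i \<in> J"
      then have "i \<noteq> p" "i \<noteq> q" by (auto simp: J_def)
      then have "idx i \<noteq> 0" "idx i \<noteq> 1" using p q by (metis idx_eq_iff)+
      then have "?k - 1 - idx i + 2 \<le> ?k - 1" using idx_less[of i] by linarith
      then have le: "\<bar>real_of_int (d i)\<bar> ^ (?k - 1 - idx i + 2) \<le> \<bar>real_of_int (d i)\<bar> ^ (?k - 1)"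
        using ge1[OF d] by (intro power_increasing)
      have nz: "real_of_int (d i) \<noteq> 0" using d by (simp add: D_def)
      have eq: "\<bar>real_of_int (d i)\<bar> ^ (?k - 1 - idx i + 2) = \<bar>real_of_int (d i)\<bar> ^ (?k - 1 - idx i) * (real_of_int (d i))\<^sup>2"
        by (simp only: power_add power2_abs)
      show "\<bar>real_of_int (d i)\<bar> ^ (?k - 1 - idx i) \<le> \<bar>real_of_int (d i)\<bar> ^ (?k - 1) * (1 / (real_of_int (d i))\<^sup>2)"
        using le nz unfolding eq by (simp add: pos_le_divide_eq)
    qed auto
    also have "\<dots> = P d ^ (?k - 1) * Q d" by (simp only: prod.distrib P_def Q_def prod_power_distrib)
    finally have J: "(\<Prod>i\<in>J. \<bar>real_of_int (d i)\<bar> ^ (?k - 1 - idx i)) \<le> P d ^ (?k - 1) * Q d" .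
    have "(\<Prod>i\<in>UNIV. \<bar>real_of_int (d i)\<bar> ^ (?k - 1 - idx i)) =
        a ^ (?k - 1) * (b ^ (?k - 2) * (\<Prod>i\<in>J. \<bar>real_of_int (d i)\<bar> ^ (?k - 1 - idx i)))"
      unfolding split[of "\<lambda>i. \<bar>real_of_int (d i)\<bar> ^ (?k - 1 - idx i)"]
      by (simp add: p q a_def b_def numeral_2_eq_2)
    also have "\<dots> \<le> a ^ (?k - 1) * (b ^ (?k - 2) * (P d ^ (?k - 1) * Q d))"
      using J nonneg by (intro mult_left_mono) auto
    also have "\<dots> = (a * (b * P d)) ^ (?k - 2) * (a * P d * Q d)"
    proof -
      have "?k - 1 = Suc (?k - 2)" using k by simp
      then show ?thesis by (simp add: power_mult_distrib mult_ac)
    qed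
    also have "\<dots> \<le> X ^ (?k - 2) * (a * P d * Q d)"
      using abP nonneg by (intro mult_right_mono power_mono) auto
    also have "\<dots> = X ^ (?k - 1) * (\<bar>c\<bar> * P d / X * Q d)"
    proof -
      have "?k - 1 = Suc (?k - 2)" using k by simp
      moreover have "a = \<bar>c\<bar>" using d by (simp add: a_def D_def)
      ultimately show ?thesis using X by simp
    qed
    finally show ?thesis .
  qed
  have fibre: "real (card {d \<in> D. restrict d J = e}) * (\<bar>c\<bar> * P e / X * Q e) \<le> 2 * Q e" if "e \<in> E" for e
  proof (cases "{d \<in> D. restrict d J = e} = {}")
    case True
    have "Q e \<ge> 0" by (auto simp: Q_def intro!: prod_nonneg)
    moreover have "card {d \<in> D. restrict d J = e} = 0" unfolding True by simp
    ultimately show ?thesis by simp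
  next
    case False
    then obtain d0 where d0: "d0 \<in> D" "restrict d0 J = e" by blast
    have c: "\<bar>c\<bar> \<ge> 1" using ge1[OF d0(1), of p] d0(1) by (simp add: D_def)
    have Pe: "P e \<ge> 1"
      unfolding d0(2)[symmetric] restr P_def using ge1[OF d0(1)] by (intro prod_ge_1) auto
    have Qe: "Q e \<ge> 0" by (auto simp: Q_def intro!: prod_nonneg)
    define Y where "Y = X / (\<bar>c\<bar> * P e)"
    have cP: "\<bar>c\<bar> * P e > 0" using c Pe by simp
    have Y: "Y \<ge> 0" using X cP by (simp add: Y_def)
    have "inj_on (\<lambda>d. d q) {d \<in> D. restrict d J = e}"
    proof (rule inj_onI)
      fix d d' assume d: "d \<in> {d \<in> D. restrict d J = e}" "d' \<in> {d \<in> D. restrict d J = e}" and eq: "d q = d' q"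
      have "d i = d' i" for i
      proof -
        consider "i = p" | "i = q" | "i \<in> J" by (auto simp: J_def)
        then show ?thesis
        proof cases
          case 1
          have "real_of_int (d p) = real_of_int (d' p)" using d by (simp add: D_def)
          then show ?thesis using 1 by simp
        next
          case 3
          then show ?thesis using d by (metis (mono_tags, lifting) mem_Collect_eq restrict_apply')
        qed (use eq in simp)
      qed
      then show "d = d'" by blast
    qed
    moreover have "(\<lambda>d. d q) ` {d \<in> D. restrict d J = e} \<subseteq> {m. m \<noteq> 0 \<and> \<bar>real_of_int m\<bar> \<le> Y}"
    proof (rule image_subsetI)
      fix d assume d: "d \<in> {d \<in> D. restrict d J = e}"
      then have "P d = P e" using restr(1)[of d] by simp
      moreover have "(\<Prod>i\<in>UNIV. \<bar>real_of_int (d i)\<bar>) \<le> X" using d by (simp add: D_def)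
      then have "\<bar>real_of_int (d p)\<bar> * (\<bar>real_of_int (d q)\<bar> * P d) \<le> X"
        unfolding split[of "\<lambda>i. \<bar>real_of_int (d i)\<bar>"] P_def .
      moreover have "real_of_int (d p) = c" using d by (simp add: D_def)
      ultimately have "\<bar>c\<bar> * (\<bar>real_of_int (d q)\<bar> * P e) \<le> X" by simp
      then have "\<bar>real_of_int (d q)\<bar> \<le> Y" using cP by (simp add: Y_def pos_le_divide_eq mult_ac)
      then show "d q \<in> {m. m \<noteq> 0 \<and> \<bar>real_of_int m\<bar> \<le> Y}" using d by (simp add: D_def)
    qed
    ultimately have "card {d \<in> D. restrict d J = e} \<le> card {m :: int. m \<noteq> 0 \<and> \<bar>real_of_int m\<bar> \<le> Y}"
      using card_nonzero_int_le(1)[OF Y] by (rule card_inj_on_le)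
    then have "real (card {d \<in> D. restrict d J = e}) \<le> 2 * Y"
      using card_nonzero_int_le(2)[OF Y] by linarith
    then have "real (card {d \<in> D. restrict d J = e}) * (\<bar>c\<bar> * P e / X * Q e) \<le> (2 * Y) * (\<bar>c\<bar> * P e / X * Q e)"
      using cP X Qe by (intro mult_right_mono) auto
    also have "\<dots> = 2 * Q e" using c Pe X by (auto simp: Y_def)
    finally show ?thesis .
  qed
  have "(\<Sum>d\<in>D. \<Prod>i\<in>UNIV. \<bar>real_of_int (d i)\<bar> ^ (?k - 1 - idx i)) \<le>
      (\<Sum>d\<in>D. X ^ (?k - 1) * (\<bar>c\<bar> * P d / X * Q d))"
    by (intro sum_mono term_le)
  also have "\<dots> = (\<Sum>e\<in>E. \<Sum>d | d \<in> D \<and> restrict d J = e. X ^ (?k - 1) * (\<bar>c\<bar> * P d / X * Q d))"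
    by (rule sum.group[OF finD finE E, symmetric])
  also have "\<dots> = (\<Sum>e\<in>E. X ^ (?k - 1) * (real (card {d \<in> D. restrict d J = e}) * (\<bar>c\<bar> * P e / X * Q e)))"
  proof (rule sum.cong[OF refl])
    fix e
    have "(\<Sum>d | d \<in> D \<and> restrict d J = e. X ^ (?k - 1) * (\<bar>c\<bar> * P d / X * Q d)) =
        (\<Sum>d | d \<in> D \<and> restrict d J = e. X ^ (?k - 1) * (\<bar>c\<bar> * P e / X * Q e))"
    proof (rule sum.cong[OF refl])
      fix d assume "d \<in> {d. d \<in> D \<and> restrict d J = e}"
      then have "P d = P e" "Q d = Q e" using restr[of d] by auto
      then show "X ^ (?k - 1) * (\<bar>c\<bar> * P d / X * Q d) = X ^ (?k - 1) * (\<bar>c\<bar> * P e / X * Q e)" by simp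
    qed
    then show "(\<Sum>d | d \<in> D \<and> restrict d J = e. X ^ (?k - 1) * (\<bar>c\<bar> * P d / X * Q d)) =
        X ^ (?k - 1) * (real (card {d \<in> D. restrict d J = e}) * (\<bar>c\<bar> * P e / X * Q e))"
      by simp
  qed
  also have "\<dots> \<le> (\<Sum>e\<in>E. X ^ (?k - 1) * (2 * Q e))"
    using X by (intro sum_mono mult_left_mono fibre) auto
  also have "\<dots> = X ^ (?k - 1) * 2 * (\<Sum>e\<in>E. Q e)" by (simp only: sum_distrib_left mult.assoc)
  also have "(\<Sum>e\<in>E. Q e) = (\<Prod>i\<in>J. \<Sum>m\<in>{-N..N} - {0}. 1 / (real_of_int m)\<^sup>2)"
    unfolding Q_def E_def by (rule prod_sum_PiE[symmetric]) auto
  also have "\<dots> \<le> (\<Prod>i\<in>J. 4)"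
    by (intro prod_mono conjI sum_inverse_squares_int_le sum_nonneg) auto
  also have "\<dots> \<le> 4 ^ ?k"
    by (simp add: card_mono power_increasing)
  finally show "(\<Sum>d\<in>D. \<Prod>i\<in>UNIV. \<bar>real_of_int (d i)\<bar> ^ (?k - 1 - idx i)) \<le> 2 * 4 ^ ?k * X ^ (?k - 1)"
    using X by (simp add: mult_ac)
qed

text \<open>The bound does not depend on \<open>c\<close>: fixing the first diagonal entry leaves \<open>|c| ^ (k - 1)\<close> choices
  for the rest of the first row, which makes up for the smaller determinant of the remaining block.\<close>

proposition card_hermite_le:
  fixes p q :: "'n::finite"
  assumes p: "idx p = 0" and q: "idx q = 1" and X: "X > 0"
  shows "finite (hermite p c X)"
    and "real (card (hermite p c X)) \<le> 2 * 4 ^ CARD('n) * X ^ (CARD('n) - 1)"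
proof -
  let ?k = "CARD('n)"
  define D where "D = {d :: 'n \<Rightarrow> int. real_of_int (d p) = c \<and> (\<forall>i. d i \<noteq> 0) \<and> (\<Prod>i\<in>UNIV. \<bar>real_of_int (d i)\<bar>) \<le> X}"
  have finD: "finite D" and sumD: "(\<Sum>d\<in>D. \<Prod>i\<in>UNIV. \<bar>real_of_int (d i)\<bar> ^ (?k - 1 - idx i)) \<le> 2 * 4 ^ ?k * X ^ (?k - 1)"
    unfolding D_def using sum_diagonals_le[OF p q X] by auto
  define W where "W = Sigma (UNIV :: 'n set) (\<lambda>i. {j :: 'n. idx i < idx j})"
  define F where "F d = (\<Pi>\<^sub>E z\<in>W. {0..<\<bar>d (fst z)\<bar>})" for d :: "'n \<Rightarrow> int"
  have finF: "finite (F d)" for d unfolding F_def W_def by (intro finite_PiE) auto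
  have cardF: "real (card (F d)) = (\<Prod>i\<in>UNIV. \<bar>real_of_int (d i)\<bar> ^ (?k - 1 - idx i))" for d
  proof -
    have "real (card (F d)) = (\<Prod>z\<in>W. \<bar>real_of_int (d (fst z))\<bar>)"
      by (simp add: F_def W_def card_PiE)
    also have "\<dots> = (\<Prod>i\<in>UNIV. \<Prod>j\<in>{j :: 'n. idx i < idx j}. \<bar>real_of_int (d i)\<bar>)"
      unfolding W_def by (subst prod.Sigma) (auto simp: case_prod_beta)
    finally show ?thesis by (simp add: card_idx_greater)
  qed
  define \<phi> where "\<phi> H = (\<lambda>i. \<lfloor>H $ i $ i\<rfloor>, \<lambda>z\<in>W. \<lfloor>H $ fst z $ snd z\<rfloor>)" for H :: "real ^ 'n ^ 'n"
  have floor: "H $ i $ j = of_int \<lfloor>H $ i $ j\<rfloor>" if "H \<in> hermite p c X" for H i j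
    using that by (simp add: hermite_def)
  have "inj_on \<phi> (hermite p c X)"
  proof (rule inj_onI)
    fix H H' :: "real ^ 'n ^ 'n"
    assume H: "H \<in> hermite p c X" "H' \<in> hermite p c X" and eq: "\<phi> H = \<phi> H'"
    have "H $ i $ j = H' $ i $ j" for i j
    proof -
      consider "idx j < idx i" | "i = j" | "idx i < idx j" by (metis idx_eq_iff linorder_less_linear)
      then show ?thesis
      proof cases
        case 1
        then show ?thesis using H by (simp add: hermite_def upper_triangular_def)
      next
        case 2
        have "\<lfloor>H $ i $ i\<rfloor> = \<lfloor>H' $ i $ i\<rfloor>" using eq by (auto simp: \<phi>_def dest: fun_cong)
        then show ?thesis using floor[OF H(1), of i i] floor[OF H(2), of i i] 2 by simp
      next
        case 3
        then have "(i, j) \<in> W" by (simp add: W_def)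
        then have "\<lfloor>H $ i $ j\<rfloor> = \<lfloor>H' $ i $ j\<rfloor>"
        proof -
          have "(\<lambda>z\<in>W. \<lfloor>H $ fst z $ snd z\<rfloor>) = (\<lambda>z\<in>W. \<lfloor>H' $ fst z $ snd z\<rfloor>)"
            using eq by (simp add: \<phi>_def)
          from fun_cong[OF this, of "(i, j)"] show ?thesis using \<open>(i, j) \<in> W\<close> by simp
        qed
        then show ?thesis using floor[OF H(1), of i j] floor[OF H(2), of i j] by simp
      qed
    qed
    then show "H = H'" by (simp add: vec_eq_iff)
  qed
  moreover have "\<phi> ` hermite p c X \<subseteq> Sigma D F"
  proof (rule image_subsetI)
    fix H :: "real ^ 'n ^ 'n" assume H: "H \<in> hermite p c X"
    have det: "det H = (\<Prod>i\<in>UNIV. H $ i $ i)" using H by (intro det_upper_triangular) (simp add: hermite_def)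
    have fl: "real_of_int \<lfloor>H $ i $ j\<rfloor> = H $ i $ j" for i j using floor[OF H] by simp
    have "H $ i $ i \<noteq> 0" for i using H det by (auto simp: hermite_def)
    then have nz: "\<lfloor>H $ i $ i\<rfloor> \<noteq> 0" for i using fl[of i i] by (metis of_int_0)
    have "(\<lambda>i. \<lfloor>H $ i $ i\<rfloor>) \<in> D"
      using H nz unfolding D_def by (simp add: fl) (simp add: hermite_def det abs_prod)
    moreover have "(\<lambda>z\<in>W. \<lfloor>H $ fst z $ snd z\<rfloor>) \<in> F (\<lambda>i. \<lfloor>H $ i $ i\<rfloor>)"
    proof -
      have "\<lfloor>H $ i $ j\<rfloor> \<in> {0..<\<bar>\<lfloor>H $ i $ i\<rfloor>\<bar>}" if "idx i < idx j" for i j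
      proof -
        have *: "0 \<le> H $ i $ j" "H $ i $ j < \<bar>H $ i $ i\<bar>"
          using H that by (auto simp: hermite_def reduced_row_def)
        have "real_of_int \<lfloor>H $ i $ j\<rfloor> < real_of_int \<bar>\<lfloor>H $ i $ i\<rfloor>\<bar>" using *(2) by (simp add: fl)
        then show ?thesis using *(1) by simp
      qed
      then show ?thesis by (auto simp: F_def W_def)
    qed
    ultimately show "\<phi> H \<in> Sigma D F" by (simp add: \<phi>_def)
  qed
  moreover have fin: "finite (Sigma D F)" using finD finF by blast
  ultimately show "finite (hermite p c X)" "real (card (hermite p c X)) \<le> 2 * 4 ^ ?k * X ^ (?k - 1)"
  proof -
    assume inj: "inj_on \<phi> (hermite p c X)" and sub: "\<phi> ` hermite p c X \<subseteq> Sigma D F"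
    show "finite (hermite p c X)" using inj sub fin by (rule inj_on_finite)
    have "real (card (hermite p c X)) \<le> real (card (Sigma D F))"
      using card_inj_on_le[OF inj sub fin] by simp
    also have "\<dots> = (\<Sum>d\<in>D. real (card (F d)))" using finD finF by (simp add: card_SigmaI)
    also have "\<dots> \<le> 2 * 4 ^ ?k * X ^ (?k - 1)" using sumD by (simp add: cardF)
    finally show "real (card (hermite p c X)) \<le> 2 * 4 ^ ?k * X ^ (?k - 1)" .
  qed
qed

section \<open>Lattice points far from the origin\<close>

text \<open>Write \<open>A = s C\<close> with \<open>C\<close> in the fundamental domain and \<open>s \<le> 1 / r\<close>. A reduced matrix \<open>B = s C \<gamma>\<close> in
  the orbit cannot be much smaller than \<open>A\<close>, because \<open>C \<gamma>\<close> is not closer to the identity than \<open>C\<close>. As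
  \<open>|B| |v| ^ (k - 1) \<le> K s ^ k\<close> for the first column \<open>v\<close> of \<open>B\<close>, a large \<open>A\<close> forces \<open>v\<close> to be short. For
  \<open>k = 1\<close> the same inequality bounds \<open>B\<close>, and no such \<open>A\<close> exists.\<close>

lemma closest_reduced_basis:
  fixes e :: "nat \<Rightarrow> 'n::finite \<times> 'n" and A :: "real ^ 'n ^ 'n" and p :: 'n
  defines "K \<equiv> real (CARD('n) * CARD('n) * 2 ^ (CARD('n) * CARD('n)))"
  assumes int: "\<And>i j. A $ i $ j \<in> \<int>" and p: "idx p = 0" and r: "r > 0" and \<epsilon>: "\<epsilon> > 0"
    and cone: "r *\<^sub>R A \<in> unit_cone (fund_domain e)"
    and far: "norm (r *\<^sub>R A) > K / \<epsilon> ^ (CARD('n) - 1) + 2 * norm (mat 1 :: real ^ 'n ^ 'n)"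
  obtains B where "B \<in> SL_orbit A" "0 < det B" "det B \<le> inverse r ^ CARD('n)" "norm (column p B) < \<epsilon> / r"
    "CARD('n) \<ge> 2"
proof -
  let ?k = "CARD('n)"
  let ?n1 = "norm (mat 1 :: real ^ 'n ^ 'n)"
  obtain t C where C: "r *\<^sub>R A = t *\<^sub>R C" "C \<in> fund_domain e" "0 \<le> t" "t \<le> 1"
    using cone by (auto simp: unit_cone_def)
  have "K / \<epsilon> ^ (?k - 1) \<ge> 0" using \<epsilon> by (simp add: K_def)
  then have "norm (r *\<^sub>R A) > 0" using far norm_ge_zero[of "mat 1 :: real ^ 'n ^ 'n"] by linarith
  then have t: "t > 0" using C(1,3) by (cases "t = 0") auto
  define s where "s = t / r"
  have s: "s > 0" "s \<le> inverse r" using t r C(4) by (auto simp: s_def divide_simps)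
  have A: "A = s *\<^sub>R C"
  proof -
    have "A = inverse r *\<^sub>R (r *\<^sub>R A)" using r by simp
    also have "\<dots> = s *\<^sub>R C" unfolding C(1) by (simp add: s_def divide_inverse mult.commute)
    finally show ?thesis .
  qed
  have detA: "det A = s ^ ?k" by (simp add: A det_scaleR fund_domainD(1)[OF C(2)])
  then have "det A > 0" using s by simp
  from exists_reduced_in_orbit[OF int this p] obtain B where B: "B \<in> SL_orbit A"
    and red: "norm B * norm (column p B) ^ (?k - 1) \<le> K * s ^ ?k"
    unfolding K_def detA by blast
  have detB: "det B = s ^ ?k" using det_SL_orbit[OF B] detA by simp
  obtain \<gamma> where g: "\<gamma> \<in> SL_int" "B = A ** \<gamma>" using B by (auto simp: SL_orbit_def)
  have "norm (r *\<^sub>R A) \<le> norm C" using C by (simp add: mult_left_le_one_le)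
  moreover have "norm C - ?n1 \<le> norm (C ** \<gamma>) + ?n1"
    using fund_domainD(2)[OF C(2) g(1)] norm_triangle_ineq2[of C "mat 1"] norm_triangle_ineq4[of "C ** \<gamma>" "mat 1"]
    by linarith
  ultimately have "K / \<epsilon> ^ (?k - 1) < norm (C ** \<gamma>)" using far by linarith
  then have "s * (K / \<epsilon> ^ (?k - 1)) < s * norm (C ** \<gamma>)" using s by (intro mult_strict_left_mono)
  moreover have "norm B = s * norm (C ** \<gamma>)" using s by (simp add: g(2) A scaleR_matrix_mult)
  ultimately have big: "s * (K / \<epsilon> ^ (?k - 1)) < norm B" by simp
  have "norm (column p B) < \<epsilon> / r"
  proof (rule ccontr)
    assume "\<not> ?thesis"
    moreover have "\<epsilon> * s \<le> \<epsilon> * inverse r" using s \<epsilon> by (intro mult_left_mono) auto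
    ultimately have "\<epsilon> * s \<le> norm (column p B)" by (simp add: divide_inverse)
    then have pw: "(\<epsilon> * s) ^ (?k - 1) \<le> norm (column p B) ^ (?k - 1)"
      using s \<epsilon> by (intro power_mono) auto
    have pos: "0 < (\<epsilon> * s) ^ (?k - 1)" using s \<epsilon> by simp
    have "?k = Suc (?k - 1)" by simp
    then have "s ^ ?k = s * s ^ (?k - 1)" by (metis power_Suc)
    then have "K * s ^ ?k = (s * (K / \<epsilon> ^ (?k - 1))) * (\<epsilon> * s) ^ (?k - 1)"
      using \<epsilon> by (simp add: power_mult_distrib)
    also have "\<dots> < norm B * (\<epsilon> * s) ^ (?k - 1)" using big pos by (intro mult_strict_right_mono)
    also have "\<dots> \<le> norm B * norm (column p B) ^ (?k - 1)" using pw by (intro mult_left_mono) auto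
    finally show False using red by simp
  qed
  moreover have "?k \<ge> 2"
  proof (rule ccontr)
    assume "\<not> 2 \<le> ?k"
    moreover have "0 < ?k" by simp
    ultimately have "?k = 1" by linarith
    then show False using big red by (simp add: mult.commute)
  qed
  moreover have "det B \<le> inverse r ^ ?k" unfolding detB using s by (intro power_mono) auto
  ultimately show thesis using that B detB s by simp
qed

text \<open>Equal determinants give equal scaling factors, so both matrices are rescaled to elements of the
  fundamental domain in one orbit.\<close>

lemma unit_cone_orbit_unique:
  fixes A A' :: "real ^ 'n ^ 'n"
  assumes "r > 0" "det A > 0" "A' \<in> SL_orbit A"
    and "r *\<^sub>R A \<in> unit_cone (fund_domain e)" "r *\<^sub>R A' \<in> unit_cone (fund_domain e)"
  shows "A = A'"
proof -
  have det: "det A' = det A" by (rule det_SL_orbit[OF assms(3)])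
  define s where "s = inverse (det_root (r *\<^sub>R A))"
  have pos: "det (r *\<^sub>R A) > 0" "det (r *\<^sub>R A') > 0" using assms(1,2) det by (simp_all add: det_scaleR)
  have s: "s > 0" using det_root_pos[OF pos(1)] by (simp add: s_def)
  have "det_root (r *\<^sub>R A') = det_root (r *\<^sub>R A)" by (simp add: det_root_def det_scaleR det)
  then have F: "s *\<^sub>R r *\<^sub>R A \<in> fund_domain e" "s *\<^sub>R r *\<^sub>R A' \<in> fund_domain e"
    using assms(4,5) pos by (simp_all add: unit_cone_iff s_def)
  obtain \<gamma> where "\<gamma> \<in> SL_int" "A' = A ** \<gamma>" using assms(3) by (auto simp: SL_orbit_def)
  then have "s *\<^sub>R r *\<^sub>R A' \<in> SL_orbit (s *\<^sub>R r *\<^sub>R A)"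
    using SL_orbit_mult[of \<gamma> "s *\<^sub>R r *\<^sub>R A"] by (simp add: scaleR_matrix_mult)
  then have "s *\<^sub>R r *\<^sub>R A = s *\<^sub>R r *\<^sub>R A'" by (rule fund_domain_unique[OF F])
  then show ?thesis using s assms(1) by simp
qed

text \<open>The far lattice points are mapped injectively to pairs \<open>(v, H)\<close>, where \<open>v\<close> is the short first column of
  a reduced matrix \<open>B\<close> in the orbit, and \<open>H\<close> is a Hermite normal form of \<open>U\<^sub>v B\<close> with a fixed unimodular
  \<open>U\<^sub>v\<close> that takes \<open>v\<close> to a multiple of the first coordinate vector. The pair determines the orbit, as
  \<open>U\<^sub>v\<close> is invertible and depends on \<open>v\<close> only.\<close>

lemma card_far_lattice_points:
  fixes e :: "nat \<Rightarrow> 'n::finite \<times> 'n"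
  defines "K \<equiv> real (CARD('n) * CARD('n) * 2 ^ (CARD('n) * CARD('n)))"
  assumes r: "r > 0" and \<epsilon>: "\<epsilon> > 0"
    and R: "R \<ge> K / \<epsilon> ^ (CARD('n) - 1) + 2 * norm (mat 1 :: real ^ 'n ^ 'n)"
  defines "S \<equiv> {A. (\<forall>i j. A $ i $ j \<in> \<int>) \<and> r *\<^sub>R A \<in> unit_cone (fund_domain e) - cball 0 R}"
  shows "finite S" "real (card S) * r ^ (CARD('n) * CARD('n)) \<le> 2 * 12 ^ CARD('n) * \<epsilon> ^ CARD('n)"
proof -
  let ?k = "CARD('n)"
  obtain p :: 'n where p: "idx p = 0" using idx_surj[of 0] by auto
  define X where "X = inverse r ^ ?k"
  have X: "X > 0" using r by (simp add: X_def)
  define V where "V = {v :: real ^ 'n. (\<forall>i. v $ i \<in> \<int>) \<and> v \<noteq> 0 \<and> norm v < \<epsilon> / r}"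
  have "\<exists>U c. U \<in> SL_int \<and> c \<in> \<int> \<and> c \<noteq> 0 \<and> U *v v = c *\<^sub>R axis p 1" if "v \<in> V" for v
    using that by (intro exists_SL_int_to_axis) (auto simp: V_def)
  then obtain U c where U: "\<And>v. v \<in> V \<Longrightarrow> U v \<in> SL_int" "\<And>v. v \<in> V \<Longrightarrow> U v *v v = c v *\<^sub>R axis p 1"
    by metis
  have "\<exists>v H. v \<in> V \<and> H \<in> hermite p (c v) X \<and> H \<in> SL_orbit (U v ** A) \<and> ?k \<ge> 2 \<and> det A > 0" if A: "A \<in> S" for A
  proof -
    have intA: "\<And>i j. A $ i $ j \<in> \<int>" and cone: "r *\<^sub>R A \<in> unit_cone (fund_domain e)" and "norm (r *\<^sub>R A) > R"
      using A by (auto simp: S_def)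
    then have far: "norm (r *\<^sub>R A) > K / \<epsilon> ^ (?k - 1) + 2 * norm (mat 1 :: real ^ 'n ^ 'n)" using R by linarith
    obtain B where B: "B \<in> SL_orbit A" "0 < det B" "det B \<le> X" "norm (column p B) < \<epsilon> / r" "?k \<ge> 2"
      unfolding X_def by (rule closest_reduced_basis[OF intA p r \<epsilon> cone far[unfolded K_def]])
    have intB: "B $ i $ j \<in> \<int>" for i j using SL_orbit_Ints[OF B(1) intA] .
    define v where "v = column p B"
    have "v \<noteq> 0"
    proof
      assume "v = 0"
      then have "det B = 0" by (intro det_zero_column(1)[of p]) (simp add: v_def)
      then show False using B(2) by simp
    qed
    then have v: "v \<in> V" using B(4) intB by (simp add: V_def v_def column_def)
    define B' where "B' = U v ** B"
    have detU: "det (U v) = 1" and intU: "\<And>i j. U v $ i $ j \<in> \<int>" using U(1)[OF v] by (auto simp: SL_int_def)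
    have detB': "det B' = det B" by (simp add: B'_def det_mul detU)
    have intB': "B' $ i $ j \<in> \<int>" for i j
      using intB intU by (simp add: B'_def matrix_matrix_mult_def Ints_sum Ints_mult)
    have "column p B' = U v *v v"
      by (simp add: B'_def v_def column_def matrix_matrix_mult_def matrix_vector_mult_def)
    then have colB': "column p B' = c v *\<^sub>R axis p 1" using U(2)[OF v] by simp
    then have "B' $ i $ p = (if i = p then c v else 0)" for i
      by (auto simp: column_def vec_eq_iff axis_def)
    then obtain H where H: "H \<in> SL_orbit B'" "column p H = column p B'" "upper_triangular H" "\<And>i. reduced_row H i"
      using exists_hermite_in_orbit[of B' p] intB' detB' B(2) p by (metis less_irrefl)
    have "H $ p $ p = column p H $ p" by (simp add: column_def)
    then have "H $ p $ p = c v" by (simp add: H(2) colB' axis_def)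
    moreover have "H $ i $ j \<in> \<int>" for i j using SL_orbit_Ints[OF H(1) intB'] .
    ultimately have "H \<in> hermite p (c v) X"
      using H(3) allI[OF H(4)] B(2,3) det_SL_orbit[OF H(1)] detB' by (simp add: hermite_def)
    moreover have "H \<in> SL_orbit (U v ** A)"
    proof -
      obtain \<gamma> where "\<gamma> \<in> SL_int" "B = A ** \<gamma>" using B(1) by (auto simp: SL_orbit_def)
      then have "B' \<in> SL_orbit (U v ** A)"
        using SL_orbit_mult[of \<gamma> "U v ** A"] by (simp add: B'_def matrix_mul_assoc)
      then show ?thesis using H(1) SL_orbit_trans by blast
    qed
    moreover have "det A > 0" using det_SL_orbit[OF B(1)] B(2) by simp
    ultimately show ?thesis using v B(5) by blast
  qed
  then obtain v H where vH: "\<And>A. A \<in> S \<Longrightarrow> v A \<in> V" "\<And>A. A \<in> S \<Longrightarrow> H A \<in> hermite p (c (v A)) X"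
      "\<And>A. A \<in> S \<Longrightarrow> H A \<in> SL_orbit (U (v A) ** A)" "\<And>A. A \<in> S \<Longrightarrow> ?k \<ge> 2" "\<And>A. A \<in> S \<Longrightarrow> det A > 0"
    by metis
  have "finite S \<and> real (card S) * r ^ (?k * ?k) \<le> 2 * 12 ^ ?k * \<epsilon> ^ ?k"
  proof (cases "S = {}")
    case True
    then show ?thesis using \<epsilon> by simp
  next
    case False
    then obtain A0 where A0: "A0 \<in> S" by blast
    have k: "?k \<ge> 2" by (rule vH(4)[OF A0])
    then have "\<exists>q :: 'n. idx q = 1" by (intro idx_surj) simp
    then obtain q :: 'n where q: "idx q = 1" by blast
    \<comment> \<open>A nonzero integer vector has length at least \<open>1\<close>, so \<open>2 \<epsilon> / r + 1\<close> is at most \<open>3 \<epsilon> / r\<close> below.\<close>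
    have "\<epsilon> / r > 1"
    proof -
      have v: "v A0 \<in> V" by (rule vH(1)[OF A0])
      then obtain i where i: "v A0 $ i \<noteq> 0" by (auto simp: V_def vec_eq_iff)
      have "v A0 $ i \<in> \<int>" using v by (simp add: V_def)
      then have "1 \<le> \<bar>v A0 $ i\<bar>" using i by (rule Ints_nonzero_abs_ge1)
      also have "\<dots> \<le> norm (v A0)" by (rule component_le_norm_cart)
      also have "\<dots> < \<epsilon> / r" using v by (simp add: V_def)
      finally show ?thesis .
    qed
    let ?V' = "{v :: real ^ 'n. (\<forall>i. v $ i \<in> \<int>) \<and> (\<forall>i. \<bar>v $ i\<bar> \<le> \<epsilon> / r)}"
    have "V \<subseteq> ?V'" by (auto simp: V_def intro: order_trans[OF component_le_norm_cart] less_imp_le)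
    then have finV: "finite V" and "card V \<le> card ?V'"
      by (rule finite_subset card_mono[rotated], intro finite_bounded_integer_vectors)+
    then have "real (card V) \<le> (2 * (\<epsilon> / r) + 1) ^ ?k"
      using card_bounded_integer_vectors[of "\<epsilon> / r", where 'n = 'n] \<open>\<epsilon> / r > 1\<close> by linarith
    also have "\<dots> \<le> (3 * (\<epsilon> / r)) ^ ?k" using \<open>\<epsilon> / r > 1\<close> by (intro power_mono) auto
    finally have cardV: "real (card V) \<le> (3 * (\<epsilon> / r)) ^ ?k" .
    have inj: "inj_on (\<lambda>A. (v A, H A)) S"
    proof (rule inj_onI)
      fix A A' assume AA: "A \<in> S" "A' \<in> S" and eq: "(v A, H A) = (v A', H A')"
      obtain W where W: "W ** U (v A) = mat 1" using SL_int_inverse[OF U(1)[OF vH(1)[OF AA(1)]]] by metis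
      have "H A \<in> SL_orbit (U (v A) ** A)" "H A \<in> SL_orbit (U (v A) ** A')"
        using vH(3)[OF AA(1)] vH(3)[OF AA(2)] eq by simp_all
      then have "U (v A) ** A' \<in> SL_orbit (U (v A) ** A)"
        using SL_orbit_trans SL_orbit_sym by blast
      then obtain \<gamma> where g: "\<gamma> \<in> SL_int" "U (v A) ** A' = U (v A) ** A ** \<gamma>" by (auto simp: SL_orbit_def)
      have "A' = W ** (U (v A) ** A')" by (simp add: matrix_mul_assoc W)
      also have "\<dots> = (W ** U (v A)) ** (A ** \<gamma>)" by (simp only: g(2) matrix_mul_assoc)
      finally have "A' = A ** \<gamma>" by (simp add: W)
      then have "A' \<in> SL_orbit A" using g(1) by (simp add: SL_orbit_mult)
      then show "A = A'"
        using AA vH(5)[OF AA(1)] by (intro unit_cone_orbit_unique[OF r, of A A' e]) (auto simp: S_def)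
    qed
    have sub: "(\<lambda>A. (v A, H A)) ` S \<subseteq> Sigma V (\<lambda>v. hermite p (c v) X)" using vH(1,2) by auto
    have fin: "finite (Sigma V (\<lambda>v. hermite p (c v) X))"
      using finV card_hermite_le(1)[OF p q X] by blast
    have "real (card S) \<le> real (card (Sigma V (\<lambda>v. hermite p (c v) X)))"
      using card_inj_on_le[OF inj sub fin] by simp
    also have "\<dots> = (\<Sum>v\<in>V. real (card (hermite p (c v) X)))"
      using finV card_hermite_le(1)[OF p q X] by (simp add: card_SigmaI)
    also have "\<dots> \<le> (\<Sum>v\<in>V. 2 * 4 ^ ?k * X ^ (?k - 1))"
      by (intro sum_mono card_hermite_le(2)[OF p q X])
    also have "\<dots> = real (card V) * (2 * 4 ^ ?k * X ^ (?k - 1))" by simp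
    also have "\<dots> \<le> (3 * (\<epsilon> / r)) ^ ?k * (2 * 4 ^ ?k * X ^ (?k - 1))"
      using cardV X by (intro mult_right_mono) auto
    finally have "real (card S) * r ^ (?k * ?k) \<le> (3 * (\<epsilon> / r)) ^ ?k * (2 * 4 ^ ?k * X ^ (?k - 1)) * r ^ (?k * ?k)"
      using r by (intro mult_right_mono) auto
    also have "\<dots> = 2 * 12 ^ ?k * \<epsilon> ^ ?k"
    proof -
      have "r ^ (?k * ?k) = (r ^ ?k) ^ Suc (?k - 1)" by (simp add: power_mult)
      then have rk: "r ^ (?k * ?k) = r ^ ?k * (r ^ ?k) ^ (?k - 1)" by (simp only: power_Suc)
      have "X ^ (?k - 1) * (r ^ ?k) ^ (?k - 1) = (X * r ^ ?k) ^ (?k - 1)" by (simp only: power_mult_distrib)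
      also have "X * r ^ ?k = 1" using r by (simp add: X_def power_inverse)
      finally have Xr: "X ^ (?k - 1) * (r ^ ?k) ^ (?k - 1) = 1" by simp
      have er: "(3 * (\<epsilon> / r)) ^ ?k * r ^ ?k = 3 ^ ?k * \<epsilon> ^ ?k"
        using r by (simp add: power_mult_distrib power_divide)
      have "(12 :: real) ^ ?k = 3 ^ ?k * 4 ^ ?k" by (simp flip: power_mult_distrib)
      moreover have "(3 * (\<epsilon> / r)) ^ ?k * (2 * 4 ^ ?k * X ^ (?k - 1)) * r ^ (?k * ?k) =
          ((3 * (\<epsilon> / r)) ^ ?k * r ^ ?k) * (2 * 4 ^ ?k) * (X ^ (?k - 1) * (r ^ ?k) ^ (?k - 1))"
        unfolding rk by (simp only: mult_ac)
      ultimately show ?thesis unfolding er Xr by simp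
    qed
    finally show ?thesis using inj_on_finite[OF inj sub fin] by blast
  qed
  then show "finite S" "real (card S) * r ^ (?k * ?k) \<le> 2 * 12 ^ ?k * \<epsilon> ^ ?k" by auto
qed

proposition unit_cone_tail:
  fixes e :: "nat \<Rightarrow> 'n::finite \<times> 'n"
  assumes "\<delta> > 0"
  shows "\<exists>R. \<forall>r>0. lattice_count (unit_cone (fund_domain e) - cball 0 R) r \<le> ennreal \<delta>"
proof -
  let ?k = "CARD('n)"
  define \<epsilon> where "\<epsilon> = min 1 (\<delta> / (2 * 12 ^ ?k))"
  have \<epsilon>: "\<epsilon> > 0" "\<epsilon> \<le> 1" using assms by (auto simp: \<epsilon>_def)
  \<comment> \<open>\<open>\<epsilon> \<le> 1\<close> was imposed to get rid of the exponent.\<close>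
  have "2 * 12 ^ ?k * \<epsilon> ^ ?k \<le> 2 * 12 ^ ?k * \<epsilon>"
    using \<epsilon> power_decreasing[of 1 ?k \<epsilon>] by (simp add: Suc_leI)
  also have "\<dots> \<le> 2 * 12 ^ ?k * (\<delta> / (2 * 12 ^ ?k))"
    by (intro mult_left_mono) (auto simp: \<epsilon>_def)
  finally have \<delta>: "2 * 12 ^ ?k * \<epsilon> ^ ?k \<le> \<delta>" by simp
  define R where "R = real (?k * ?k * 2 ^ (?k * ?k)) / \<epsilon> ^ (?k - 1) + 2 * norm (mat 1 :: real ^ 'n ^ 'n)"
  have "lattice_count (unit_cone (fund_domain e) - cball 0 R) r \<le> ennreal \<delta>" if r: "r > 0" for r
  proof -
    define S where "S = {A. (\<forall>i j. A $ i $ j \<in> \<int>) \<and> r *\<^sub>R A \<in> unit_cone (fund_domain e) - cball 0 R}"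
    have S: "finite S" "real (card S) * r ^ (?k * ?k) \<le> 2 * 12 ^ ?k * \<epsilon> ^ ?k"
      using card_far_lattice_points[OF r \<epsilon>(1), of R e] unfolding S_def R_def by auto
    have eq: "(unit_cone (fund_domain e) - cball 0 R) \<inter> (\<lambda>x. r *\<^sub>R x) ` int_lattice = (\<lambda>x. r *\<^sub>R x) ` S"
      by (auto simp: S_def int_lattice_matrix)
    have "card ((\<lambda>x. r *\<^sub>R x) ` S) = card S" using r by (intro card_image) (simp add: inj_on_def)
    then have "lattice_count (unit_cone (fund_domain e) - cball 0 R) r = ennreal (r ^ (?k * ?k)) * ennreal (real (card S))"
      unfolding lattice_count_def eq using S(1)
      by (simp add: emeasure_count_space_finite ennreal_of_nat_eq_real_of_nat)
    also have "\<dots> = ennreal (real (card S) * r ^ (?k * ?k))"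
      using r by (simp add: ennreal_mult mult.commute)
    also have "\<dots> \<le> ennreal \<delta>" using S(2) \<delta> by (intro ennreal_leI) linarith
    finally show ?thesis .
  qed
  then show ?thesis by blast
qed

section \<open>Volume and limiting lattice count\<close>

theorem theorem3p15:
  fixes e :: "nat \<Rightarrow> 'n::finite \<times> 'n"
  assumes "entry_enum e"
  shows "unit_cone (fund_domain e) \<in> sets lebesgue \<and>
         has_mu_Z (unit_cone (fund_domain e)) \<and>
         emeasure lebesgue (unit_cone (fund_domain e)) = mu_Z (unit_cone (fund_domain e))"
proof -
  note limit = lattice_count_tendsto_volume[OF negligible_frontier_unit_cone[of e] unit_cone_tail]
  have "mu_Z (unit_cone (fund_domain e)) = emeasure lebesgue (unit_cone (fund_domain e))"
    unfolding mu_Z_def by (rule tendsto_Lim[OF _ limit(2)]) simp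
  then show ?thesis using limit by (auto simp: has_mu_Z_def)
qed

end
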